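(* Let $\mathcal{M}$ be a smooth oriented $(n+2)$-dimensional manifold. Then the following statements are equivalent. (1) $\mathcal{M}$ is endowed with a generalised optical structure $(K,\mathbf{o})$. (2) $\mathcal{M}$ is endowed with a pair of distributions $K^{(1)}$ and $K^{(n+1)}$ of rank $1$ and $n+1$ respectively such that $K^{(1)}\subset K^{(n+1)}$, and its associated screen bundle $K^{(n+1)}/K^{(1)}$ is equipped with a conformal structure of Riemannian signature.
   Context: A generalised optical structure on a smooth manifold $\mathcal{M}$ is a pair $(K,\mathbf{o})$ where $K\subset T\mathcal{M}$ is a line distribution and $\mathbf{o}$ is an equivalence class of Lorentzian metrics such that (i) $K$ is null with respect to each $g\in\mathbf{o}$; (ii) any two metrics $g,\tilde g$ in $\mathbf{o}$ are related by $\tilde g=e^{2\varphi}(g+2\,\kappa\,\alpha)$ for some smooth function $\varphi$ and $1$-form $\alpha$ on $\mathcal{M}$, where $\kappa=g(k,\cdot)$ for any non-vanishing section $k$ of $K$ and $\kappa\,\alpha=\frac12(\kappa\otimes\alpha+\alpha\otimes\kappa)$. A conformal structure of Riemannian signature on a vector bundle is an equivalence class of positive definite bundle metrics, any two being related by a positive smooth factor.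
   Formalization: In (2) the screen bundle is additionally required to be orientable; without this, some pairs of distributions on an oriented manifold come from no Lorentzian metric. Every structure in (1) is shown to induce an orientable screen bundle. *)

theory Defs
  imports "HOL-Analysis.Analysis" "HOL-Combinatorics.Permutations"
begin

section \<open>Smooth maps between open subsets of Euclidean spaces\<close>

primrec Ck_on :: "nat \<Rightarrow> 'a::euclidean_space set \<Rightarrow> ('a \<Rightarrow> 'b::real_normed_vector) \<Rightarrow> bool" where
  "Ck_on 0 S f \<longleftrightarrow> continuous_on S f"
| "Ck_on (Suc k) S f \<longleftrightarrow> (\<forall>x\<in>S. f differentiable (at x)) \<and>
     (\<forall>v. Ck_on k S (\<lambda>x. frechet_derivative f (at x) v))"

text \<open>Only used for open \<open>S\<close>.\<close>
definition Cinf_on :: "'a::euclidean_space set \<Rightarrow> ('a \<Rightarrow> 'b::real_normed_vector) \<Rightarrow> bool" where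
  "Cinf_on S f \<longleftrightarrow> (\<forall>k. Ck_on k S f)"

section \<open>Oriented smooth manifolds\<close>

text \<open>The manifold is the whole of a Hausdorff, second countable type \<open>'m\<close>, with an atlas
  (not necessarily maximal) of charts with values in \<open>real^'d\<close>. A chart is its domain together with
  its coordinate map, whose values off the domain are irrelevant.\<close>

type_synonym ('m, 'd) chart = "'m set \<times> ('m \<Rightarrow> real^'d)"

definition chart_inv :: "('m, 'd::finite) chart \<Rightarrow> real^'d \<Rightarrow> 'm" where
  "chart_inv c = inv_into (fst c) (snd c)"

definition is_chart :: "('m::topological_space, 'd::finite) chart \<Rightarrow> bool" where
  "is_chart c \<longleftrightarrow> open (fst c) \<and> open (snd c ` fst c) \<and>
     homeomorphism (fst c) (snd c ` fst c) (snd c) (chart_inv c)"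

definition smooth_atlas :: "('m::topological_space, 'd::finite) chart set \<Rightarrow> bool" where
  "smooth_atlas A \<longleftrightarrow> (\<forall>c\<in>A. is_chart c) \<and> (\<Union>c\<in>A. fst c) = UNIV \<and>
     (\<forall>c\<in>A. \<forall>c'\<in>A. Cinf_on (snd c ` (fst c \<inter> fst c')) (snd c' \<circ> chart_inv c))"

text \<open>The differential at the point \<open>p\<close> of the coordinate change from \<open>c\<close> to \<open>c'\<close>.\<close>
definition transition_deriv ::
    "('m, 'd::finite) chart \<Rightarrow> ('m, 'd) chart \<Rightarrow> 'm \<Rightarrow> real^'d \<Rightarrow> real^'d" where
  "transition_deriv c c' p = frechet_derivative (snd c' \<circ> chart_inv c) (at (snd c p))"

text \<open>An orientation is given by an atlas all of whose coordinate changes have positive Jacobian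
  determinant (in dimension at least one, every oriented manifold has such an atlas).\<close>
definition oriented_smooth_atlas :: "('m::topological_space, 'd::finite) chart set \<Rightarrow> bool" where
  "oriented_smooth_atlas A \<longleftrightarrow> smooth_atlas A \<and>
     (\<forall>c\<in>A. \<forall>c'\<in>A. \<forall>p\<in>fst c \<inter> fst c'. det (matrix (transition_deriv c c' p)) > 0)"

section \<open>Tangent vectors and tensor fields\<close>

text \<open>Each tangent space \<open>T\<^sub>pM\<close> is identified with \<open>real^'d\<close> by means of one chart around \<open>p\<close>, chosen
  once and for all. The choice varies with \<open>p\<close> in an arbitrary way, so smoothness of fields is always
  expressed through their components in the charts of the atlas: \<open>to_coord A c p v\<close> is the component
  vector with respect to \<open>c\<close> of the tangent vector \<open>v\<close> at \<open>p\<close>, and \<open>of_coord A c p\<close> is its inverse, so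
  that \<open>of_coord A c p (axis i 1)\<close> is the \<open>i\<close>-th coordinate vector field of \<open>c\<close> at \<open>p\<close>.\<close>

definition base_chart :: "('m, 'd::finite) chart set \<Rightarrow> 'm \<Rightarrow> ('m, 'd) chart" where
  "base_chart A p = (SOME c. c \<in> A \<and> p \<in> fst c)"

definition to_coord ::
    "('m, 'd::finite) chart set \<Rightarrow> ('m, 'd) chart \<Rightarrow> 'm \<Rightarrow> real^'d \<Rightarrow> real^'d" where
  "to_coord A c p = transition_deriv (base_chart A p) c p"

definition of_coord ::
    "('m, 'd::finite) chart set \<Rightarrow> ('m, 'd) chart \<Rightarrow> 'm \<Rightarrow> real^'d \<Rightarrow> real^'d" where
  "of_coord A c p = transition_deriv c (base_chart A p) p"

text \<open>The following three notions are used for open \<open>U\<close>; values outside \<open>U\<close> are irrelevant.\<close>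

definition smooth_fun :: "('m, 'd::finite) chart set \<Rightarrow> 'm set \<Rightarrow> ('m \<Rightarrow> real) \<Rightarrow> bool" where
  "smooth_fun A U f \<longleftrightarrow> (\<forall>c\<in>A. Cinf_on (snd c ` (U \<inter> fst c)) (f \<circ> chart_inv c))"

definition smooth_vector_field ::
    "('m, 'd::finite) chart set \<Rightarrow> 'm set \<Rightarrow> ('m \<Rightarrow> real^'d) \<Rightarrow> bool" where
  "smooth_vector_field A U X \<longleftrightarrow>
     (\<forall>c\<in>A. Cinf_on (snd c ` (U \<inter> fst c)) ((\<lambda>p. to_coord A c p (X p)) \<circ> chart_inv c))"

definition smooth_one_form ::
    "('m, 'd::finite) chart set \<Rightarrow> 'm set \<Rightarrow> ('m \<Rightarrow> real^'d \<Rightarrow> real) \<Rightarrow> bool" where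
  "smooth_one_form A U \<alpha> \<longleftrightarrow> (\<forall>p\<in>U. linear (\<alpha> p)) \<and>
     (\<forall>c\<in>A. \<forall>i. Cinf_on (snd c ` (U \<inter> fst c))
        ((\<lambda>p. \<alpha> p (of_coord A c p (axis i 1))) \<circ> chart_inv c))"

definition lorentzian_form :: "(real^'d::finite \<Rightarrow> real^'d \<Rightarrow> real) \<Rightarrow> bool" where
  "lorentzian_form B \<longleftrightarrow> bilinear B \<and>
     (\<exists>(b :: 'd \<Rightarrow> real^'d) i0. span (range b) = UNIV \<and>
        (\<forall>i j. B (b i) (b j) = (if i \<noteq> j then 0 else if i = i0 then -1 else 1)))"

definition lorentzian_metric ::
    "('m, 'd::finite) chart set \<Rightarrow> ('m \<Rightarrow> real^'d \<Rightarrow> real^'d \<Rightarrow> real) \<Rightarrow> bool" where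
  "lorentzian_metric A g \<longleftrightarrow> (\<forall>p. lorentzian_form (g p)) \<and>
     (\<forall>c\<in>A. \<forall>i j. Cinf_on (snd c ` fst c)
        ((\<lambda>p. g p (of_coord A c p (axis i 1)) (of_coord A c p (axis j 1))) \<circ> chart_inv c))"

section \<open>Distributions\<close>

definition distribution ::
    "('m::topological_space, 'd::finite) chart set \<Rightarrow> nat \<Rightarrow> ('m \<Rightarrow> (real^'d) set) \<Rightarrow> bool" where
  "distribution A r D \<longleftrightarrow> (\<forall>p. subspace (D p) \<and> dim (D p) = r) \<and>
     (\<forall>p. \<exists>U X. open U \<and> p \<in> U \<and> (\<forall>i<r. smooth_vector_field A U (X i)) \<and>
        (\<forall>q\<in>U. D q = span ((\<lambda>i::nat. X i q) ` {..<r})))"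

definition smooth_section :: "('m, 'd::finite) chart set \<Rightarrow> ('m \<Rightarrow> (real^'d) set) \<Rightarrow> 'm set \<Rightarrow>
    ('m \<Rightarrow> real^'d) \<Rightarrow> bool" where
  "smooth_section A D U X \<longleftrightarrow> smooth_vector_field A U X \<and> (\<forall>p\<in>U. X p \<in> D p)"

section \<open>Generalised optical structures\<close>

definition sym_prod :: "('v \<Rightarrow> real) \<Rightarrow> ('v \<Rightarrow> real) \<Rightarrow> 'v \<Rightarrow> 'v \<Rightarrow> real" where
  "sym_prod \<kappa> \<alpha> v w = (\<kappa> v * \<alpha> w + \<alpha> v * \<kappa> w) / 2"

definition null_metrics :: "('m, 'd::finite) chart set \<Rightarrow> ('m \<Rightarrow> (real^'d) set) \<Rightarrow>
    ('m \<Rightarrow> real^'d \<Rightarrow> real^'d \<Rightarrow> real) set" where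
  "null_metrics A K = {g. lorentzian_metric A g \<and> (\<forall>p. \<forall>v\<in>K p. g p v v = 0)}"

text \<open>The relation \<open>g' = exp (2\<phi>) (g + 2\<kappa>\<alpha>)\<close> with \<open>\<kappa> = g(k,\<cdot>)\<close>. As a line distribution need not have a global
  non-vanishing section, \<open>k\<close> ranges over all local ones; \<open>\<phi>\<close> is global, while \<open>\<alpha>\<close> lives where \<open>k\<close> does
  and is determined by \<open>k\<close> and \<open>\<phi>\<close>. When \<open>K\<close> has a global non-vanishing section \<open>k\<close>, the relation for
  this one \<open>k\<close>, with \<open>\<alpha>\<close> a global 1-form, implies it for all others.\<close>
definition optical_rel :: "('m::topological_space, 'd::finite) chart set \<Rightarrow> ('m \<Rightarrow> (real^'d) set) \<Rightarrow>
    (('m \<Rightarrow> real^'d \<Rightarrow> real^'d \<Rightarrow> real) \<times> ('m \<Rightarrow> real^'d \<Rightarrow> real^'d \<Rightarrow> real)) set" where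
  "optical_rel A K = {(g, g'). g \<in> null_metrics A K \<and> g' \<in> null_metrics A K \<and>
     (\<exists>\<phi>. smooth_fun A UNIV \<phi> \<and>
       (\<forall>U k. open U \<and> smooth_section A K U k \<and> (\<forall>p\<in>U. k p \<noteq> 0) \<longrightarrow>
         (\<exists>\<alpha>. smooth_one_form A U \<alpha> \<and>
           (\<forall>p\<in>U. \<forall>v w. g' p v w =
              exp (2 * \<phi> p) * (g p v w + 2 * sym_prod (g p (k p)) (\<alpha> p) v w)))))}"

definition generalised_optical_structure ::
    "('m::topological_space, 'd::finite) chart set \<Rightarrow> ('m \<Rightarrow> (real^'d) set) \<Rightarrow>
     ('m \<Rightarrow> real^'d \<Rightarrow> real^'d \<Rightarrow> real) set \<Rightarrow> bool" where
  "generalised_optical_structure A K \<O> \<longleftrightarrow>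
     distribution A 1 K \<and> \<O> \<in> null_metrics A K // optical_rel A K"

section \<open>The screen bundle and its conformal structures\<close>

text \<open>Elements of the fibre of the quotient bundle \<open>N/K\<close> at \<open>p\<close> are the cosets \<open>v + K p\<close>, \<open>v \<in> N p\<close>.\<close>

definition coset :: "('m \<Rightarrow> (real^'d::finite) set) \<Rightarrow> 'm \<Rightarrow> real^'d \<Rightarrow> (real^'d) set" where
  "coset K p v = (\<lambda>u. v + u) ` K p"

definition screen :: "('m \<Rightarrow> (real^'d::finite) set) \<Rightarrow> ('m \<Rightarrow> (real^'d) set) \<Rightarrow> 'm \<Rightarrow>
    (real^'d) set set" where
  "screen K N p = coset K p ` N p"

text \<open>Positive definite bundle metrics on \<open>N/K\<close>, set to zero off the fibres to make them unique as
  functions. The linear structure of the quotient and the smoothness of its sections are those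
  induced by representatives.\<close>
definition screen_metrics :: "('m::topological_space, 'd::finite) chart set \<Rightarrow>
    ('m \<Rightarrow> (real^'d) set) \<Rightarrow> ('m \<Rightarrow> (real^'d) set) \<Rightarrow>
    ('m \<Rightarrow> (real^'d) set \<Rightarrow> (real^'d) set \<Rightarrow> real) set" where
  "screen_metrics A K N = {h.
     (\<forall>p a b. a \<notin> screen K N p \<or> b \<notin> screen K N p \<longrightarrow> h p a b = 0) \<and>
     (\<forall>p. \<forall>a\<in>screen K N p. \<forall>b\<in>screen K N p. h p a b = h p b a) \<and>
     (\<forall>p. \<forall>u\<in>N p. \<forall>v\<in>N p. \<forall>b\<in>screen K N p. \<forall>r s.
        h p (coset K p (r *\<^sub>R u + s *\<^sub>R v)) b = r * h p (coset K p u) b + s * h p (coset K p v) b) \<and>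
     (\<forall>p. \<forall>a\<in>screen K N p. a \<noteq> coset K p 0 \<longrightarrow> h p a a > 0) \<and>
     (\<forall>U X Y. open U \<and> smooth_section A N U X \<and> smooth_section A N U Y \<longrightarrow>
        smooth_fun A U (\<lambda>p. h p (coset K p (X p)) (coset K p (Y p))))}"

definition conformal_rel :: "('m::topological_space, 'd::finite) chart set \<Rightarrow>
    ('m \<Rightarrow> (real^'d) set) \<Rightarrow> ('m \<Rightarrow> (real^'d) set) \<Rightarrow>
    (('m \<Rightarrow> (real^'d) set \<Rightarrow> (real^'d) set \<Rightarrow> real) \<times>
     ('m \<Rightarrow> (real^'d) set \<Rightarrow> (real^'d) set \<Rightarrow> real)) set" where
  "conformal_rel A K N = {(h, h'). h \<in> screen_metrics A K N \<and> h' \<in> screen_metrics A K N \<and>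
     (\<exists>f. smooth_fun A UNIV f \<and> (\<forall>p. f p > 0) \<and> (\<forall>p a b. h' p a b = f p * h p a b))}"

definition conformal_screen_structure :: "('m::topological_space, 'd::finite) chart set \<Rightarrow> nat \<Rightarrow>
    ('m \<Rightarrow> (real^'d) set) \<Rightarrow> ('m \<Rightarrow> (real^'d) set) \<Rightarrow>
    ('m \<Rightarrow> (real^'d) set \<Rightarrow> (real^'d) set \<Rightarrow> real) set \<Rightarrow> bool" where
  "conformal_screen_structure A n K N \<C> \<longleftrightarrow>
     distribution A 1 K \<and> distribution A (n + 1) N \<and> (\<forall>p. K p \<subseteq> N p) \<and>
     \<C> \<in> screen_metrics A K N // conformal_rel A K N"

text \<open>Orientability of \<open>N/K\<close>, where \<open>N\<close> has rank \<open>n + 1\<close> and \<open>K\<close> rank 1: there are local frames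
  \<open>X 0 + K, \<dots>, X (n - 1) + K\<close> over a cover such that all transition matrices \<open>a\<close> have positive
  determinant (spelt out by the Leibniz formula, since the matrix size is a natural number).\<close>
definition screen_orientable :: "('m::topological_space, 'd::finite) chart set \<Rightarrow> nat \<Rightarrow>
    ('m \<Rightarrow> (real^'d) set) \<Rightarrow> ('m \<Rightarrow> (real^'d) set) \<Rightarrow> bool" where
  "screen_orientable A n K N \<longleftrightarrow>
     (\<exists>F :: ('m set \<times> (nat \<Rightarrow> 'm \<Rightarrow> real^'d)) set.
        (\<Union>(U, X)\<in>F. U) = UNIV \<and>
        (\<forall>(U, X)\<in>F. open U \<and> (\<forall>i<n. smooth_section A N U (X i)) \<and>
           (\<forall>p\<in>U. N p = span (K p \<union> (\<lambda>i. X i p) ` {..<n}))) \<and>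
        (\<forall>(U, X)\<in>F. \<forall>(V, Y)\<in>F. \<forall>p\<in>U \<inter> V. \<forall>a :: nat \<Rightarrow> nat \<Rightarrow> real.
           (\<forall>j<n. Y j p - (\<Sum>i<n. a i j *\<^sub>R X i p) \<in> K p) \<longrightarrow>
           (\<Sum>\<pi> | \<pi> permutes {..<n}. of_int (sign \<pi>) * (\<Prod>i<n. a i (\<pi> i))) > 0))"

section \<open>The structures induced by a generalised optical structure\<close>

definition orth_distribution :: "('m \<Rightarrow> (real^'d::finite) set) \<Rightarrow>
    ('m \<Rightarrow> real^'d \<Rightarrow> real^'d \<Rightarrow> real) set \<Rightarrow> 'm \<Rightarrow> (real^'d) set" where
  "orth_distribution K \<O> p = {w. \<forall>g\<in>\<O>. \<forall>v\<in>K p. g p v w = 0}"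

text \<open>The metric induced by \<open>g\<close> on the screen bundle: the common value of \<open>g p v w\<close> over all
  representatives.\<close>
definition screen_metric_of :: "('m \<Rightarrow> (real^'d::finite) set) \<Rightarrow> ('m \<Rightarrow> (real^'d) set) \<Rightarrow>
    ('m \<Rightarrow> real^'d \<Rightarrow> real^'d \<Rightarrow> real) \<Rightarrow> 'm \<Rightarrow> (real^'d) set \<Rightarrow> (real^'d) set \<Rightarrow> real" where
  "screen_metric_of K N g p a b = (if a \<in> screen K N p \<and> b \<in> screen K N p
     then (THE r. \<forall>v\<in>a. \<forall>w\<in>b. g p v w = r) else 0)"

definition induced_screen_structure :: "('m \<Rightarrow> (real^'d::finite) set) \<times>
      ('m \<Rightarrow> real^'d \<Rightarrow> real^'d \<Rightarrow> real) set \<Rightarrow>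
    ('m \<Rightarrow> (real^'d) set) \<times> ('m \<Rightarrow> (real^'d) set) \<times>
      ('m \<Rightarrow> (real^'d) set \<Rightarrow> (real^'d) set \<Rightarrow> real) set" where
  "induced_screen_structure = (\<lambda>(K, \<O>). (K, orth_distribution K \<O>,
     screen_metric_of K (orth_distribution K \<O>) ` \<O>))"

end

theory Submission
  imports Defs
begin

text \<open>A metric \<open>g\<close> for which the line distribution \<open>K\<close> is null determines \<open>N = K\<^sup>\<bottom>\<close> and a positive
  definite metric on \<open>N/K\<close>. Two such metrics \<open>g\<close>, \<open>g'\<close> are related by \<open>g' = exp (2\<phi>) (g + 2\<kappa>\<alpha>)\<close> exactly
  when \<open>g' = exp (2\<phi>) g\<close> on \<open>N\<close>: a symmetric form \<open>b\<close> vanishing on \<open>N = ker \<kappa>\<close> is \<open>2\<kappa>\<alpha>\<close> with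
  \<open>\<alpha> = b(l,\<cdot>) - b(l,l) \<kappa>/2\<close> for any \<open>l\<close> with \<open>\<kappa>(l) = 1\<close>. So the class of \<open>g\<close> is determined by \<open>K\<close>, \<open>N\<close> and the
  conformal class on \<open>N/K\<close>. Conversely, metrics inducing given \<open>K\<close>, \<open>N\<close> and \<open>h\<close> exist locally. The
  orientations of \<open>TM\<close> and of \<open>N/K\<close> single out the pairs \<open>(k,l)\<close>, \<open>k \<in> K\<close>, for which the frame
  \<open>k, X\<^sub>0, \<dots>, l\<close> is positive; the condition \<open>g(k,l) > 0\<close> for all these pairs makes the set of admissible
  forms convex, so that the local metrics can be glued with smooth bump functions. The sign of
  \<open>g(k,l)\<close> also transports the orientation of \<open>TM\<close> to \<open>N/K\<close>.\<close>

section \<open>Calculus of smooth maps\<close>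

text \<open>Why orientability of the screen enters: a metric with K null pairs K nondegenerately
  with TM/N, so the line bundle K \<otimes> TM/N is trivial; as TM is oriented, this amounts to an
  orientation of N/K. The obstacle to gluing is the sign of g(k,l): an average of local metrics with
  opposite signs can degenerate. The class itself does not see this sign, because g +
  2\<kappa>\<alpha> reverses it when \<alpha>(k) < -1; fixing it is a choice made only to keep
  averages nondegenerate. Two devices shape the rest. Signature is tested by
  \<open>optical_form\<close>, which looks only at k, at g(k,.) and at positivity on the kernel of
  g(k,.) modulo k, so no orthonormal frames have to be glued. Tangent spaces are identified with
  real^'d through charts that jump from point to point, so a frame determinant is not a smooth
  function; only its vanishing, its sign (by orientation) and ratios of two of them are meaningful.
  Dual frames are therefore written by Cramer's rule as such ratios.\<close>

lemma Ck_on_subset: "Ck_on k S f \<Longrightarrow> T \<subseteq> S \<Longrightarrow> Ck_on k T f"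
  by (induction k arbitrary: f) (auto intro: continuous_on_subset)

lemma Ck_on_cong:
  assumes "open S" "\<And>x. x \<in> S \<Longrightarrow> f x = g x" "Ck_on k S f"
  shows "Ck_on k S g"
  using assms(2,3)
proof (induction k arbitrary: f g)
  case 0
  then show ?case using continuous_on_cong by force
next
  case (Suc k)
  have d: "(g has_derivative frechet_derivative f (at x)) (at x)" if "x \<in> S" for x
  proof (rule has_derivative_transform_within_open[OF _ \<open>open S\<close> that])
    show "(f has_derivative frechet_derivative f (at x)) (at x)"
      using Suc.prems(2) that by (simp add: frechet_derivative_works)
  qed (use Suc.prems in auto)
  have e: "frechet_derivative g (at x) = frechet_derivative f (at x)" if "x \<in> S" for x
    using frechet_derivative_at[OF d[OF that]] by simp
  show ?case
    unfolding Ck_on.simps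
  proof (intro conjI ballI allI)
    fix v show "Ck_on k S (\<lambda>x. frechet_derivative g (at x) v)"
      by (rule Suc.IH[of "\<lambda>x. frechet_derivative f (at x) v"]) (use Suc.prems e in auto)
  qed (use d differentiable_def in blast)
qed

lemma Ck_on_SucI:
  assumes "open S" "\<And>x. x \<in> S \<Longrightarrow> (f has_derivative f' x) (at x)"
    and "\<And>v. Ck_on k S (\<lambda>x. f' x v)"
  shows "Ck_on (Suc k) S f"
  unfolding Ck_on.simps
proof (intro conjI ballI allI)
  fix v show "Ck_on k S (\<lambda>x. frechet_derivative f (at x) v)"
    by (rule Ck_on_cong[OF assms(1) _ assms(3)[of v]]) (use frechet_derivative_at[OF assms(2)] in auto)
qed (use assms(2) differentiable_def in blast)

lemma Ck_on_SucD:
  assumes "Ck_on (Suc k) S f" "x \<in> S"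
  shows "(f has_derivative frechet_derivative f (at x)) (at x)"
  using assms by (simp add: frechet_derivative_works)

lemma Ck_on_le_Suc: "Ck_on (Suc k) S f \<Longrightarrow> Ck_on k S f"
proof (induction k arbitrary: f)
  case 0
  then show ?case
    by (auto intro!: continuous_at_imp_continuous_on differentiable_imp_continuous_within)
next
  case (Suc k)
  then show ?case by (metis Ck_on.simps(2))
qed

lemma Ck_on_const: "open S \<Longrightarrow> Ck_on k S (\<lambda>x. c)"
  by (induction k arbitrary: c) auto

lemma Ck_on_bounded_linear:
  assumes "open S" "bounded_linear L" "Ck_on k S f"
  shows "Ck_on k S (\<lambda>x. L (f x))"
  using assms(3)
proof (induction k arbitrary: f)
  case 0
  then show ?case using bounded_linear.continuous_on[OF assms(2)] by auto
next
  case (Suc k)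
  show ?case
    by (rule Ck_on_SucI[OF assms(1) bounded_linear.has_derivative[OF assms(2) Ck_on_SucD[OF Suc.prems]]])
      (use Suc in auto)
qed

lemma Ck_on_add:
  assumes "open S" "Ck_on k S f" "Ck_on k S g"
  shows "Ck_on k S (\<lambda>x. f x + g x)"
  using assms(2,3)
proof (induction k arbitrary: f g)
  case 0
  then show ?case by (auto intro: continuous_on_add)
next
  case (Suc k)
  show ?case
    by (rule Ck_on_SucI[OF assms(1) has_derivative_add[OF Ck_on_SucD[OF Suc.prems(1)] Ck_on_SucD[OF Suc.prems(2)]]])
      (use Suc in auto)
qed

lemma Ck_on_scaleR:
  assumes "open S" "Ck_on k S f" "Ck_on k S g"
  shows "Ck_on k S (\<lambda>x. f x *\<^sub>R g x)"
  using assms(2,3)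
proof (induction k arbitrary: f g)
  case 0
  then show ?case by (auto intro: continuous_on_scaleR)
next
  case (Suc k)
  show ?case
    by (rule Ck_on_SucI[OF assms(1) has_derivative_scaleR[OF Ck_on_SucD[OF Suc.prems(1)] Ck_on_SucD[OF Suc.prems(2)]]])
      (use Suc Ck_on_le_Suc[OF Suc.prems(1)] Ck_on_le_Suc[OF Suc.prems(2)] in
        \<open>auto intro!: Ck_on_add assms(1)\<close>)
qed

lemma Ck_on_sum:
  assumes "open S" "\<And>i. i \<in> I \<Longrightarrow> Ck_on k S (f i)"
  shows "Ck_on k S (\<lambda>x. \<Sum>i\<in>I. f i x)"
  using assms(2)
  by (induction I rule: infinite_finite_induct) (auto intro!: Ck_on_const Ck_on_add assms(1))

text \<open>\<open>Ck_on\<close> speaks of derivatives in fixed directions, but the chain rule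
  applies the derivative of \<open>g\<close> to a direction that moves with \<open>x\<close>.
  Expanding this direction in \<open>Basis\<close> leaves scalar functions times derivatives of
  \<open>g\<close> in fixed directions, to which the induction hypothesis applies.\<close>

lemma Ck_on_compose:
  fixes f :: "'a::euclidean_space \<Rightarrow> 'b::euclidean_space" and g :: "'b \<Rightarrow> 'c::real_normed_vector"
  assumes "open S" "open T" "f ` S \<subseteq> T" "Ck_on k S f" "Ck_on k T g"
  shows "Ck_on k S (\<lambda>x. g (f x))"
  using assms(4,5)
proof (induction k arbitrary: g)
  case 0
  then show ?case using continuous_on_compose2 assms(3) by auto
next
  case (Suc k)
  let ?f' = "\<lambda>x. frechet_derivative f (at x)" and ?g' = "\<lambda>y. frechet_derivative g (at y)"
  have exp: "?g' y w = (\<Sum>b\<in>Basis. (w \<bullet> b) *\<^sub>R ?g' y b)" if "y \<in> T" for y w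
  proof -
    have "linear (?g' y)"
      using Ck_on_SucD[OF Suc.prems(2) that] has_derivative_linear by blast
    then have "?g' y (\<Sum>b\<in>Basis. (w \<bullet> b) *\<^sub>R b) = (\<Sum>b\<in>Basis. (w \<bullet> b) *\<^sub>R ?g' y b)"
      by (simp add: linear_sum linear_cmul)
    then show ?thesis by (simp add: euclidean_representation)
  qed
  show ?case
  proof (rule Ck_on_SucI[OF assms(1)])
    show "((\<lambda>x. g (f x)) has_derivative (\<lambda>v. ?g' (f x) (?f' x v))) (at x)" if "x \<in> S" for x
      using diff_chain_at[OF Ck_on_SucD[OF Suc.prems(1) that] Ck_on_SucD[OF Suc.prems(2)]] that assms(3)
      by (auto simp: o_def)
    fix v
    have fk: "Ck_on k S f" using Ck_on_le_Suc Suc.prems(1) by blast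
    have "Ck_on k S (\<lambda>x. \<Sum>b\<in>Basis. (?f' x v \<bullet> b) *\<^sub>R ?g' (f x) b)"
      by (intro Ck_on_sum Ck_on_scaleR assms(1) Suc.IH fk Ck_on_bounded_linear[OF assms(1) bounded_linear_inner_left])
        (use Suc.prems in auto)
    then show "Ck_on k S (\<lambda>x. ?g' (f x) (?f' x v))"
      by (rule Ck_on_cong[OF assms(1), rotated]) (use exp assms(3) in auto)
  qed
qed

section \<open>Smooth functions of one real variable\<close>

lemma Ck_on_real_SucI:
  fixes f :: "real \<Rightarrow> real"
  assumes "open S" "\<And>x. x \<in> S \<Longrightarrow> (f has_field_derivative f' x) (at x)" "Ck_on k S f'"
  shows "Ck_on (Suc k) S f"
proof (rule Ck_on_SucI[OF assms(1)])
  show "(f has_derivative (\<lambda>v. f' x * v)) (at x)" if "x \<in> S" for x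
    using assms(2)[OF that] by (simp add: has_field_derivative_def)
  show "Ck_on k S (\<lambda>x. f' x * v)" for v
    using Ck_on_scaleR[OF assms(1,3) Ck_on_const[OF assms(1), of k v]] by simp
qed

lemma Ck_on_exp: "Ck_on k UNIV (exp :: real \<Rightarrow> real)"
  by (induction k) (auto intro!: continuous_intros Ck_on_real_SucI[where f' = exp] DERIV_exp simp del: Ck_on.simps(2))

lemma Ck_on_inverse: "Ck_on k (- {0}) (inverse :: real \<Rightarrow> real)"
proof (induction k)
  case 0
  then show ?case by (auto intro!: continuous_intros)
next
  case (Suc k)
  have "Ck_on k (- {0}) (\<lambda>x::real. (- 1) *\<^sub>R (inverse x *\<^sub>R inverse x))"
    by (intro Ck_on_scaleR Ck_on_const Suc) auto
  then have "Ck_on k (- {0}) (\<lambda>x::real. - (inverse x * inverse x))" by simp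
  then show ?case
    by (intro Ck_on_real_SucI[where f' = "\<lambda>x. - (inverse x * inverse x)"])
      (auto intro!: derivative_eq_intros)
qed

lemma Ck_on_ln: "Ck_on k {0<..} (ln :: real \<Rightarrow> real)"
proof (cases k)
  case 0
  then show ?thesis by (auto intro!: continuous_intros)
next
  case (Suc m)
  show ?thesis unfolding Suc
    by (intro Ck_on_real_SucI[where f' = inverse] Ck_on_subset[OF Ck_on_inverse])
      (auto intro!: derivative_eq_intros simp: inverse_eq_divide)
qed

text \<open>\<open>flat_exp 0\<close> is the classical smooth function exp(-1/t) that is flat at 0.
  The extra power of 1/t makes the family closed, up to linear combinations, under differentiation,
  so smoothness follows by one induction for all \<open>n\<close> at once.\<close>

definition flat_exp :: "nat \<Rightarrow> real \<Rightarrow> real" where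
  "flat_exp n t = (if t > 0 then exp (- inverse t) * inverse t ^ n else 0)"

lemma flat_exp_tendsto_0: "(flat_exp n \<longlongrightarrow> 0) (at 0)"
proof -
  have "((\<lambda>x::real. x ^ n / exp x) \<longlongrightarrow> 0) at_top"
    by (rule tendsto_power_div_exp_0)
  then have "((\<lambda>t::real. inverse t ^ n / exp (inverse t)) \<longlongrightarrow> 0) (at_right 0)"
    by (rule filterlim_compose) (rule filterlim_inverse_at_top_right)
  then have r: "(flat_exp n \<longlongrightarrow> 0) (at_right 0)"
    by (rule Lim_transform_eventually)
      (auto simp: eventually_at_right_less flat_exp_def exp_minus field_simps intro!: eventually_at_rightI[of 0 1])
  have l: "(flat_exp n \<longlongrightarrow> 0) (at_left 0)"
    by (rule Lim_transform_eventually[OF tendsto_const])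
      (auto simp: flat_exp_def intro!: eventually_at_leftI[of "-1"])
  show ?thesis using l r filterlim_split_at by blast
qed

lemma flat_exp_deriv:
  "(flat_exp n has_field_derivative (flat_exp (n + 2) t - n * flat_exp (Suc n) t)) (at t)"
proof -
  consider "t > 0" | "t < 0" | "t = 0" by linarith
  then show ?thesis
  proof cases
    case 1
    have "((\<lambda>t. exp (- inverse t) * inverse t ^ n) has_field_derivative
        (flat_exp (n + 2) t - n * flat_exp (Suc n) t)) (at t)"
    proof -
      have "((\<lambda>t. inverse t ^ n) has_field_derivative (- n * inverse t ^ Suc n)) (at t)"
      proof (cases n)
        case (Suc m)
        have "(inverse has_field_derivative (- (inverse t * inverse t))) (at t)"
          using 1 by (auto intro!: derivative_eq_intros)
        from DERIV_power[OF this, of n] show ?thesis by (simp add: Suc algebra_simps del: power_inverse)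
      qed auto
      moreover have "((\<lambda>t. exp (- inverse t)) has_field_derivative (exp (- inverse t) * inverse t ^ 2)) (at t)"
        using 1 by (auto intro!: derivative_eq_intros simp: power2_eq_square)
      ultimately have "((\<lambda>t. exp (- inverse t) * inverse t ^ n) has_field_derivative
          (exp (- inverse t) * inverse t ^ 2 * inverse t ^ n + (- n * inverse t ^ Suc n) * exp (- inverse t))) (at t)"
        by (rule DERIV_mult[rotated])
      then show ?thesis
        by (rule back_subst[where P = "\<lambda>y. (_ has_field_derivative y) _"])
          (use 1 in \<open>simp add: flat_exp_def algebra_simps power2_eq_square\<close>)
    qed
    then show ?thesis
      by (rule has_field_derivative_transform_within_open[of _ _ _ "{0<..}"]) (use 1 in \<open>auto simp: flat_exp_def\<close>)
  next
    case 2
    have "((\<lambda>t. 0) has_field_derivative (flat_exp (n + 2) t - n * flat_exp (Suc n) t)) (at t)"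
      using 2 by (auto simp: flat_exp_def)
    then show ?thesis
      by (rule has_field_derivative_transform_within_open[of _ _ _ "{..<0}"]) (use 2 in \<open>auto simp: flat_exp_def\<close>)
  next
    case 3
    \<comment> \<open>At the origin the difference quotient is again a member of the family, and it
      tends to 0.\<close>
    have "(\<lambda>h. (flat_exp n (0 + h) - flat_exp n 0) / h) = flat_exp (Suc n)"
      by (auto simp: flat_exp_def fun_eq_iff field_simps)
    then show ?thesis
      using flat_exp_tendsto_0[of "Suc n"] 3 by (simp add: DERIV_def flat_exp_def)
  qed
qed

lemma Ck_on_flat_exp: "Ck_on k UNIV (flat_exp n)"
proof (induction k arbitrary: n)
  case 0
  show ?case using DERIV_isCont[OF flat_exp_deriv] by (auto intro!: continuous_at_imp_continuous_on)
next
  case (Suc k)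
  have "Ck_on k UNIV (\<lambda>t. flat_exp (n + 2) t + (- real n) *\<^sub>R flat_exp (Suc n) t)"
    by (intro Ck_on_add Ck_on_scaleR Ck_on_const Suc open_UNIV)
  then have "Ck_on k UNIV (\<lambda>t. flat_exp (n + 2) t - n * flat_exp (Suc n) t)" by simp
  then show ?case by (rule Ck_on_real_SucI[OF open_UNIV flat_exp_deriv])
qed

lemma Cinf_on_subset: "Cinf_on S f \<Longrightarrow> T \<subseteq> S \<Longrightarrow> Cinf_on T f"
  using Ck_on_subset Cinf_on_def by metis

lemma Cinf_on_cong: "open S \<Longrightarrow> (\<And>x. x \<in> S \<Longrightarrow> f x = g x) \<Longrightarrow> Cinf_on S f \<Longrightarrow> Cinf_on S g"
  using Ck_on_cong Cinf_on_def by metis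

lemma Cinf_on_compose:
  fixes f :: "'a::euclidean_space \<Rightarrow> 'b::euclidean_space" and g :: "'b \<Rightarrow> 'c::real_normed_vector"
  assumes "open S" "open T" "f ` S \<subseteq> T" "Cinf_on S f" "Cinf_on T g"
  shows "Cinf_on S (\<lambda>x. g (f x))"
  using Ck_on_compose[OF assms(1-3)] assms(4,5) by (auto simp: Cinf_on_def)

lemma Cinf_on_continuous: "Cinf_on S f \<Longrightarrow> continuous_on S f"
  unfolding Cinf_on_def by (metis Ck_on.simps(1))

lemma Cinf_on_has_derivative:
  "Cinf_on S f \<Longrightarrow> x \<in> S \<Longrightarrow> (f has_derivative frechet_derivative f (at x)) (at x)"
  unfolding Cinf_on_def using Ck_on_SucD by blast

lemma Cinf_on_derivative: "Cinf_on S f \<Longrightarrow> Cinf_on S (\<lambda>x. frechet_derivative f (at x) v)"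
  unfolding Cinf_on_def using Ck_on.simps(2) by blast

lemma Ck_on_locally:
  assumes "\<And>x. x \<in> S \<Longrightarrow> \<exists>T. open T \<and> x \<in> T \<and> Ck_on k T f"
  shows "Ck_on k S f"
  using assms
proof (induction k arbitrary: f)
  case 0
  have "isCont f x" if "x \<in> S" for x
    using 0[OF that] continuous_on_eq_continuous_at by auto
  then show ?case by (simp add: continuous_at_imp_continuous_on)
next
  case (Suc k)
  have "Ck_on k S (\<lambda>x. frechet_derivative f (at x) v)" for v
    by (rule Suc.IH) (use Suc.prems in fastforce)
  then show ?case using Suc.prems by fastforce
qed

lemma Cinf_on_locally:
  assumes "\<And>x. x \<in> S \<Longrightarrow> \<exists>T. open T \<and> x \<in> T \<and> Cinf_on T f"
  shows "Cinf_on S f"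
  unfolding Cinf_on_def
proof
  fix k show "Ck_on k S f"
    by (rule Ck_on_locally) (use assms Cinf_on_def in metis)
qed

section \<open>Smooth functions and tensor fields on a manifold\<close>

locale smooth_manifold =
  fixes A :: "('m::{t2_space, second_countable_topology}, 'd::finite) chart set"
  assumes atlas: "smooth_atlas A"
begin

lemma chart_homeo: "c \<in> A \<Longrightarrow> homeomorphism (fst c) (snd c ` fst c) (snd c) (chart_inv c)"
  and chart_open: "c \<in> A \<Longrightarrow> open (fst c)"
  and chart_image_open: "c \<in> A \<Longrightarrow> open (snd c ` fst c)"
  using atlas unfolding smooth_atlas_def is_chart_def by auto

lemma chart_inv_chart [simp]: "c \<in> A \<Longrightarrow> p \<in> fst c \<Longrightarrow> chart_inv c (snd c p) = p"
  using chart_homeo unfolding homeomorphism_def by auto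

lemma chart_exists: "\<exists>c\<in>A. p \<in> fst c"
  using atlas unfolding smooth_atlas_def by (metis UN_E UNIV_I)

lemma open_chart_image:
  assumes "c \<in> A" "open U"
  shows "open (snd c ` (U \<inter> fst c))"
proof -
  have "openin (top_of_set (fst c)) (U \<inter> fst c)"
    using assms(2) by (metis Int_commute openin_open_Int)
  then have "openin (top_of_set (snd c ` fst c)) (snd c ` (U \<inter> fst c))"
    using homeomorphism_imp_open_map[OF chart_homeo[OF assms(1)]] by blast
  then show ?thesis using openin_open_trans chart_image_open[OF assms(1)] by blast
qed

lemma chart_transition:
  "c \<in> A \<Longrightarrow> c' \<in> A \<Longrightarrow> Cinf_on (snd c ` (fst c \<inter> fst c')) (snd c' \<circ> chart_inv c)"
  using atlas unfolding smooth_atlas_def by auto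

text \<open>Smoothness as a property of germs, so that identities valid only near a point can be
  used through \<open>eventually\<close>. A single chart is demanded; \<open>smooth_at_chart\<close>
  passes to any other chart around the point.\<close>

definition smooth_at :: "('m \<Rightarrow> 'b::real_normed_vector) \<Rightarrow> 'm \<Rightarrow> bool" where
  "smooth_at f p \<longleftrightarrow> (\<exists>c\<in>A. \<exists>U. open U \<and> p \<in> U \<and> U \<subseteq> fst c \<and> Cinf_on (snd c ` U) (f \<circ> chart_inv c))"

lemma smooth_at_chart:
  assumes "smooth_at f p" "c' \<in> A" "p \<in> fst c'"
  obtains U where "open U" "p \<in> U" "U \<subseteq> fst c'" "Cinf_on (snd c' ` U) (f \<circ> chart_inv c')"
proof -
  obtain c U where c: "c \<in> A" "open U" "p \<in> U" "U \<subseteq> fst c" "Cinf_on (snd c ` U) (f \<circ> chart_inv c)"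
    using assms(1) smooth_at_def by blast
  let ?W = "U \<inter> fst c'"
  have sub: "?W = ?W \<inter> fst c'" "U = U \<inter> fst c" using c by auto
  have o: "open ?W" using c(2) chart_open[OF assms(2)] by blast
  have oW: "open (snd c' ` ?W)" "open (snd c ` U)"
    using open_chart_image[OF assms(2) o] sub(1) open_chart_image[OF c(1,2)] sub(2) by auto
  have "Cinf_on (snd c' ` ?W) (snd c \<circ> chart_inv c')"
    by (rule Cinf_on_subset[OF chart_transition[OF assms(2) c(1)]]) (use c in auto)
  from Cinf_on_compose[OF oW _ this c(5)]
  have "Cinf_on (snd c' ` ?W) (\<lambda>x. (f \<circ> chart_inv c) ((snd c \<circ> chart_inv c') x))"
    using c assms by fastforce
  then have "Cinf_on (snd c' ` ?W) (f \<circ> chart_inv c')"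
    by (rule Cinf_on_cong[OF oW(1), rotated]) (use c assms in auto)
  then show ?thesis using that[of ?W] o c assms by auto
qed

text \<open>Bridge from smoothness on an open set, tested in every chart of the atlas, to the
  pointwise notion in which all later calculus is done.\<close>

lemma smooth_on_iff:
  assumes "open U"
  shows "(\<forall>c\<in>A. Cinf_on (snd c ` (U \<inter> fst c)) (f \<circ> chart_inv c)) \<longleftrightarrow> (\<forall>p\<in>U. smooth_at f p)"
proof (intro iffI ballI)
  fix p assume "\<forall>c\<in>A. Cinf_on (snd c ` (U \<inter> fst c)) (f \<circ> chart_inv c)" "p \<in> U"
  then show "smooth_at f p"
    using chart_exists[of p] chart_open assms unfolding smooth_at_def
    by (metis Int_iff inf_le2 open_Int)
next
  fix c assume s: "\<forall>p\<in>U. smooth_at f p" and c: "c \<in> A"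
  show "Cinf_on (snd c ` (U \<inter> fst c)) (f \<circ> chart_inv c)"
  proof (rule Cinf_on_locally)
    fix x assume "x \<in> snd c ` (U \<inter> fst c)"
    then obtain p where p: "p \<in> U" "p \<in> fst c" "x = snd c p" by auto
    then obtain V where V: "open V" "p \<in> V" "V \<subseteq> fst c" "Cinf_on (snd c ` V) (f \<circ> chart_inv c)"
      using smooth_at_chart s c by blast
    then show "\<exists>T. open T \<and> x \<in> T \<and> Cinf_on T (f \<circ> chart_inv c)"
      using open_chart_image[OF c V(1)] p by (metis Int_absorb2 imageI)
  qed
qed

lemma smooth_at_eventually: "smooth_at f p \<Longrightarrow> \<forall>\<^sub>F q in nhds p. smooth_at f q"
  unfolding smooth_at_def eventually_nhds by blast

lemma smooth_at_cong:
  assumes "\<forall>\<^sub>F q in nhds p. f q = g q" "smooth_at f p"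
  shows "smooth_at g p"
proof -
  obtain c U where c: "c \<in> A" "open U" "p \<in> U" "U \<subseteq> fst c" "Cinf_on (snd c ` U) (f \<circ> chart_inv c)"
    using assms(2) smooth_at_def by blast
  obtain V where V: "open V" "p \<in> V" "\<And>q. q \<in> V \<Longrightarrow> f q = g q"
    using assms(1) unfolding eventually_nhds by blast
  have o: "open (snd c ` (U \<inter> V))"
    using open_chart_image[OF c(1) open_Int[OF c(2) V(1)]] c(4)
    by (metis Int_absorb2 Int_commute le_infI2)
  have "Cinf_on (snd c ` (U \<inter> V)) (f \<circ> chart_inv c)"
    by (rule Cinf_on_subset[OF c(5)]) auto
  then have "Cinf_on (snd c ` (U \<inter> V)) (g \<circ> chart_inv c)"
    by (rule Cinf_on_cong[OF o, rotated]) (use c V in auto)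
  then show ?thesis
    unfolding smooth_at_def using c V by (intro bexI[of _ c] exI[of _ "U \<inter> V"]) auto
qed

lemma smooth_at_const: "smooth_at (\<lambda>q. k) p"
proof -
  obtain c where "c \<in> A" "p \<in> fst c" using chart_exists by blast
  then show ?thesis
    unfolding smooth_at_def
    by (intro bexI[of _ c] exI[of _ "fst c"])
      (auto simp: chart_open Cinf_on_def o_def intro!: Ck_on_const chart_image_open)
qed

lemma smooth_at_lift2:
  fixes f :: "'m \<Rightarrow> 'b::real_normed_vector" and g :: "'m \<Rightarrow> 'c::real_normed_vector"
  assumes "\<And>S (u :: real^'d \<Rightarrow> 'b) (v :: real^'d \<Rightarrow> 'c). open S \<Longrightarrow> Cinf_on S u \<Longrightarrow> Cinf_on S v \<Longrightarrow>
      Cinf_on S (\<lambda>x. F (u x) (v x))"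
    and "smooth_at f p" "smooth_at g p"
  shows "smooth_at (\<lambda>q. F (f q) (g q)) p"
proof -
  obtain c U where c: "c \<in> A" "open U" "p \<in> U" "U \<subseteq> fst c" "Cinf_on (snd c ` U) (f \<circ> chart_inv c)"
    using assms(2) smooth_at_def by blast
  obtain V where V: "open V" "p \<in> V" "V \<subseteq> fst c" "Cinf_on (snd c ` V) (g \<circ> chart_inv c)"
    using assms(3) smooth_at_chart c by blast
  have "open (snd c ` (U \<inter> V))"
    using open_chart_image[OF c(1) open_Int[OF c(2) V(1)]] c(4)
    by (metis Int_absorb2 Int_commute le_infI2)
  moreover have "Cinf_on (snd c ` (U \<inter> V)) (f \<circ> chart_inv c)" "Cinf_on (snd c ` (U \<inter> V)) (g \<circ> chart_inv c)"
    by (rule Cinf_on_subset[OF c(5)], auto, rule Cinf_on_subset[OF V(4)], auto)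
  ultimately have "Cinf_on (snd c ` (U \<inter> V)) ((\<lambda>q. F (f q) (g q)) \<circ> chart_inv c)"
    using assms(1)[of _ "f \<circ> chart_inv c" "g \<circ> chart_inv c"] by (simp add: o_def)
  then show ?thesis
    unfolding smooth_at_def using c V by (intro bexI[of _ c] exI[of _ "U \<inter> V"]) auto
qed

lemma smooth_at_add:
  "smooth_at f p \<Longrightarrow> smooth_at g p \<Longrightarrow> smooth_at (\<lambda>q. f q + g q) p"
  by (rule smooth_at_lift2) (auto simp: Cinf_on_def Ck_on_add)

lemma smooth_at_scaleR:
  "smooth_at f p \<Longrightarrow> smooth_at g p \<Longrightarrow> smooth_at (\<lambda>q. f q *\<^sub>R g q) p"
  by (rule smooth_at_lift2) (auto simp: Cinf_on_def Ck_on_scaleR)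

lemma smooth_at_mult:
  fixes f g :: "'m \<Rightarrow> real"
  shows "smooth_at f p \<Longrightarrow> smooth_at g p \<Longrightarrow> smooth_at (\<lambda>q. f q * g q) p"
  using smooth_at_scaleR[of f p g] by simp

lemma smooth_at_bounded_linear:
  "bounded_linear L \<Longrightarrow> smooth_at f p \<Longrightarrow> smooth_at (\<lambda>q. L (f q)) p"
  using smooth_at_lift2[of "\<lambda>a b. L a" f p f] by (auto simp: Cinf_on_def Ck_on_bounded_linear)

lemma smooth_at_minus: "smooth_at f p \<Longrightarrow> smooth_at (\<lambda>q. - f q) p"
  by (rule smooth_at_bounded_linear[of uminus]) (auto intro: bounded_linear_minus bounded_linear_ident)

lemma smooth_at_diff:
  "smooth_at f p \<Longrightarrow> smooth_at g p \<Longrightarrow> smooth_at (\<lambda>q. f q - g q) p"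
  using smooth_at_add[of f p "\<lambda>q. - g q"] smooth_at_minus[of g p] by simp

lemma smooth_at_vec_nth: "smooth_at f p \<Longrightarrow> smooth_at (\<lambda>q. f q $ i) p"
  by (rule smooth_at_bounded_linear) (rule bounded_linear_vec_nth)

lemma smooth_at_sum: "(\<And>i. i \<in> I \<Longrightarrow> smooth_at (f i) p) \<Longrightarrow> smooth_at (\<lambda>q. \<Sum>i\<in>I. f i q) p"
  by (induction I rule: infinite_finite_induct) (auto intro: smooth_at_const smooth_at_add)

lemma smooth_at_prod:
  fixes f :: "'i \<Rightarrow> 'm \<Rightarrow> real"
  shows "(\<And>i. i \<in> I \<Longrightarrow> smooth_at (f i) p) \<Longrightarrow> smooth_at (\<lambda>q. \<Prod>i\<in>I. f i q) p"
  by (induction I rule: infinite_finite_induct) (auto intro: smooth_at_const smooth_at_mult)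

lemma smooth_at_det:
  assumes "\<And>i. smooth_at (\<lambda>q. M q $ i) p"
  shows "smooth_at (\<lambda>q. det (M q :: real^'i^'i)) p"
  unfolding det_def
  by (intro smooth_at_sum smooth_at_mult smooth_at_const smooth_at_prod smooth_at_vec_nth assms)

text \<open>Smoothness near \<open>p\<close> gives continuity near \<open>p\<close>, so the chart
  neighbourhood can be shrunk into the preimage of \<open>T\<close>. This serves both composition
  with partially defined functions and the persistence of open conditions.\<close>

lemma smooth_at_preimage:
  assumes "smooth_at f p" "open T" "f p \<in> T"
  obtains c U where "c \<in> A" "open U" "p \<in> U" "U \<subseteq> fst c" "Cinf_on (snd c ` U) (f \<circ> chart_inv c)" "f ` U \<subseteq> T"
proof -
  obtain c U where c: "c \<in> A" "open U" "p \<in> U" "U \<subseteq> fst c" "Cinf_on (snd c ` U) (f \<circ> chart_inv c)"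
    using assms(1) smooth_at_def by blast
  have "continuous_on U (snd c)"
    using chart_homeo[OF c(1)] c(4) continuous_on_subset homeomorphism_def by metis
  then have "continuous_on U ((f \<circ> chart_inv c) \<circ> snd c)"
    using Cinf_on_continuous[OF c(5)] by (rule continuous_on_compose)
  then have "continuous_on U f"
    by (rule continuous_on_cong[THEN iffD1, rotated 2]) (use c in auto)
  then have "open (U \<inter> f -` T)"
    using continuous_open_preimage c(2) assms(2) by blast
  moreover have "Cinf_on (snd c ` (U \<inter> f -` T)) (f \<circ> chart_inv c)"
    by (rule Cinf_on_subset[OF c(5)]) auto
  ultimately show ?thesis
    using that[of c "U \<inter> f -` T"] c assms by auto
qed

lemma smooth_at_eventually_in:
  assumes "smooth_at f p" "open T" "f p \<in> T"
  shows "\<forall>\<^sub>F q in nhds p. f q \<in> T"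
  using smooth_at_preimage[OF assms] unfolding eventually_nhds by (metis image_subset_iff)

lemma smooth_at_compose:
  fixes g :: "'b::euclidean_space \<Rightarrow> 'c::real_normed_vector"
  assumes "smooth_at f p" "open T" "f p \<in> T" "Cinf_on T g"
  shows "smooth_at (\<lambda>q. g (f q)) p"
proof -
  obtain c U where c: "c \<in> A" "open U" "p \<in> U" "U \<subseteq> fst c" "Cinf_on (snd c ` U) (f \<circ> chart_inv c)" "f ` U \<subseteq> T"
    using smooth_at_preimage[OF assms(1-3)] by blast
  have "open (snd c ` U)" using open_chart_image[OF c(1,2)] c(4) by (simp add: Int_absorb2)
  then have "Cinf_on (snd c ` U) (\<lambda>x. g ((f \<circ> chart_inv c) x))"
    by (rule Cinf_on_compose[OF _ assms(2) _ c(5) assms(4)]) (use c in force)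
  then show ?thesis unfolding smooth_at_def using c by (auto simp: o_def)
qed

lemma smooth_at_inverse:
  fixes f :: "'m \<Rightarrow> real"
  shows "smooth_at f p \<Longrightarrow> f p \<noteq> 0 \<Longrightarrow> smooth_at (\<lambda>q. inverse (f q)) p"
  by (rule smooth_at_compose[where T = "- {0}"]) (auto simp: Cinf_on_def Ck_on_inverse)

lemma smooth_at_divide:
  fixes f g :: "'m \<Rightarrow> real"
  shows "smooth_at f p \<Longrightarrow> smooth_at g p \<Longrightarrow> g p \<noteq> 0 \<Longrightarrow> smooth_at (\<lambda>q. f q / g q) p"
  using smooth_at_mult[of f p "\<lambda>q. inverse (g q)"] smooth_at_inverse[of g p] by (simp add: divide_inverse)

lemma smooth_at_exp: "smooth_at f p \<Longrightarrow> smooth_at (\<lambda>q. exp (f q :: real)) p"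
  by (rule smooth_at_compose[where T = UNIV]) (auto simp: Cinf_on_def Ck_on_exp)

lemma smooth_at_ln: "smooth_at f p \<Longrightarrow> f p > 0 \<Longrightarrow> smooth_at (\<lambda>q. ln (f q :: real)) p"
  by (rule smooth_at_compose[where T = "{0<..}"]) (auto simp: Cinf_on_def Ck_on_ln)

lemma smooth_at_flat_exp: "smooth_at f p \<Longrightarrow> smooth_at (\<lambda>q. flat_exp n (f q)) p"
  by (rule smooth_at_compose[where T = UNIV]) (auto simp: Cinf_on_def Ck_on_flat_exp)

lemma smooth_at_pos: "smooth_at f p \<Longrightarrow> (f p :: real) > 0 \<Longrightarrow> \<forall>\<^sub>F q in nhds p. f q > 0"
  using smooth_at_eventually_in[of f p "{0<..}"] by auto

lemma smooth_at_nonzero: "smooth_at f p \<Longrightarrow> (f p :: real) \<noteq> 0 \<Longrightarrow> \<forall>\<^sub>F q in nhds p. f q \<noteq> 0"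
  using smooth_at_eventually_in[of f p "- {0}"] by auto

lemma smooth_fun_iff: "open U \<Longrightarrow> smooth_fun A U f \<longleftrightarrow> (\<forall>p\<in>U. smooth_at f p)"
  unfolding smooth_fun_def by (rule smooth_on_iff)

end

text \<open>Frames are stored as rows, so applying \<open>T\<close> to each vector multiplies by the
  transpose of its matrix on the right. A change of identification of the tangent space thus scales
  all frame determinants at a point by one common factor.\<close>

lemma det_rows_image:
  fixes f :: "'d::finite \<Rightarrow> real^'d" and T :: "real^'d \<Rightarrow> real^'d"
  assumes "linear T"
  shows "det (\<chi> i. T (f i)) = det (matrix T) * det (\<chi> i. f i)"
proof -
  have "(\<chi> i. T (f i)) = (\<chi> i. f i) ** transpose (matrix T)"
  proof (intro vec_eq_iff[THEN iffD2] allI)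
    fix i j
    have "T (f i) $ j = (matrix T *v f i) $ j" using matrix_vector_mul(2)[OF assms] by metis
    then show "(\<chi> i. T (f i)) $ i $ j = ((\<chi> i. f i) ** transpose (matrix T)) $ i $ j"
      by (simp add: matrix_vector_mult_def matrix_matrix_mult_def transpose_def mult.commute)
  qed
  then show ?thesis by (simp add: det_mul det_transpose mult.commute)
qed

context smooth_manifold
begin

section \<open>Tangent spaces and smooth tensor fields\<close>

lemma transition_has_derivative:
  assumes "c \<in> A" "c' \<in> A" "p \<in> fst c" "p \<in> fst c'"
  shows "((snd c' \<circ> chart_inv c) has_derivative transition_deriv c c' p) (at (snd c p))"
  unfolding transition_deriv_def
  by (rule Cinf_on_has_derivative[OF chart_transition]) (use assms in auto)

lemma transition_chain:
  assumes "c \<in> A" "c' \<in> A" "c'' \<in> A" "p \<in> fst c" "p \<in> fst c'" "p \<in> fst c''"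
  shows "transition_deriv c' c'' p (transition_deriv c c' p v) = transition_deriv c c'' p v"
proof -
  let ?W = "snd c ` (fst c' \<inter> fst c'' \<inter> fst c)"
  have o: "open ?W" by (intro open_chart_image assms open_Int chart_open)
  have "((snd c'' \<circ> chart_inv c') has_derivative transition_deriv c' c'' p) (at ((snd c' \<circ> chart_inv c) (snd c p)))"
    using transition_has_derivative assms by simp
  from diff_chain_at[OF transition_has_derivative[OF assms(1,2,4,5)] this]
  have "((snd c'' \<circ> chart_inv c' \<circ> (snd c' \<circ> chart_inv c)) has_derivative
      (transition_deriv c' c'' p \<circ> transition_deriv c c' p)) (at (snd c p))"
    .
  then have "((snd c'' \<circ> chart_inv c) has_derivative
      (transition_deriv c' c'' p \<circ> transition_deriv c c' p)) (at (snd c p))"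
    by (rule has_derivative_transform_within_open[OF _ o]) (use assms in auto)
  with transition_has_derivative[of c c'' p] assms
  have "transition_deriv c c'' p = transition_deriv c' c'' p \<circ> transition_deriv c c' p"
    using has_derivative_unique by blast
  then show ?thesis by simp
qed

lemma transition_id:
  assumes "c \<in> A" "p \<in> fst c"
  shows "transition_deriv c c p v = v"
proof -
  have "((snd c \<circ> chart_inv c) has_derivative (\<lambda>v. v)) (at (snd c p))"
    by (rule has_derivative_transform_within_open[OF has_derivative_ident chart_image_open[OF assms(1)]])
      (use assms in auto)
  then show ?thesis
    using transition_has_derivative[of c c p] assms has_derivative_unique by metis
qed

lemma base_chart: "base_chart A p \<in> A" "p \<in> fst (base_chart A p)"
proof -
  have "\<exists>c. c \<in> A \<and> p \<in> fst c" using chart_exists by blast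
  from someI_ex[OF this] show "base_chart A p \<in> A" "p \<in> fst (base_chart A p)"
    unfolding base_chart_def by blast+
qed

lemma linear_to_coord: "c \<in> A \<Longrightarrow> p \<in> fst c \<Longrightarrow> linear (to_coord A c p)"
  and linear_of_coord: "c \<in> A \<Longrightarrow> p \<in> fst c \<Longrightarrow> linear (of_coord A c p)"
  unfolding to_coord_def of_coord_def
  using transition_has_derivative base_chart has_derivative_linear by blast+

lemma to_coord_of_coord:
  "c \<in> A \<Longrightarrow> c' \<in> A \<Longrightarrow> p \<in> fst c \<Longrightarrow> p \<in> fst c' \<Longrightarrow>
    to_coord A c' p (of_coord A c p v) = transition_deriv c c' p v"
  unfolding to_coord_def of_coord_def by (simp add: transition_chain base_chart)

lemma of_coord_to_coord:
  "c \<in> A \<Longrightarrow> p \<in> fst c \<Longrightarrow> of_coord A c p (to_coord A c p v) = v"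
  unfolding to_coord_def of_coord_def by (simp add: transition_chain base_chart transition_id)

lemma to_coord_of_coord_same [simp]:
  "c \<in> A \<Longrightarrow> p \<in> fst c \<Longrightarrow> to_coord A c p (of_coord A c p v) = v"
  by (simp add: to_coord_of_coord transition_id)

lemma det_to_coord_nonzero:
  assumes "c \<in> A" "p \<in> fst c"
  shows "det (matrix (to_coord A c p)) \<noteq> 0"
proof -
  have "matrix (to_coord A c p) ** matrix (of_coord A c p) = mat 1"
    using matrix_compose[OF linear_of_coord[OF assms] linear_to_coord[OF assms]] assms
    by (simp add: o_def matrix_id_mat_1[unfolded id_def])
  then have "det (matrix (to_coord A c p)) * det (matrix (of_coord A c p)) = 1"
    by (metis det_mul det_I)
  then show ?thesis by auto
qed

lemma coordinate_expansion:
  assumes "c \<in> A" "p \<in> fst c"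
  shows "v = (\<Sum>i\<in>UNIV. (to_coord A c p v $ i) *\<^sub>R of_coord A c p (axis i 1))"
proof -
  have "of_coord A c p (to_coord A c p v) = (\<Sum>i\<in>UNIV. (to_coord A c p v $ i) *\<^sub>R of_coord A c p (axis i 1))"
    by (subst basis_expansion[symmetric, of "to_coord A c p v"])
      (simp add: linear_sum[OF linear_of_coord[OF assms]] linear_cmul[OF linear_of_coord[OF assms]] scalar_mult_eq_scaleR)
  then show ?thesis using of_coord_to_coord[OF assms] by simp
qed

lemma smooth_at_transition:
  assumes "c \<in> A" "c' \<in> A" "p \<in> fst c" "p \<in> fst c'"
  shows "smooth_at (\<lambda>q. transition_deriv c c' q v) p"
proof -
  let ?W = "fst c \<inter> fst c'"
  have oW: "open (snd c ` ?W)"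
    using open_chart_image[OF assms(1) chart_open[OF assms(2)]] by (simp add: Int_commute)
  have "Cinf_on (snd c ` ?W) (\<lambda>x. frechet_derivative (snd c' \<circ> chart_inv c) (at x) v)"
    by (rule Cinf_on_derivative[OF chart_transition[OF assms(1,2)]])
  then have "Cinf_on (snd c ` ?W) ((\<lambda>q. transition_deriv c c' q v) \<circ> chart_inv c)"
    by (rule Cinf_on_cong[OF oW, rotated]) (use assms in \<open>auto simp: transition_deriv_def\<close>)
  then show ?thesis
    unfolding smooth_at_def using assms chart_open
    by (intro bexI[OF _ assms(1)] exI[of _ ?W]) (simp add: open_Int)
qed

lemma eventually_in_chart: "c \<in> A \<Longrightarrow> p \<in> fst c \<Longrightarrow> \<forall>\<^sub>F q in nhds p. q \<in> fst c"
  using chart_open eventually_nhds by blast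

text \<open>The raw map \<open>X\<close> depends on \<open>base_chart\<close>, which varies
  arbitrarily with the point; only its components in a fixed chart can be expected to be
  smooth.\<close>

definition smooth_vec_at :: "('m \<Rightarrow> real^'d) \<Rightarrow> 'm \<Rightarrow> bool" where
  "smooth_vec_at X p \<longleftrightarrow> (\<forall>c\<in>A. p \<in> fst c \<longrightarrow> smooth_at (\<lambda>q. to_coord A c q (X q)) p)"

text \<open>In a second chart the components are the old ones multiplied by the Jacobian of the
  coordinate change, whose columns are smooth.\<close>

lemma smooth_vec_atI:
  assumes "c \<in> A" "p \<in> fst c" "smooth_at (\<lambda>q. to_coord A c q (X q)) p"
  shows "smooth_vec_at X p"
  unfolding smooth_vec_at_def
proof (intro ballI impI)
  fix c' assume c': "c' \<in> A" "p \<in> fst c'"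
  have "smooth_at (\<lambda>q. \<Sum>i\<in>UNIV. (to_coord A c q (X q) $ i) *\<^sub>R transition_deriv c c' q (axis i 1)) p"
    by (intro smooth_at_sum smooth_at_scaleR smooth_at_vec_nth smooth_at_transition assms c')
  moreover have "\<forall>\<^sub>F q in nhds p. (\<Sum>i\<in>UNIV. (to_coord A c q (X q) $ i) *\<^sub>R transition_deriv c c' q (axis i 1))
      = to_coord A c' q (X q)"
    using eventually_in_chart[OF assms(1,2)] eventually_in_chart[OF c']
  proof eventually_elim
    case (elim q)
    have "to_coord A c' q (\<Sum>i\<in>UNIV. (to_coord A c q (X q) $ i) *\<^sub>R of_coord A c q (axis i 1))
        = (\<Sum>i\<in>UNIV. (to_coord A c q (X q) $ i) *\<^sub>R transition_deriv c c' q (axis i 1))"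
      using elim assms c' linear_to_coord[of c' q]
      by (simp add: linear_sum linear_cmul to_coord_of_coord)
    then show ?case using coordinate_expansion[of c q "X q"] assms elim by simp
  qed
  ultimately show "smooth_at (\<lambda>q. to_coord A c' q (X q)) p"
    by (rule smooth_at_cong[rotated])
qed

lemma smooth_vec_at_eventually:
  assumes "smooth_vec_at X p"
  shows "\<forall>\<^sub>F q in nhds p. smooth_vec_at X q"
proof -
  obtain c where c: "c \<in> A" "p \<in> fst c" using chart_exists by blast
  have "\<forall>\<^sub>F q in nhds p. smooth_at (\<lambda>q. to_coord A c q (X q)) q"
    by (rule smooth_at_eventually) (use assms c smooth_vec_at_def in auto)
  with eventually_in_chart[OF c] show ?thesis
    by eventually_elim (use smooth_vec_atI c in auto)
qed

lemma smooth_vector_field_iff: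
  assumes "open U"
  shows "smooth_vector_field A U X \<longleftrightarrow> (\<forall>p\<in>U. smooth_vec_at X p)"
proof -
  have *: "Cinf_on (snd c ` (U \<inter> fst c)) ((\<lambda>p. to_coord A c p (X p)) \<circ> chart_inv c) \<longleftrightarrow>
      (\<forall>p\<in>U. p \<in> fst c \<longrightarrow> smooth_at (\<lambda>q. to_coord A c q (X q)) p)" (is "?L \<longleftrightarrow> ?R") if c: "c \<in> A" for c
  proof
    assume L: ?L
    show ?R
    proof (intro ballI impI)
      fix p assume "p \<in> U" "p \<in> fst c"
      then show "smooth_at (\<lambda>q. to_coord A c q (X q)) p"
        unfolding smooth_at_def using L assms chart_open[OF c]
        by (intro bexI[OF _ c] exI[of _ "U \<inter> fst c"]) auto
    qed
  next
    assume R: ?R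
    show ?L
    proof (rule Cinf_on_locally)
      fix x assume "x \<in> snd c ` (U \<inter> fst c)"
      then obtain p where p: "p \<in> U" "p \<in> fst c" "x = snd c p" by auto
      then have "smooth_at (\<lambda>q. to_coord A c q (X q)) p" using R by blast
      then obtain V where V: "open V" "p \<in> V" "V \<subseteq> fst c"
          "Cinf_on (snd c ` V) ((\<lambda>q. to_coord A c q (X q)) \<circ> chart_inv c)"
        by (rule smooth_at_chart[OF _ c p(2)])
      then show "\<exists>T. open T \<and> x \<in> T \<and> Cinf_on T ((\<lambda>p. to_coord A c p (X p)) \<circ> chart_inv c)"
        using open_chart_image[OF c V(1)] p by (metis Int_absorb2 imageI)
    qed
  qed
  show ?thesis unfolding smooth_vector_field_def smooth_vec_at_def using * by auto
qed

lemma smooth_vec_at_coord: "c \<in> A \<Longrightarrow> p \<in> fst c \<Longrightarrow> smooth_vec_at (\<lambda>q. of_coord A c q v) p"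
proof (rule smooth_vec_atI)
  assume c: "c \<in> A" "p \<in> fst c"
  show "smooth_at (\<lambda>q. to_coord A c q (of_coord A c q v)) p"
    by (rule smooth_at_cong[OF _ smooth_at_const[of v]])
      (use eventually_in_chart[OF c] in \<open>eventually_elim, use c in auto\<close>)
qed

lemma smooth_vec_at_add:
  assumes "smooth_vec_at X p" "smooth_vec_at Y p"
  shows "smooth_vec_at (\<lambda>q. X q + Y q) p"
  unfolding smooth_vec_at_def
proof (intro ballI impI)
  fix c assume c: "c \<in> A" "p \<in> fst c"
  have "smooth_at (\<lambda>q. to_coord A c q (X q) + to_coord A c q (Y q)) p"
    using assms c by (auto simp: smooth_vec_at_def intro: smooth_at_add)
  then show "smooth_at (\<lambda>q. to_coord A c q (X q + Y q)) p"
    by (rule smooth_at_cong[rotated])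
      (use eventually_in_chart[OF c] in \<open>eventually_elim, use c linear_to_coord in \<open>simp add: linear_add\<close>\<close>)
qed

lemma smooth_vec_at_scaleR:
  assumes "smooth_at f p" "smooth_vec_at X p"
  shows "smooth_vec_at (\<lambda>q. f q *\<^sub>R X q) p"
  unfolding smooth_vec_at_def
proof (intro ballI impI)
  fix c assume c: "c \<in> A" "p \<in> fst c"
  have "smooth_at (\<lambda>q. f q *\<^sub>R to_coord A c q (X q)) p"
    using assms c by (auto simp: smooth_vec_at_def intro: smooth_at_scaleR)
  then show "smooth_at (\<lambda>q. to_coord A c q (f q *\<^sub>R X q)) p"
    by (rule smooth_at_cong[rotated])
      (use eventually_in_chart[OF c] in \<open>eventually_elim, use c linear_to_coord in \<open>simp add: linear_cmul\<close>\<close>)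
qed

lemma smooth_vec_at_diff:
  assumes "smooth_vec_at X p" "smooth_vec_at Y p"
  shows "smooth_vec_at (\<lambda>q. X q - Y q) p"
  using smooth_vec_at_add[OF assms(1) smooth_vec_at_scaleR[OF smooth_at_const[of "-1"] assms(2)]] by simp

text \<open>Covariant tensors are tested on smooth vector fields instead of by components: later
  computations then stay free of coordinates. For linear forms the two notions agree by
  \<open>coordinate_expansion\<close>.\<close>

definition smooth_covec_at :: "('m \<Rightarrow> real^'d \<Rightarrow> real) \<Rightarrow> 'm \<Rightarrow> bool" where
  "smooth_covec_at \<alpha> p \<longleftrightarrow> (\<forall>X. smooth_vec_at X p \<longrightarrow> smooth_at (\<lambda>q. \<alpha> q (X q)) p)"

definition smooth_bilin_at :: "('m \<Rightarrow> real^'d \<Rightarrow> real^'d \<Rightarrow> real) \<Rightarrow> 'm \<Rightarrow> bool" where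
  "smooth_bilin_at g p \<longleftrightarrow> (\<forall>X Y. smooth_vec_at X p \<longrightarrow> smooth_vec_at Y p \<longrightarrow> smooth_at (\<lambda>q. g q (X q) (Y q)) p)"

lemma smooth_covec_at_coord:
  assumes "\<forall>\<^sub>F q in nhds p. linear (\<alpha> q)" "c \<in> A" "p \<in> fst c"
    and "\<And>i. smooth_at (\<lambda>q. \<alpha> q (of_coord A c q (axis i 1))) p"
  shows "smooth_covec_at \<alpha> p"
  unfolding smooth_covec_at_def
proof (intro allI impI)
  fix X assume X: "smooth_vec_at X p"
  have "smooth_at (\<lambda>q. \<Sum>i\<in>UNIV. (to_coord A c q (X q) $ i) * \<alpha> q (of_coord A c q (axis i 1))) p"
    using X assms(2,3)
    by (auto intro!: smooth_at_sum smooth_at_mult smooth_at_vec_nth assms simp: smooth_vec_at_def)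
  then show "smooth_at (\<lambda>q. \<alpha> q (X q)) p"
  proof (rule smooth_at_cong[rotated])
    show "\<forall>\<^sub>F q in nhds p. (\<Sum>i\<in>UNIV. (to_coord A c q (X q) $ i) * \<alpha> q (of_coord A c q (axis i 1))) = \<alpha> q (X q)"
      using eventually_in_chart[OF assms(2,3)] assms(1)
    proof eventually_elim
      case (elim q)
      have "\<alpha> q (\<Sum>i\<in>UNIV. (to_coord A c q (X q) $ i) *\<^sub>R of_coord A c q (axis i 1)) =
         (\<Sum>i\<in>UNIV. (to_coord A c q (X q) $ i) * \<alpha> q (of_coord A c q (axis i 1)))"
        using elim by (simp add: linear_sum linear_cmul)
      then show ?case using coordinate_expansion[of c q "X q"] assms elim by simp
    qed
  qed
qed

text \<open>One slot at a time: with a coordinate field on the left, \<open>g\<close> is a smooth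
  covector field; pairing it with \<open>Y\<close> gives the components of the covector field
  obtained from \<open>g\<close> by inserting \<open>Y\<close> on the right.\<close>

lemma smooth_bilin_at_coord:
  assumes "\<And>q. bilinear (g q)" "c \<in> A" "p \<in> fst c"
    and "\<And>i j. smooth_at (\<lambda>q. g q (of_coord A c q (axis i 1)) (of_coord A c q (axis j 1))) p"
  shows "smooth_bilin_at g p"
  unfolding smooth_bilin_at_def
proof (intro allI impI)
  fix X Y assume X: "smooth_vec_at X p" "smooth_vec_at Y p"
  have l: "linear (g q v)" "linear (\<lambda>w. g q w v)" for q v
    using assms(1)[of q] unfolding bilinear_def by auto
  have "smooth_covec_at (\<lambda>q. g q (of_coord A c q (axis i 1))) p" for i
    using smooth_covec_at_coord[OF _ assms(2,3), of "\<lambda>q. g q (of_coord A c q (axis i 1))"] l assms(4) by simp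
  then have "smooth_at (\<lambda>q. g q (of_coord A c q (axis i 1)) (Y q)) p" for i
    using X(2) unfolding smooth_covec_at_def by blast
  then have "smooth_covec_at (\<lambda>q v. g q v (Y q)) p"
    using smooth_covec_at_coord[OF _ assms(2,3), of "\<lambda>q v. g q v (Y q)"] l by simp
  then show "smooth_at (\<lambda>q. g q (X q) (Y q)) p"
    using X(1) unfolding smooth_covec_at_def by blast
qed

lemma smooth_one_form_iff:
  assumes "open U"
  shows "smooth_one_form A U \<alpha> \<longleftrightarrow> (\<forall>p\<in>U. linear (\<alpha> p) \<and> smooth_covec_at \<alpha> p)" (is "?L \<longleftrightarrow> ?R")
proof
  assume L: ?L
  show ?R
  proof
    fix p assume p: "p \<in> U"
    obtain c where c: "c \<in> A" "p \<in> fst c" using chart_exists by blast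
    have "\<forall>\<^sub>F q in nhds p. linear (\<alpha> q)"
      using L p assms unfolding smooth_one_form_def eventually_nhds by blast
    moreover have "smooth_at (\<lambda>q. \<alpha> q (of_coord A c q (axis i 1))) p" for i
      unfolding smooth_at_def using L c p assms chart_open[OF c(1)]
      by (intro bexI[OF _ c(1)] exI[of _ "U \<inter> fst c"]) (auto simp: smooth_one_form_def)
    ultimately show "linear (\<alpha> p) \<and> smooth_covec_at \<alpha> p"
      using smooth_covec_at_coord c L p unfolding smooth_one_form_def by blast
  qed
next
  assume R: ?R
  have "Cinf_on (snd c ` (U \<inter> fst c)) ((\<lambda>p. \<alpha> p (of_coord A c p (axis i 1))) \<circ> chart_inv c)"
    if c: "c \<in> A" for c i
  proof -
    have o: "open (U \<inter> fst c)" using assms chart_open[OF c] by auto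
    have "\<forall>p\<in>U \<inter> fst c. smooth_at (\<lambda>p. \<alpha> p (of_coord A c p (axis i 1))) p"
      using R c smooth_vec_at_coord smooth_covec_at_def by blast
    then have "Cinf_on (snd c ` (U \<inter> fst c \<inter> fst c)) ((\<lambda>p. \<alpha> p (of_coord A c p (axis i 1))) \<circ> chart_inv c)"
      using smooth_on_iff[OF o] c by blast
    then show ?thesis by (simp add: Int_assoc)
  qed
  then show ?L using R unfolding smooth_one_form_def by blast
qed

lemma lorentzian_metric_iff:
  "lorentzian_metric A g \<longleftrightarrow> (\<forall>p. lorentzian_form (g p) \<and> smooth_bilin_at g p)" (is "?L \<longleftrightarrow> ?R")
proof
  assume L: ?L
  then have b: "bilinear (g q)" for q unfolding lorentzian_metric_def lorentzian_form_def by blast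
  show ?R
  proof
    fix p
    obtain c where c: "c \<in> A" "p \<in> fst c" using chart_exists by blast
    have "smooth_at (\<lambda>q. g q (of_coord A c q (axis i 1)) (of_coord A c q (axis j 1))) p" for i j
      unfolding smooth_at_def using L c chart_open[OF c(1)]
      by (intro bexI[OF _ c(1)] exI[of _ "fst c"]) (auto simp: lorentzian_metric_def)
    then show "lorentzian_form (g p) \<and> smooth_bilin_at g p"
      using smooth_bilin_at_coord b c L unfolding lorentzian_metric_def by blast
  qed
next
  assume R: ?R
  have "Cinf_on (snd c ` fst c) ((\<lambda>p. g p (of_coord A c p (axis i 1)) (of_coord A c p (axis j 1))) \<circ> chart_inv c)"
    if c: "c \<in> A" for c i j
  proof -
    have "\<forall>p\<in>fst c. smooth_at (\<lambda>p. g p (of_coord A c p (axis i 1)) (of_coord A c p (axis j 1))) p"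
      using R c smooth_vec_at_coord smooth_bilin_at_def by blast
    then have "Cinf_on (snd c ` (fst c \<inter> fst c)) ((\<lambda>p. g p (of_coord A c p (axis i 1)) (of_coord A c p (axis j 1))) \<circ> chart_inv c)"
      using smooth_on_iff[OF chart_open[OF c]] c by blast
    then show ?thesis by simp
  qed
  then show ?L using R unfolding lorentzian_metric_def by blast
qed

section \<open>Determinants of frames at a varying base point\<close>

lemma det_rows_to_coord:
  assumes "c \<in> A" "q \<in> fst c"
  shows "det (\<chi> i. to_coord A c q (f i)) = det (matrix (to_coord A c q)) * det (\<chi> i. f i)"
  using det_rows_image linear_to_coord assms by blast

lemma smooth_at_det_coord:
  assumes "\<And>i. smooth_vec_at (F i) p" "c \<in> A" "p \<in> fst c"
  shows "smooth_at (\<lambda>q. det (\<chi> i. to_coord A c q (F i q))) p"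
  using assms by (auto intro!: smooth_at_det simp: smooth_vec_at_def)

text \<open>The determinant taken in the base charts may jump, but it differs from the smooth
  determinant in a fixed chart by a nonzero factor, so nonvanishing still persists nearby.\<close>

lemma eventually_det_nonzero:
  assumes "\<And>i. smooth_vec_at (F i) p" "det (\<chi> i. F i p) \<noteq> 0"
  shows "\<forall>\<^sub>F q in nhds p. det (\<chi> i. F i q) \<noteq> 0"
proof -
  obtain c where c: "c \<in> A" "p \<in> fst c" using chart_exists by blast
  have "\<forall>\<^sub>F q in nhds p. det (\<chi> i. to_coord A c q (F i q)) \<noteq> 0"
    by (rule smooth_at_nonzero[OF smooth_at_det_coord[OF assms(1) c]])
      (use c assms det_to_coord_nonzero in \<open>simp add: det_rows_to_coord\<close>)
  with eventually_in_chart[OF c] show ?thesis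
    by eventually_elim (use c det_rows_to_coord in auto)
qed

text \<open>Numerator and denominator carry the same factor
  \<open>det (matrix (to_coord A c q))\<close>, so the quotient does not depend on the arbitrary
  base charts although neither determinant need be smooth.\<close>

lemma smooth_at_det_ratio:
  assumes "\<And>i. smooth_vec_at (F i) p" "\<And>i. smooth_vec_at (G i) p" "det (\<chi> i. G i p) \<noteq> 0"
  shows "smooth_at (\<lambda>q. det (\<chi> i. F i q) / det (\<chi> i. G i q)) p"
proof -
  obtain c where c: "c \<in> A" "p \<in> fst c" using chart_exists by blast
  have "smooth_at (\<lambda>q. det (\<chi> i. to_coord A c q (F i q)) / det (\<chi> i. to_coord A c q (G i q))) p"
    by (rule smooth_at_divide[OF smooth_at_det_coord[OF assms(1) c] smooth_at_det_coord[OF assms(2) c]])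
      (use c assms det_to_coord_nonzero in \<open>simp add: det_rows_to_coord\<close>)
  then show ?thesis
    by (rule smooth_at_cong[rotated])
      (use eventually_in_chart[OF c] in \<open>eventually_elim, use c det_to_coord_nonzero in \<open>simp add: det_rows_to_coord\<close>\<close>)
qed

end

locale oriented_smooth_manifold = smooth_manifold +
  assumes oriented: "c \<in> A \<Longrightarrow> c' \<in> A \<Longrightarrow> p \<in> fst c \<Longrightarrow> p \<in> fst c' \<Longrightarrow> det (matrix (transition_deriv c c' p)) > 0"
begin

text \<open>The base charts belong to the oriented atlas, so the factor between the determinant in a
  base chart and that in a fixed chart is positive, and signs are comparable at different
  points.\<close>

lemma eventually_det_pos:
  assumes "\<And>i. smooth_vec_at (F i) p" "det (\<chi> i. F i p) > 0"
  shows "\<forall>\<^sub>F q in nhds p. det (\<chi> i. F i q) > 0"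
proof -
  obtain c where c: "c \<in> A" "p \<in> fst c" using chart_exists by blast
  have pos: "det (matrix (to_coord A c q)) > 0" if "q \<in> fst c" for q
    unfolding to_coord_def by (rule oriented) (use base_chart c that in auto)
  have "\<forall>\<^sub>F q in nhds p. det (\<chi> i. to_coord A c q (F i q)) > 0"
    by (rule smooth_at_pos[OF smooth_at_det_coord[OF assms(1) c]])
      (use c assms pos in \<open>simp add: det_rows_to_coord\<close>)
  with eventually_in_chart[OF c] show ?thesis
    by eventually_elim (use c det_rows_to_coord pos zero_less_mult_pos in metis)
qed

end

section \<open>Bump functions\<close>

context smooth_manifold
begin

lemma smooth_at_chart_map:
  assumes "c \<in> A" "p \<in> fst c"
  shows "smooth_at (snd c) p"
proof -
  have "Cinf_on (snd c ` fst c) (snd c \<circ> chart_inv c)"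
    using chart_transition[OF assms(1,1)] by simp
  then show ?thesis
    unfolding smooth_at_def using assms chart_open by blast
qed

lemma bump_function:
  assumes "open U" "p \<in> U"
  obtains f :: "'m \<Rightarrow> real" where "\<And>q. smooth_at f q" "\<And>q. f q \<ge> 0" "f p > 0"
    "\<And>q. q \<notin> U \<Longrightarrow> \<forall>\<^sub>F x in nhds q. f x = 0"
proof -
  obtain c where c: "c \<in> A" "p \<in> fst c" using chart_exists by blast
  have "open (snd c ` (U \<inter> fst c))" "snd c p \<in> snd c ` (U \<inter> fst c)"
    using open_chart_image c assms by auto
  then obtain r where r: "r > 0" "cball (snd c p) r \<subseteq> snd c ` (U \<inter> fst c)"
    using open_contains_cball by blast
  define K where "K = chart_inv c ` cball (snd c p) r"
  have "continuous_on (snd c ` fst c) (chart_inv c)"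
    using chart_homeo[OF c(1)] homeomorphism_def by metis
  then have "continuous_on (cball (snd c p) r) (chart_inv c)"
    by (rule continuous_on_subset) (use r(2) in blast)
  then have "compact K"
    unfolding K_def using compact_cball by (rule compact_continuous_image)
  \<comment> \<open>The Hausdorff property makes the compact coordinate ball closed in the manifold.
    Hence every point outside the chart domain has a neighbourhood missing the support, and
    extension by zero is smooth there.\<close>
  then have "open (- K)" by (simp add: compact_imp_closed open_Compl)
  have K: "K \<subseteq> U" "K \<subseteq> fst c" unfolding K_def using r c by force+
  define f where "f q = (if q \<in> fst c then flat_exp 0 (r\<^sup>2 - (snd c q - snd c p) \<bullet> (snd c q - snd c p)) else 0)" for q
  have outside: "f q = 0" if "q \<notin> K" for q
  proof (cases "q \<in> fst c")
    case True
    then have "snd c q \<notin> cball (snd c p) r"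
      using that c(1) unfolding K_def by (metis chart_inv_chart imageI)
    then have "r\<^sup>2 \<le> (norm (snd c q - snd c p))\<^sup>2"
      using r(1) by (intro power_mono) (auto simp: dist_norm norm_minus_commute)
    then show ?thesis by (simp add: f_def flat_exp_def dot_square_norm)
  qed (simp add: f_def)
  have smooth: "smooth_at f q" for q
  proof (cases "q \<in> fst c")
    case True
    have "smooth_at (\<lambda>x. flat_exp 0 (r\<^sup>2 - (snd c x - snd c p) \<bullet> (snd c x - snd c p))) q"
      unfolding inner_vec_def inner_real_def
      by (intro smooth_at_flat_exp smooth_at_diff smooth_at_sum smooth_at_mult smooth_at_vec_nth
          smooth_at_const smooth_at_chart_map c True)
    then show ?thesis
      by (rule smooth_at_cong[rotated])
        (use eventually_in_chart[OF c(1) True] in \<open>eventually_elim, simp add: f_def\<close>)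
  next
    case False
    then have "\<forall>\<^sub>F x in nhds q. x \<in> - K"
      using \<open>open (- K)\<close> K eventually_nhds by blast
    then have "\<forall>\<^sub>F x in nhds q. 0 = f x" by eventually_elim (use outside in auto)
    then show ?thesis by (rule smooth_at_cong) (rule smooth_at_const)
  qed
  show thesis
  proof
    show "smooth_at f q" "f q \<ge> 0" for q using smooth by (auto simp: f_def flat_exp_def)
    show "f p > 0" using c r by (simp add: f_def flat_exp_def)
    show "\<forall>\<^sub>F x in nhds q. f x = 0" if "q \<notin> U" for q
    proof -
      have "\<forall>\<^sub>F x in nhds q. x \<in> - K"
        using \<open>open (- K)\<close> K that eventually_nhds by blast
      then show ?thesis by eventually_elim (use outside in auto)
    qed
  qed
qed

text \<open>Second countability enters through the Lindelof property: countably many positivity sets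
  of bump functions cover the manifold. The family is left unnormalised; the division by its sum
  takes place when metrics are averaged.\<close>

lemma partition_functions:
  assumes "\<And>p. open (U p) \<and> p \<in> U p"
  obtains x :: "nat \<Rightarrow> 'm" and \<phi> :: "nat \<Rightarrow> 'm \<Rightarrow> real"
  where "\<And>i q. smooth_at (\<phi> i) q" "\<And>i q. \<phi> i q \<ge> 0" "\<And>q. \<exists>i. \<phi> i q > 0"
    "\<And>q. \<exists>m. \<forall>\<^sub>F y in nhds q. \<forall>i\<ge>m. \<phi> i y = 0"
    "\<And>i q. q \<notin> U (x i) \<Longrightarrow> \<forall>\<^sub>F y in nhds q. \<phi> i y = 0"
proof -
  have "\<exists>f :: 'm \<Rightarrow> real. (\<forall>q. smooth_at f q) \<and> (\<forall>q. f q \<ge> 0) \<and> f p > 0 \<and>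
      (\<forall>q. q \<notin> U p \<longrightarrow> (\<forall>\<^sub>F x in nhds q. f x = 0))" for p
    using bump_function[of "U p" p] assms[of p] by metis
  then obtain f :: "'m \<Rightarrow> 'm \<Rightarrow> real" where f: "\<And>p q. smooth_at (f p) q" "\<And>p q. f p q \<ge> 0" "\<And>p. f p p > 0"
      "\<And>p q. q \<notin> U p \<Longrightarrow> \<forall>\<^sub>F x in nhds q. f p x = 0"
    by metis
  define W where "W p = {q. f p q > 0}" for p
  have openW: "open (W p)" for p
    unfolding open_subopen[of "W p"]
  proof
    fix q assume "q \<in> W p"
    then have "\<forall>\<^sub>F y in nhds q. f p y > 0" using smooth_at_pos[OF f(1)] by (simp add: W_def)
    then obtain T where "open T" "q \<in> T" "\<forall>y\<in>T. f p y > 0" unfolding eventually_nhds by blast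
    then show "\<exists>T. open T \<and> q \<in> T \<and> T \<subseteq> W p" by (intro exI[of _ T]) (auto simp: W_def)
  qed
  obtain F where F: "F \<subseteq> range W" "countable F" "\<Union>F = \<Union>(range W)"
    by (rule Lindelof[of "range W"]) (use openW in auto)
  have cover: "\<Union>F = UNIV" unfolding F(3) W_def using f(3) by blast
  then have "F \<noteq> {}" by auto
  have "\<forall>n. \<exists>p. from_nat_into F n = W p"
    using from_nat_into[OF \<open>F \<noteq> {}\<close>] F(1) by blast
  then obtain x where x: "\<And>n. from_nat_into F n = W (x n)" by metis
  have ex: "\<exists>n. f (x n) q > 0" for q
  proof -
    have "q \<in> \<Union>F" using cover by simp
    then obtain w where w: "w \<in> F" "q \<in> w" by blast
    obtain n where "from_nat_into F n = w"
      using from_nat_into_surj[OF F(2) w(1)] by blast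
    then have "q \<in> W (x n)" using x w(2) by simp
    then show ?thesis by (auto simp: W_def)
  qed
  \<comment> \<open>The cut-off factors make the family locally finite: \<open>\<phi> n\<close> vanishes where some \<open>f (x j)\<close>, \<open>j < n\<close>,
    is at least \<open>1 / Suc n\<close>.\<close>
  define \<phi> where "\<phi> n q = f (x n) q * (\<Prod>j<n. flat_exp 0 (1 / Suc n - f (x j) q))" for n q
  show thesis
  proof
    show "smooth_at (\<phi> i) q" for i q
      unfolding \<phi>_def by (intro smooth_at_mult smooth_at_prod smooth_at_flat_exp smooth_at_diff smooth_at_const f(1))
    show "\<phi> i q \<ge> 0" for i q
      unfolding \<phi>_def by (intro mult_nonneg_nonneg prod_nonneg f(2)) (simp add: flat_exp_def)
    show "\<exists>i. \<phi> i q > 0" for q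
    proof -
      \<comment> \<open>At the first index whose bump is positive at \<open>q\<close>, all earlier
        bumps vanish there, so each cut-off factor is evaluated at the positive number 1 /
        \<open>Suc n\<close>.\<close>
      define n where "n = (LEAST n. f (x n) q > 0)"
      have n: "f (x n) q > 0" unfolding n_def by (rule LeastI_ex[OF ex])
      have "f (x j) q = 0" if "j < n" for j
        using not_less_Least[of j "\<lambda>n. f (x n) q > 0"] that f(2)[of "x j" q] unfolding n_def by force
      then have "\<phi> n q > 0"
        unfolding \<phi>_def using n by (intro mult_pos_pos prod_pos) (auto simp: flat_exp_def)
      then show ?thesis by blast
    qed
    show "\<exists>m. \<forall>\<^sub>F y in nhds q. \<forall>i\<ge>m. \<phi> i y = 0" for q
    proof -
      obtain n where n: "f (x n) q > 0" using ex by blast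
      then obtain m where m: "1 / Suc m < f (x n) q" using nat_approx_posE by blast
      have "\<forall>\<^sub>F y in nhds q. f (x n) y - 1 / Suc m > 0"
        by (rule smooth_at_pos) (use m in \<open>auto intro: smooth_at_diff smooth_at_const f(1)\<close>)
      \<comment> \<open>\<open>i > n\<close> ensures that the factor with index \<open>n\<close>
        occurs in the product; \<open>i \<ge> m\<close> makes the threshold 1 / \<open>Suc i\<close>
        small enough for this factor to vanish.\<close>
      then have "\<forall>\<^sub>F y in nhds q. \<forall>i\<ge>max m (Suc n). \<phi> i y = 0"
      proof eventually_elim
        case (elim y)
        show ?case
        proof (intro allI impI)
          fix i assume i: "i \<ge> max m (Suc n)"
          then have "1 / real (Suc i) \<le> 1 / Suc m" by (simp add: frac_le)
          then have "flat_exp 0 (1 / Suc i - f (x n) y) = 0" using elim by (simp add: flat_exp_def)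
          then have "(\<Prod>j<i. flat_exp 0 (1 / Suc i - f (x j) y)) = 0"
            using i by (intro prod_zero) auto
          then show "\<phi> i y = 0" by (simp add: \<phi>_def)
        qed
      qed
      then show ?thesis by blast
    qed
    show "\<forall>\<^sub>F y in nhds q. \<phi> i y = 0" if "q \<notin> U (x i)" for i q
      using f(4)[OF that] by eventually_elim (simp add: \<phi>_def)
  qed
qed

end

section \<open>Lorentzian forms with a null vector\<close>

lemma dim_kernel:
  fixes f :: "real^'d::finite \<Rightarrow> real"
  assumes "linear f" "f x \<noteq> 0"
  shows "dim {v. f v = 0} + 1 = CARD('d)"
proof -
  let ?K = "{v. f v = 0}"
  have s: "subspace ?K" using assms(1) by (rule linear_subspace_kernel)
  have span: "v \<in> span (insert x ?K)" for v
  proof -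
    have "v - (f v / f x) *\<^sub>R x \<in> ?K"
      using assms by (simp add: linear_diff linear_cmul)
    then have "v - (f v / f x) *\<^sub>R x \<in> span ?K" by (rule span_base)
    then show ?thesis unfolding span_breakdown_eq by (rule exI)
  qed
  then have "span (insert x ?K) = UNIV" by (intro UNIV_eq_I[symmetric])
  then have "dim (insert x ?K) = dim (UNIV :: (real^'d) set)" using dim_span[of "insert x ?K"] by simp
  then have "dim (insert x ?K) = CARD('d)" by simp
  moreover have "x \<notin> span ?K" using assms(2) span_minimal[OF subset_refl s] by blast
  ultimately show ?thesis by (simp add: dim_insert)
qed

text \<open>Characterises Lorentzian forms for which the nonzero vector \<open>k\<close> is null,
  without a basis: the form induced on the kernel of \<open>B k\<close> modulo \<open>k\<close> is
  positive definite. The conditions can be verified directly for scaled and glued metrics.\<close>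

definition optical_form :: "(real^'d::finite \<Rightarrow> real^'d \<Rightarrow> real) \<Rightarrow> real^'d \<Rightarrow> bool" where
  "optical_form B k \<longleftrightarrow> bilinear B \<and> (\<forall>v w. B v w = B w v) \<and> k \<noteq> 0 \<and> B k k = 0 \<and> (\<exists>l. B k l \<noteq> 0) \<and>
     (\<forall>w. B k w = 0 \<longrightarrow> w \<notin> span {k} \<longrightarrow> B w w > 0)"

text \<open>A nonzero null vector has nonzero timelike component, for otherwise its square would be
  a sum of spacelike squares. Any vector orthogonal to it can thus be made purely spacelike by
  subtracting a multiple of it.\<close>

lemma lorentzian_imp_optical_form:
  fixes B :: "real^'d::finite \<Rightarrow> real^'d \<Rightarrow> real"
  assumes "lorentzian_form B" "k \<noteq> 0" "B k k = 0"
  shows "optical_form B k"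
proof -
  obtain b :: "'d \<Rightarrow> real^'d" and i0 where bil: "bilinear B" and b: "span (range b) = UNIV"
    and B: "\<And>i j. B (b i) (b j) = (if i \<noteq> j then 0 else if i = i0 then -1 else 1)"
    using assms(1) unfolding lorentzian_form_def by blast
  have lin: "linear (B v)" "linear (\<lambda>v. B v w)" for v w
    using bil unfolding bilinear_def by auto
  have "inj b"
  proof
    fix i j assume "b i = b j"
    then have "B (b i) (b j) = B (b i) (b i)" by simp
    then show "i = j" unfolding B by (simp split: if_splits)
  qed
  have ex: "\<exists>a. v = (\<Sum>i\<in>UNIV. a i *\<^sub>R b i)" for v
  proof -
    have "v \<in> range (\<lambda>u. \<Sum>v\<in>range b. u v *\<^sub>R v)" using b span_finite[of "range b"] by auto
    then obtain u where "v = (\<Sum>v\<in>range b. u v *\<^sub>R v)" by blast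
    then have "v = (\<Sum>i\<in>UNIV. u (b i) *\<^sub>R b i)" using \<open>inj b\<close> by (simp add: sum.reindex)
    then show ?thesis by (rule exI[of _ "\<lambda>i. u (b i)"])
  qed
  define e where "e i = (if i = i0 then -1 else 1 :: real)" for i
  have Bb: "B (\<Sum>i\<in>UNIV. a i *\<^sub>R b i) (b j) = a j * e j" for a j
  proof -
    have "B (\<Sum>i\<in>UNIV. a i *\<^sub>R b i) (b j) = (\<Sum>i\<in>UNIV. a i * B (b i) (b j))"
      by (simp add: linear_sum[OF lin(2)] linear_cmul[OF lin(2)])
    also have "\<dots> = (\<Sum>i\<in>UNIV. if i = j then a i * e j else 0)"
      by (rule sum.cong) (auto simp: B e_def)
    finally show ?thesis by simp
  qed
  have BB: "B (\<Sum>i\<in>UNIV. a i *\<^sub>R b i) (\<Sum>i\<in>UNIV. c i *\<^sub>R b i) = (\<Sum>i\<in>UNIV. a i * c i * e i)" for a c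
  proof -
    have "B v (\<Sum>i\<in>UNIV. c i *\<^sub>R b i) = (\<Sum>i\<in>UNIV. c i * B v (b i))" for v
      by (simp add: linear_sum[OF lin(1)] linear_cmul[OF lin(1)])
    then show ?thesis by (simp add: Bb mult_ac)
  qed
  have sym: "B v w = B w v" for v w
  proof -
    obtain a c where "v = (\<Sum>i\<in>UNIV. a i *\<^sub>R b i)" "w = (\<Sum>i\<in>UNIV. c i *\<^sub>R b i)"
      using ex by metis
    then show ?thesis by (simp only: BB mult.commute)
  qed
  have split: "(\<Sum>i\<in>UNIV. f i * e i) = (\<Sum>i\<in>UNIV - {i0}. f i) - f i0" for f
    by (simp add: sum.remove[of UNIV i0] e_def)
  obtain a where a: "k = (\<Sum>i\<in>UNIV. a i *\<^sub>R b i)" using ex by blast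
  have a0: "a i0 \<noteq> 0"
  proof
    assume z: "a i0 = 0"
    then have "(\<Sum>i\<in>UNIV - {i0}. a i * a i) = 0" using assms(3) unfolding a BB split by simp
    then have "a i = 0" for i
      using z by (cases "i = i0") (auto simp: sum_nonneg_eq_0_iff)
    then show False using assms(2) a by simp
  qed
  have "B k (b i0) \<noteq> 0" using a0 unfolding a Bb by (simp add: e_def)
  moreover have "B w w > 0" if w: "B k w = 0" "w \<notin> span {k}" for w
  proof -
    obtain c where c: "w = (\<Sum>i\<in>UNIV. c i *\<^sub>R b i)" using ex by blast
    \<comment> \<open>Chosen so that \<open>w - t *\<^sub>R k\<close> has no timelike component. The
      square of \<open>w\<close> is unchanged, as \<open>k\<close> is null and orthogonal to
      \<open>w\<close>.\<close>
    define t where "t = c i0 / a i0"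
    define d where "d i = c i - t * a i" for i
    have wd: "w - t *\<^sub>R k = (\<Sum>i\<in>UNIV. d i *\<^sub>R b i)"
      unfolding a c d_def by (simp add: scaleR_sum_right sum_subtractf algebra_simps)
    have d0: "d i0 = 0" using a0 by (simp add: d_def t_def)
    have "B w w = B (w - t *\<^sub>R k) (w - t *\<^sub>R k)"
      using w(1) assms(3) sym[of w k]
      by (simp add: linear_diff[OF lin(1)] linear_diff[OF lin(2)] linear_cmul[OF lin(1)] linear_cmul[OF lin(2)])
    also have "\<dots> = (\<Sum>i\<in>UNIV - {i0}. d i * d i)" unfolding wd BB split using d0 by simp
    finally have Bw: "B w w = (\<Sum>i\<in>UNIV - {i0}. d i * d i)" .
    have "\<exists>i\<in>UNIV - {i0}. d i * d i \<noteq> 0"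
    proof (rule ccontr)
      assume "\<not> ?thesis"
      then have "d i = 0" for i using d0 by (cases "i = i0") auto
      then have "w = t *\<^sub>R k" using wd by simp
      then show False using w(2) by (simp add: span_base span_scale)
    qed
    then have "(\<Sum>i\<in>UNIV - {i0}. d i * d i) \<noteq> 0" by (subst sum_nonneg_eq_0_iff) auto
    moreover have "(\<Sum>i\<in>UNIV - {i0}. d i * d i) \<ge> 0" by (simp add: sum_nonneg)
    ultimately show ?thesis using Bw by simp
  qed
  ultimately show ?thesis
    unfolding optical_form_def using bil sym assms by blast
qed

text \<open>Gram-Schmidt started from \<open>u\<close> and fed with the vectors of
  \<open>Basis\<close>; a vector already in the span is skipped. The resulting set is finally
  enumerated by the index type \<open>'d\<close>, as \<open>lorentzian_form\<close>
  requires.\<close>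

lemma orthonormal_basis_containing:
  fixes P :: "real^'d::finite \<Rightarrow> real^'d \<Rightarrow> real"
  assumes bil: "bilinear P" and sym: "\<And>v w. P v w = P w v"
    and pos: "\<And>v. v \<noteq> 0 \<Longrightarrow> P v v > 0" and u: "P u u = 1"
  obtains b :: "'d \<Rightarrow> real^'d" and i0 where "b i0 = u" "span (range b) = UNIV"
    "\<And>i j. P (b i) (b j) = (if i = j then 1 else 0)"
proof -
  have lin: "linear (P v)" "linear (\<lambda>v. P v w)" for v w
    using bil unfolding bilinear_def by auto
  have "\<exists>C. finite C \<and> u \<in> C \<and> (\<forall>x\<in>C. \<forall>y\<in>C. P x y = (if x = y then 1 else 0)) \<and> T \<subseteq> span C"
    if "finite T" for T
    using that
  proof induction
    case empty
    show ?case using u by (intro exI[of _ "{u}"]) auto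
  next
    case (insert x T)
    then obtain C where C: "finite C" "u \<in> C" "\<And>x y. x \<in> C \<Longrightarrow> y \<in> C \<Longrightarrow> P x y = (if x = y then 1 else 0)"
        "T \<subseteq> span C" by blast
    define y where "y = x - (\<Sum>c\<in>C. P x c *\<^sub>R c)"
    have s: "(\<Sum>c\<in>C. P x c *\<^sub>R c) \<in> span C" by (intro span_sum span_scale span_base)
    show ?case
    proof (cases "y = 0")
      case True
      then have "x \<in> span C" using s by (simp add: y_def)
      then show ?thesis using C by (intro exI[of _ C]) auto
    next
      case False
      define z where "z = (1 / sqrt (P y y)) *\<^sub>R y"
      have yy: "P y y > 0" using pos False by simp
      have yc: "P y c = 0" if "c \<in> C" for c
      proof -
        have "P y c = P x c - (\<Sum>d\<in>C. P x d * P d c)"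
          unfolding y_def by (simp add: linear_diff[OF lin(2)] linear_sum[OF lin(2)] linear_cmul[OF lin(2)])
        also have "(\<Sum>d\<in>C. P x d * P d c) = (\<Sum>d\<in>C. if d = c then P x d else 0)"
          by (rule sum.cong) (use C(3) that in auto)
        finally show ?thesis using C(1) that by simp
      qed
      have zc: "P z c = 0" "P c z = 0" if "c \<in> C" for c
        using yc[OF that] sym[of c z] by (auto simp: z_def linear_cmul[OF lin(2)])
      have zz: "P z z = 1"
        using yy by (simp add: z_def linear_cmul[OF lin(2)] linear_cmul[OF lin(1)])
      have "z \<notin> C" using zc zz by force
      have "y = sqrt (P y y) *\<^sub>R z" using yy by (simp add: z_def)
      then have "y \<in> span (insert z C)" by (metis insertI1 span_base span_scale)
      then have "x \<in> span (insert z C)"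
        using s span_mono[of C "insert z C"] span_add[of y _ "\<Sum>c\<in>C. P x c *\<^sub>R c"]
        by (auto simp: y_def)
      moreover have "T \<subseteq> span (insert z C)" using C(4) span_mono[of C "insert z C"] by blast
      ultimately show ?thesis
        using C zc zz \<open>z \<notin> C\<close> by (intro exI[of _ "insert z C"]) auto
    qed
  qed
  from this[OF finite_Basis] obtain C where C: "finite C" "u \<in> C" "(Basis :: (real^'d) set) \<subseteq> span C"
    and ON: "\<And>x y. x \<in> C \<Longrightarrow> y \<in> C \<Longrightarrow> P x y = (if x = y then 1 else 0)" by blast
  have span: "span C = UNIV"
    using C(3) span_minimal[of Basis "span C"] span_Basis by auto
  have "independent C"
  proof (rule independent_if_scalars_zero[OF C(1)])
    fix f x assume "(\<Sum>x\<in>C. f x *\<^sub>R x) = 0" "x \<in> C"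
    then have "0 = P (\<Sum>y\<in>C. f y *\<^sub>R y) x" by (simp add: linear_0[OF lin(2)])
    also have "\<dots> = (\<Sum>y\<in>C. f y * P y x)" by (simp add: linear_sum[OF lin(2)] linear_cmul[OF lin(2)])
    also have "\<dots> = (\<Sum>y\<in>C. if y = x then f y else 0)"
      by (rule sum.cong) (use ON \<open>x \<in> C\<close> in auto)
    finally show "f x = 0" using C(1) \<open>x \<in> C\<close> by simp
  qed
  then have "card C = dim (UNIV :: (real^'d) set)"
    using dim_eq_card[of C UNIV] span by simp
  then have "card (UNIV :: 'd set) = card C" by simp
  then obtain b where b: "bij_betw b (UNIV :: 'd set) C"
    using finite_same_card_bij[OF finite_class.finite_UNIV C(1)] by blast
  then obtain i0 where "b i0 = u" using C(2) by (metis bij_betw_imp_surj_on imageE)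
  moreover have "range b = C" "inj b" using b by (auto simp: bij_betw_def)
  moreover have "P (b i) (b j) = (if i = j then 1 else 0)" for i j
    using ON[of "b i" "b j"] \<open>range b = C\<close> \<open>inj b\<close> by (auto simp: inj_eq)
  ultimately show ?thesis using that[of b i0] span by simp
qed

text \<open>A unit timelike vector \<open>u\<close> is built from \<open>k\<close> and a vector dual
  to it. Reversing the sign of \<open>B\<close> along \<open>u\<close> gives a positive definite
  form \<open>P\<close>, and a \<open>P\<close>-orthonormal basis containing \<open>u\<close> is
  orthonormal for \<open>B\<close> in the Lorentzian sense.\<close>

lemma optical_form_imp_lorentzian:
  fixes B :: "real^'d::finite \<Rightarrow> real^'d \<Rightarrow> real"
  assumes "optical_form B k"
  shows "lorentzian_form B"
proof -
  have bil: "bilinear B" and sym: "\<And>v w. B v w = B w v" and k: "k \<noteq> 0" "B k k = 0"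
    and pos: "\<And>w. B k w = 0 \<Longrightarrow> w \<notin> span {k} \<Longrightarrow> B w w > 0"
    using assms unfolding optical_form_def by auto
  obtain l0 where l0: "B k l0 \<noteq> 0" using assms unfolding optical_form_def by blast
  note [simp] = bilinear_ladd[OF bil] bilinear_radd[OF bil] bilinear_lsub[OF bil] bilinear_rsub[OF bil]
    bilinear_lmul[OF bil] bilinear_rmul[OF bil]
  define l1 where "l1 = (1 / B k l0) *\<^sub>R l0"
  have l1: "B k l1 = 1" "B l1 k = 1" using l0 sym[of l0 k] by (auto simp: l1_def)
  \<comment> \<open>Moving along the null vector \<open>k\<close> changes the square of
    \<open>l1\<close> linearly; this coefficient brings it to -1.\<close>
  define u where "u = l1 - ((B l1 l1 + 1) / 2) *\<^sub>R k"
  have uu: "B u u = -1" and ku: "B k u = 1" "B u k = 1" using l1 k by (auto simp: u_def field_simps)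
  \<comment> \<open>Since \<open>B u u = -1\<close>, this agrees with \<open>B\<close> on the
    orthogonal complement of \<open>u\<close> and takes the value 1 at \<open>u\<close>.\<close>
  define P where "P v w = B v w + 2 * B v u * B w u" for v w
  have "bilinear P"
    unfolding bilinear_def by (auto intro!: linearI simp: P_def algebra_simps)
  moreover have "P v w = P w v" for v w using sym by (simp add: P_def)
  moreover have "P v v > 0" if "v \<noteq> 0" for v
  proof -
    \<comment> \<open>Decompose \<open>v = x *\<^sub>R u + y *\<^sub>R (k + u) + t\<close> with \<open>t\<close> orthogonal to \<open>k\<close> and \<open>u\<close>;
      here \<open>k + u\<close> is a unit vector orthogonal to \<open>u\<close>.\<close>
    define x where "x = - B v u"
    define y where "y = B v k - x"
    define t where "t = v - x *\<^sub>R u - y *\<^sub>R (k + u)"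
    have tk: "B t k = 0" "B k t = 0" using k ku sym[of k t] by (auto simp: t_def y_def)
    have tu: "B t u = 0" "B u t = 0" using k ku uu sym[of u t] by (auto simp: t_def x_def)
    have v: "v = x *\<^sub>R u + y *\<^sub>R (k + u) + t" by (simp add: t_def)
    have "B v v = - x\<^sup>2 + y\<^sup>2 + B t t"
      by (subst (1 2) v) (use tk tu k ku uu in \<open>simp add: power2_eq_square algebra_simps\<close>)
    then have P: "P v v = x\<^sup>2 + y\<^sup>2 + B t t" by (simp add: P_def x_def power2_eq_square)
    show ?thesis
    proof (cases "t = 0")
      case True
      then have "x \<noteq> 0 \<or> y \<noteq> 0" using v that by auto
      then show ?thesis
        using P True bilinear_lzero[OF bil, of 0] by (simp add: sum_power2_gt_zero_iff)
    next
      case False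
      have "t \<notin> span {k}"
      proof
        assume "t \<in> span {k}"
        then obtain a where "t = a *\<^sub>R k" unfolding span_singleton by blast
        then show False using tu ku False by auto
      qed
      then have "B t t > 0" using pos tk by blast
      then show ?thesis using P by (simp add: add_nonneg_pos)
    qed
  qed
  moreover have "P u u = 1" using uu by (simp add: P_def)
  ultimately obtain b :: "'d \<Rightarrow> real^'d" and i0 where b: "b i0 = u" "span (range b) = UNIV"
    "\<And>i j. P (b i) (b j) = (if i = j then 1 else 0)"
    using orthonormal_basis_containing by metis
  have Pu: "P v u = - B v u" for v using uu by (simp add: P_def)
  have "B v w = P v w - 2 * P v u * P w u" for v w unfolding Pu by (simp add: P_def)
  then have "B (b i) (b j) = (if i \<noteq> j then 0 else if i = i0 then -1 else 1)" for i j
    using b(3)[of i j] b(3)[of i i0] b(3)[of j i0] unfolding b(1) by auto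
  then show ?thesis unfolding lorentzian_form_def using bil b(2) by blast
qed

text \<open>Both \<open>v - \<kappa> v *\<^sub>R l\<close> and
  \<open>w - \<kappa> w *\<^sub>R l\<close> lie in the kernel. Expanding \<open>b\<close> on them
  leaves one term with \<open>b l l\<close>, shared equally between the two copies of \<alpha>;
  hence the half.\<close>

lemma form_vanishing_on_kernel:
  fixes b :: "real^'d::finite \<Rightarrow> real^'d \<Rightarrow> real"
  assumes "bilinear b" "\<And>v w. b v w = b w v" "linear \<kappa>" "\<kappa> l = 1"
    and "\<And>v w. \<kappa> v = 0 \<Longrightarrow> \<kappa> w = 0 \<Longrightarrow> b v w = 0"
    and \<alpha>: "\<And>v. \<alpha> v = b l v - b l l * \<kappa> v / 2"
  shows "b v w = \<kappa> v * \<alpha> w + \<alpha> v * \<kappa> w"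
proof -
  have "b (v - \<kappa> v *\<^sub>R l) (w - \<kappa> w *\<^sub>R l) = 0"
    by (rule assms(5)) (use assms(3,4) in \<open>simp_all add: linear_diff linear_cmul\<close>)
  then show ?thesis
    using assms(2)[of v l]
    by (simp add: \<alpha> bilinear_lsub[OF assms(1)] bilinear_rsub[OF assms(1)] bilinear_lmul[OF assms(1)]
        bilinear_rmul[OF assms(1)] algebra_simps)
qed

text \<open>A nonzero \<kappa> can be cancelled from the symmetric product: the pair (l,l) gives
  equality at l, then (v,l) gives it everywhere. This shows that \<alpha> does not depend on the
  auxiliary vector used to write it down.\<close>

lemma sym_prod_cancel:
  fixes \<kappa> :: "'v \<Rightarrow> real"
  assumes "\<kappa> l = 1" "\<And>v w. \<kappa> v * \<alpha> w + \<alpha> v * \<kappa> w = \<kappa> v * \<beta> w + \<beta> v * \<kappa> w"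
  shows "\<alpha> v = \<beta> v"
  using assms(2)[of l l] assms(2)[of v l] assms(1) by (simp add: algebra_simps)

text \<open>The screen bundle has rank \<open>n\<close>, and its frames are indexed by \<open>nat\<close>; the two
  directions \<open>ik\<close> and \<open>il\<close> are reserved for the line \<open>K\<close> and for a complement of \<open>N\<close>.\<close>
locale split_index =
  fixes ik il :: "'d::finite" and e :: "'d \<Rightarrow> nat" and n :: nat
  assumes ik_il: "ik \<noteq> il" and e: "bij_betw e (UNIV - {ik, il}) {..<n}"
begin

definition frame :: "real^'d \<Rightarrow> (nat \<Rightarrow> real^'d) \<Rightarrow> real^'d \<Rightarrow> 'd \<Rightarrow> real^'d" where
  "frame k X l i = (if i = ik then k else if i = il then l else X (e i))"

definition frame_det :: "real^'d \<Rightarrow> (nat \<Rightarrow> real^'d) \<Rightarrow> real^'d \<Rightarrow> real" where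
  "frame_det k X l = det (\<chi> i. frame k X l i)"

lemma e_less: "i \<noteq> ik \<Longrightarrow> i \<noteq> il \<Longrightarrow> e i < n"
  using e unfolding bij_betw_def by auto

lemma card_index: "CARD('d) = n + 2"
proof -
  have "card (UNIV - {ik, il}) = n" using bij_betw_same_card[OF e] by simp
  moreover have "card (UNIV - {ik, il}) = CARD('d) - card {ik, il}" by (rule card_Diff_subset) auto
  moreover have "card {ik, il} \<le> CARD('d)" by (rule card_mono) auto
  ultimately show ?thesis using ik_il by simp
qed

lemma range_frame: "range (frame k X l) = insert k (insert l (X ` {..<n}))"
proof -
  have "range (frame k X l) = frame k X l ` ({ik, il} \<union> (UNIV - {ik, il}))" by simp
  also have "\<dots> = {k, l} \<union> X ` e ` (UNIV - {ik, il})"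
    unfolding image_Un using ik_il by (auto simp: frame_def)
  also have "e ` (UNIV - {ik, il}) = {..<n}" using e by (simp add: bij_betw_def)
  finally show ?thesis by auto
qed

text \<open>With \<open>il\<close> tested first, the determinant has the shape expected by the row
  rules \<open>det_row_add\<close> and \<open>det_row_mul\<close> for the row
  \<open>il\<close>.\<close>

lemma frame_det_eq: "frame_det k X l = det (\<chi> i. if i = il then l else if i = ik then k else X (e i))"
  unfolding frame_det_def frame_def using ik_il by (intro arg_cong[where f = det]) (auto simp: vec_eq_iff)

lemma linear_frame_det_last: "linear (\<lambda>l. frame_det k X l)"
proof (rule linearI)
  fix r and v w :: "real^'d"
  let ?f = "\<lambda>i. if i = ik then k else X (e i)"
  show "frame_det k X (v + w) = frame_det k X v + frame_det k X w"
    unfolding frame_det_eq using det_row_add[of il "\<lambda>_. v" "\<lambda>_. w" ?f] by simp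
  show "frame_det k X (r *\<^sub>R v) = r *\<^sub>R frame_det k X v"
    unfolding frame_det_eq
    using det_row_mul[of il r "\<lambda>_. v" ?f, unfolded scalar_mult_eq_scaleR] by simp
qed

lemma linear_frame_det_first: "linear (\<lambda>k. frame_det k X l)"
proof (rule linearI)
  fix r and v w :: "real^'d"
  let ?f = "\<lambda>i. if i = il then l else X (e i)"
  show "frame_det (v + w) X l = frame_det v X l + frame_det w X l"
    unfolding frame_det_def frame_def using det_row_add[of ik "\<lambda>_. v" "\<lambda>_. w" ?f] by simp
  show "frame_det (r *\<^sub>R v) X l = r *\<^sub>R frame_det v X l"
    unfolding frame_det_def frame_def
    using det_row_mul[of ik r "\<lambda>_. v" ?f, unfolded scalar_mult_eq_scaleR] by simp
qed

lemma frame_det_nonzero_iff: "frame_det k X l \<noteq> 0 \<longleftrightarrow> span (insert k (insert l (X ` {..<n}))) = UNIV"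
proof -
  let ?M = "(\<chi> i. frame k X l i)"
  have "rows ?M = range (frame k X l)" by (auto simp: rows_def row_def)
  then have "span (insert k (insert l (X ` {..<n}))) = UNIV \<longleftrightarrow> (\<exists>B. B ** ?M = mat 1)"
    using matrix_left_invertible_span_rows[of ?M] range_frame by simp
  also have "\<dots> \<longleftrightarrow> frame_det k X l \<noteq> 0"
    unfolding frame_det_def invertible_det_nz[symmetric] invertible_left_inverse ..
  finally show ?thesis by blast
qed

lemma frame_det_last_zero:
  assumes "v \<in> span (insert k (X ` {..<n}))"
  shows "frame_det k X v = 0"
proof (rule ccontr)
  assume "frame_det k X v \<noteq> 0"
  then have "span (insert v (insert k (X ` {..<n}))) = UNIV"
    using frame_det_nonzero_iff by (simp add: insert_commute)
  then have "span (insert k (X ` {..<n})) = UNIV" using span_redundant[OF assms] by simp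
  then have "dim (insert k (X ` {..<n})) = n + 2" using card_index dim_span[of "insert k (X ` {..<n})"] by simp
  moreover have "dim (insert k (X ` {..<n})) \<le> card (insert k (X ` {..<n}))"
    by (rule dim_le_card') simp
  moreover have "card (insert k (X ` {..<n})) \<le> Suc (card (X ` {..<n}))" by (simp add: card_insert_if)
  moreover have "card (X ` {..<n}) \<le> n" using card_image_le[of "{..<n}" X] by simp
  ultimately show False by simp
qed

text \<open>When \<open>k\<close> and \<open>X\<close> frame the fibre of \<open>N\<close>, the
  determinant as a function of its last vector is a covector cutting out \<open>N\<close>. It is the
  numerator in Cramer's rule for the covector dual to \<open>l\<close>.\<close>

lemma kernel_frame_det:
  assumes "frame_det k X l \<noteq> 0"
  shows "frame_det k X v = 0 \<longleftrightarrow> v \<in> span (insert k (X ` {..<n}))"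
proof
  let ?S = "insert k (X ` {..<n})"
  assume z: "frame_det k X v = 0"
  have "v \<in> span (insert l ?S)"
    using frame_det_nonzero_iff assms by (metis UNIV_I insert_commute)
  then obtain a where a: "v - a *\<^sub>R l \<in> span ?S" unfolding span_breakdown_eq by blast
  then have "frame_det k X (v - a *\<^sub>R l) = 0" by (rule frame_det_last_zero)
  then have "frame_det k X v - a * frame_det k X l = 0"
    by (simp add: linear_diff[OF linear_frame_det_last] linear_cmul[OF linear_frame_det_last])
  then have "a = 0" using z assms by simp
  then show "v \<in> span ?S" using a by simp
qed (rule frame_det_last_zero)

text \<open>\<open>B\<close> is the change of frame from (k, X, l) to (k, Y, l) when Y equals X
  times a modulo k. Its rows \<open>ik\<close> and \<open>il\<close> are unit vectors, so only the
  block of \<open>a\<close> counts and the coefficients \<open>s\<close> along k do not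
  contribute.\<close>

lemma det_block:
  fixes a :: "nat \<Rightarrow> nat \<Rightarrow> real" and s :: "nat \<Rightarrow> real"
  defines "B \<equiv> (\<chi> r c. if r = ik then (if c = ik then 1 else 0) else if r = il then (if c = il then 1 else 0)
      else if c = ik then s (e r) else if c = il then 0 else a (e c) (e r)) :: real^'d^'d"
  shows "det B = (\<Sum>\<pi> | \<pi> permutes {..<n}. of_int (sign \<pi>) * (\<Prod>i<n. a i (\<pi> i)))"
proof -
  let ?R = "UNIV - {ik, il}"
  let ?f = "\<lambda>\<pi>. of_int (sign \<pi>) * (\<Prod>i\<in>UNIV. B $ \<pi> i $ i)"
  have "det B = det (transpose B)" by (simp add: det_transpose)
  also have "\<dots> = sum ?f {\<pi>. \<pi> permutes UNIV}" by (simp add: det_def transpose_def)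
  also have "\<dots> = sum ?f {\<pi>. \<pi> permutes ?R}"
  proof (rule sum.mono_neutral_right)
    show "{\<pi>. \<pi> permutes ?R} \<subseteq> {\<pi>. \<pi> permutes UNIV}" using permutes_subset by blast
    show "\<forall>\<pi>\<in>{\<pi>. \<pi> permutes UNIV} - {\<pi>. \<pi> permutes ?R}. ?f \<pi> = 0"
    proof
      fix \<pi> :: "'d \<Rightarrow> 'd" assume "\<pi> \<in> {\<pi>. \<pi> permutes UNIV} - {\<pi>. \<pi> permutes ?R}"
      then have \<pi>: "\<pi> permutes UNIV" "\<not> \<pi> permutes ?R" by auto
      have "\<exists>j. B $ \<pi> j $ j = 0"
      proof (rule ccontr)
        assume nz: "\<nexists>j. B $ \<pi> j $ j = 0"
        have "\<pi> r = r" if "r = ik \<or> r = il" for r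
        proof -
          obtain j where j: "\<pi> j = r" using permutes_surj[OF \<pi>(1)] by (metis surjD)
          have "B $ r $ j \<noteq> 0" using nz j by blast
          \<comment> \<open>The rows \<open>ik\<close> and \<open>il\<close> have their only nonzero
            entry on the diagonal, so a permutation with nonzero product must fix both
            indices.\<close>
          then have "j = r" using that ik_il by (auto simp: B_def split: if_splits)
          then show ?thesis using j by simp
        qed
        then have "\<pi> permutes ?R" using permutes_superset[OF \<pi>(1), of ?R] by auto
        then show False using \<pi>(2) by simp
      qed
      then show "?f \<pi> = 0" by (auto intro: prod_zero)
    qed
  qed (simp add: finite_permutations)
  also have "\<dots> = (\<Sum>\<pi> | \<pi> permutes {..<n}. of_int (sign \<pi>) * (\<Prod>i<n. a i (\<pi> i)))"
  \<comment> \<open>Permutations of the screen directions are carried by \<open>e\<close> to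
    permutations of the first \<open>n\<close> numbers, with the same sign.\<close>
  proof (rule sum.reindex_bij_witness[where j = "map_permutation ?R e" and i = "map_permutation {..<n} (inv_into ?R e)"])
    fix \<pi> assume "\<pi> \<in> {\<pi>. \<pi> permutes ?R}"
    then have \<pi>: "\<pi> permutes ?R" by simp
    show "map_permutation {..<n} (inv_into ?R e) (map_permutation ?R e \<pi>) = \<pi>"
      by (rule map_permutation_compose_inv[OF e \<pi>]) (use e in \<open>auto simp: bij_betw_def\<close>)
    show "map_permutation ?R e \<pi> \<in> {\<pi>. \<pi> permutes {..<n}}"
      using map_permutation_permutes[OF e \<pi>] by simp
    have inj: "inj_on e ?R" using e by (simp add: bij_betw_def)
    have sg: "sign (map_permutation ?R e \<pi>) = sign \<pi>"
      by (rule sign_map_permutation[OF inj \<pi>]) simp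
    have fix2: "\<pi> ik = ik" "\<pi> il = il" using \<pi> by (auto simp: permutes_not_in)
    have "(\<Prod>i<n. a i (map_permutation ?R e \<pi> i)) = (\<Prod>i\<in>?R. a (e i) (map_permutation ?R e \<pi> (e i)))"
      using prod.reindex_bij_betw[OF e, of "\<lambda>i. a i (map_permutation ?R e \<pi> i)"] by simp
    also have "\<dots> = (\<Prod>i\<in>?R. B $ \<pi> i $ i)"
    proof (rule prod.cong[OF refl])
      fix i assume i: "i \<in> ?R"
      then have "\<pi> i \<in> ?R" using \<pi> permutes_in_image by metis
      then show "a (e i) (map_permutation ?R e \<pi> (e i)) = B $ \<pi> i $ i"
        using i by (simp add: map_permutation_apply[OF inj] B_def)
    qed
    also have "\<dots> = (\<Prod>i\<in>UNIV. B $ \<pi> i $ i)"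
      by (rule prod.mono_neutral_left) (auto simp: fix2 B_def)
    finally show "of_int (sign (map_permutation ?R e \<pi>)) * (\<Prod>i<n. a i (map_permutation ?R e \<pi> i)) = ?f \<pi>"
      using sg by simp
  next
    fix \<pi> assume "\<pi> \<in> {\<pi>. \<pi> permutes {..<n}}"
    then have \<pi>: "\<pi> permutes {..<n}" by simp
    have e': "bij_betw (inv_into ?R e) {..<n} ?R" using e by (rule bij_betw_inv_into)
    show "map_permutation ?R e (map_permutation {..<n} (inv_into ?R e) \<pi>) = \<pi>"
      by (rule map_permutation_compose_inv[OF e' \<pi>]) (use e in \<open>auto simp: bij_betw_def f_inv_into_f\<close>)
    show "map_permutation {..<n} (inv_into ?R e) \<pi> \<in> {\<pi>. \<pi> permutes ?R}"
      using map_permutation_permutes[OF e' \<pi>] by simp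
  qed
  finally show ?thesis .
qed

text \<open>Links the Leibniz sum in \<open>screen_orientable\<close> with frame determinants: it is
  the factor by which the determinant changes when one screen frame replaces another, with
  \<open>k\<close> and \<open>l\<close> fixed.\<close>

lemma frame_det_change:
  assumes "\<And>j. j < n \<Longrightarrow> Y j - (\<Sum>i<n. a i j *\<^sub>R X i) \<in> span {k}"
  shows "frame_det k Y l = (\<Sum>\<pi> | \<pi> permutes {..<n}. of_int (sign \<pi>) * (\<Prod>i<n. a i (\<pi> i))) * frame_det k X l"
proof -
  let ?R = "UNIV - {ik, il}"
  have "\<exists>t. j < n \<longrightarrow> Y j = (\<Sum>i<n. a i j *\<^sub>R X i) + t *\<^sub>R k" for j
  proof (cases "j < n")
    case True
    then obtain t where "Y j - (\<Sum>i<n. a i j *\<^sub>R X i) = t *\<^sub>R k"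
      using assms unfolding span_singleton by blast
    then show ?thesis by (intro exI[of _ t]) (simp add: algebra_simps)
  qed simp
  then obtain s where s: "\<And>j. j < n \<Longrightarrow> Y j = (\<Sum>i<n. a i j *\<^sub>R X i) + s j *\<^sub>R k" by metis
  define B :: "real^'d^'d" where "B = (\<chi> r c. if r = ik then (if c = ik then 1 else 0)
      else if r = il then (if c = il then 1 else 0)
      else if c = ik then s (e r) else if c = il then 0 else a (e c) (e r))"
  have split: "(\<Sum>c\<in>UNIV. f c) = f ik + f il + (\<Sum>c\<in>?R. f c)" for f :: "'d \<Rightarrow> real"
    using sum.subset_diff[of "{ik, il}" UNIV f] ik_il by simp
  have "(\<chi> i. frame k Y l i) = B ** (\<chi> i. frame k X l i)"
  proof (intro vec_eq_iff[THEN iffD2] allI)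
    fix r m
    consider "r = ik" | "r = il" | "r \<in> ?R" by blast
    then show "(\<chi> i. frame k Y l i) $ r $ m = (B ** (\<chi> i. frame k X l i)) $ r $ m"
    proof cases
      case 3
      have "(B ** (\<chi> i. frame k X l i)) $ r $ m =
          s (e r) * k $ m + (\<Sum>c\<in>?R. a (e c) (e r) * X (e c) $ m)"
        using 3 ik_il by (simp add: matrix_matrix_mult_def split B_def frame_def)
      also have "(\<Sum>c\<in>?R. a (e c) (e r) * X (e c) $ m) = (\<Sum>i<n. a i (e r) * X i $ m)"
        using sum.reindex_bij_betw[OF e, of "\<lambda>i. a i (e r) * X i $ m"] .
      finally show ?thesis
        using s[of "e r"] e_less[of r] 3 by (simp add: frame_def)
    qed (use ik_il in \<open>simp_all add: matrix_matrix_mult_def split B_def frame_def\<close>)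
  qed
  then have "frame_det k Y l = det B * frame_det k X l"
    by (simp add: frame_det_def det_mul)
  also have "det B = (\<Sum>\<pi> | \<pi> permutes {..<n}. of_int (sign \<pi>) * (\<Prod>i<n. a i (\<pi> i)))"
    unfolding B_def by (rule det_block)
  finally show ?thesis .
qed

end

section \<open>Metrics for which a line distribution is null\<close>

definition orth :: "('m \<Rightarrow> (real^'d::finite) set) \<Rightarrow> ('m \<Rightarrow> real^'d \<Rightarrow> real^'d \<Rightarrow> real) \<Rightarrow> 'm \<Rightarrow> (real^'d) set" where
  "orth K g p = {w. \<forall>v\<in>K p. g p v w = 0}"

lemma (in smooth_manifold) smooth_vec_extension:
  obtains X where "X p = v" "smooth_vec_at X p"
proof -
  obtain c where c: "c \<in> A" "p \<in> fst c" using chart_exists by blast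
  show thesis
    by (rule that[of "\<lambda>q. of_coord A c q (to_coord A c p v)"])
      (use c in \<open>simp_all add: of_coord_to_coord smooth_vec_at_coord\<close>)
qed

lemma (in smooth_manifold) smooth_bilin_atD:
  "smooth_bilin_at g p \<Longrightarrow> smooth_vec_at X p \<Longrightarrow> smooth_vec_at Y p \<Longrightarrow> smooth_at (\<lambda>q. g q (X q) (Y q)) p"
  unfolding smooth_bilin_at_def by blast

locale line_distribution = smooth_manifold A
  for A :: "('m::{t2_space, second_countable_topology}, 'd::finite) chart set" +
  fixes K :: "'m \<Rightarrow> (real^'d) set"
  assumes line: "distribution A 1 K"
begin

lemma subspace_K: "subspace (K p)" and dim_K: "dim (K p) = 1"
  using line unfolding distribution_def by auto

lemma K_eq_span:
  assumes "k \<in> K p" "k \<noteq> 0"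
  shows "K p = span {k}"
proof (rule subspace_dim_equal[symmetric])
  show "span {k} \<subseteq> K p" using span_minimal[of "{k}"] subspace_K assms(1) by simp
  have "dim {k} = 1" using assms(2) dim_insert[of k "{}"] by simp
  then show "dim (K p) \<le> dim (span {k})" using dim_K dim_span[of "{k}"] by simp
qed (auto simp: subspace_K)

lemma local_generator:
  obtains U k where "open U" "p \<in> U" "\<And>q. q \<in> U \<Longrightarrow> smooth_vec_at k q" "\<And>q. q \<in> U \<Longrightarrow> k q \<in> K q"
    "\<And>q. q \<in> U \<Longrightarrow> k q \<noteq> 0"
proof -
  obtain U X where U: "open U" "p \<in> U" "smooth_vector_field A U (X (0::nat))"
      "\<And>q. q \<in> U \<Longrightarrow> K q = span ((\<lambda>i::nat. X i q) ` {..<1})"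
    using line unfolding distribution_def by (metis less_one)
  have s: "K q = span {X 0 q}" if "q \<in> U" for q
    using U(4)[OF that] by (simp add: lessThan_Suc)
  have "X 0 q \<noteq> 0" if "q \<in> U" for q
  proof
    assume "X 0 q = 0"
    then have "K q = {0}" using s[OF that] by simp
    then show False using dim_K[of q] by simp
  qed
  then show ?thesis
    using that[of U "X 0"] U s smooth_vector_field_iff[OF U(1)] by (simp add: span_base)
qed

lemma generator_exists: "\<exists>k\<in>K p. k \<noteq> 0"
  using local_generator[of p] by metis

lemma null_metricsD:
  assumes "g \<in> null_metrics A K"
  shows "lorentzian_form (g p)" "smooth_bilin_at g p" "bilinear (g p)" "g p v w = g p w v"
    and "k \<in> K p \<Longrightarrow> k \<noteq> 0 \<Longrightarrow> optical_form (g p) k"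
proof -
  show l: "lorentzian_form (g p)" "smooth_bilin_at g p"
    using assms lorentzian_metric_iff unfolding null_metrics_def by auto
  have o: "optical_form (g p) k" if "k \<in> K p" "k \<noteq> 0" for k
    using lorentzian_imp_optical_form[OF l(1) that(2)] that(1) assms unfolding null_metrics_def by auto
  then show "k \<in> K p \<Longrightarrow> k \<noteq> 0 \<Longrightarrow> optical_form (g p) k" .
  show "bilinear (g p)" "g p v w = g p w v"
    using o generator_exists[of p] unfolding optical_form_def by blast+
qed

lemma linear_right: "g \<in> null_metrics A K \<Longrightarrow> linear (g p v)"
  and linear_left: "g \<in> null_metrics A K \<Longrightarrow> linear (\<lambda>v. g p v w)"
  using null_metricsD(3)[of g p] unfolding bilinear_def by auto

lemma orth_eq_kernel:
  assumes "bilinear (g p)" "k \<in> K p" "k \<noteq> 0"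
  shows "orth K g p = {w. g p k w = 0}"
proof -
  have "g p v w = 0" if w: "g p k w = 0" and v: "v \<in> K p" for v w
  proof -
    obtain a where "v = a *\<^sub>R k" using v K_eq_span[OF assms(2,3)] unfolding span_singleton by auto
    then show ?thesis using w bilinear_lmul[OF assms(1)] by simp
  qed
  then show ?thesis using assms(2) unfolding orth_def by blast
qed

lemma orth_null:
  assumes "g \<in> null_metrics A K" "k \<in> K p" "k \<noteq> 0"
  shows "orth K g p = {w. g p k w = 0}"
  using orth_eq_kernel null_metricsD(3) assms by blast

text \<open>Reduces the relation to a comparison on N. The definition of \<open>optical_rel\<close>
  asks for a smooth \<alpha> over every local section, and the difficulty is to find it without a
  global smooth vector dual to k.\<close>

lemma optical_relI:
  assumes g: "g \<in> null_metrics A K" and g': "g' \<in> null_metrics A K"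
    and \<phi>: "\<And>p. smooth_at \<phi> p"
    and eq: "\<And>p v w. v \<in> orth K g p \<Longrightarrow> w \<in> orth K g p \<Longrightarrow> g' p v w = exp (2 * \<phi> p) * g p v w"
  shows "(g, g') \<in> optical_rel A K"
proof -
  \<comment> \<open>The remainder that has to be written as 2\<kappa>\<alpha>; by assumption it
    vanishes on N.\<close>
  define b where "b p v w = exp (- 2 * \<phi> p) * g' p v w - g p v w" for p v w
  have bil: "bilinear (b p)" for p
    unfolding bilinear_def b_def
    by (auto intro!: linearI simp: linear_add[OF linear_right] linear_cmul[OF linear_right] g g'
        linear_add[OF linear_left] linear_cmul[OF linear_left] algebra_simps)
  have sym: "b p v w = b p w v" for p v w
    unfolding b_def using null_metricsD(4) g g' by metis
  have bg: "g' p v w = exp (2 * \<phi> p) * (g p v w + b p v w)" for p v w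
    unfolding b_def by (simp add: mult_exp_exp[symmetric] exp_minus field_simps)
  have ex: "\<exists>\<alpha>. smooth_one_form A U \<alpha> \<and> (\<forall>p\<in>U. \<forall>v w. g' p v w =
        exp (2 * \<phi> p) * (g p v w + 2 * sym_prod (g p (k p)) (\<alpha> p) v w))"
    if U: "open U" and k: "smooth_section A K U k" and nz: "\<forall>p\<in>U. k p \<noteq> 0" for U k
  proof -
    have kK: "k p \<in> K p" "smooth_vec_at k p" if "p \<in> U" for p
      using k that smooth_vector_field_iff[OF U] unfolding smooth_section_def by auto
    have kern: "b p v w = 0" if "p \<in> U" "g p (k p) v = 0" "g p (k p) w = 0" for p v w
      using eq[of v p w] orth_null[OF g kK(1), of p] nz that
      by (simp add: b_def mult_exp_exp[symmetric] exp_minus)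
    have dual: "b p v w = g p (k p) v * (b p l w - b p l l * g p (k p) w / 2)
          + (b p l v - b p l l * g p (k p) v / 2) * g p (k p) w"
      if "p \<in> U" "g p (k p) l = 1" for p l v w
      by (rule form_vanishing_on_kernel[OF bil sym linear_right[OF g] that(2)]) (use kern that in auto)
    \<comment> \<open>This pointwise choice need not be smooth. It only defines \<alpha>, whose
      value does not depend on the choice.\<close>
    define l where "l p = (SOME l. g p (k p) l = 1)" for p
    have l: "g p (k p) (l p) = 1" if p: "p \<in> U" for p
    proof -
      have "optical_form (g p) (k p)" using null_metricsD(5)[OF g] kK(1) p nz by blast
      then obtain v where "g p (k p) v \<noteq> 0" unfolding optical_form_def by blast
      then have "g p (k p) ((1 / g p (k p) v) *\<^sub>R v) = 1" by (simp add: linear_cmul[OF linear_right[OF g]])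
      then show ?thesis unfolding l_def by (rule someI)
    qed
    define \<alpha> where "\<alpha> p v = b p (l p) v - b p (l p) (l p) * g p (k p) v / 2" for p v
    have lin: "linear (\<alpha> p)" for p
      unfolding \<alpha>_def
      by (rule linearI) (simp_all add: bilinear_radd[OF bil] bilinear_rmul[OF bil]
          linear_add[OF linear_right[OF g]] linear_cmul[OF linear_right[OF g]] algebra_simps add_divide_distrib)
    have "smooth_covec_at \<alpha> p" if p: "p \<in> U" for p
      unfolding smooth_covec_at_def
    proof (intro allI impI)
      fix X assume X: "smooth_vec_at X p"
      \<comment> \<open>For smoothness at \<open>p\<close>, the chosen vector is replaced nearby by
        a smooth field \<open>M\<close> normalised to pair to 1 with k; cancelling \<kappa> shows
        that \<open>M\<close> yields the same \<alpha>.\<close>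
      obtain L where L: "L p = l p" "smooth_vec_at L p" using smooth_vec_extension .
      note gs = smooth_bilin_atD[OF null_metricsD(2)[OF g]] and gs' = smooth_bilin_atD[OF null_metricsD(2)[OF g']]
      have s1: "smooth_at (\<lambda>q. g q (k q) (L q)) p" by (intro gs kK p L)
      have n1: "g p (k p) (L p) \<noteq> 0" using l[OF p] L by simp
      define M where "M q = (1 / g q (k q) (L q)) *\<^sub>R L q" for q
      have M: "smooth_vec_at M p"
        unfolding M_def by (intro smooth_vec_at_scaleR smooth_at_divide smooth_at_const s1 n1 L)
      have bs: "smooth_at (\<lambda>q. b q (Y q) (Z q)) p" if "smooth_vec_at Y p" "smooth_vec_at Z p" for Y Z
        unfolding b_def
        by (intro smooth_at_diff smooth_at_mult smooth_at_exp smooth_at_const \<phi> gs gs' that)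
      have "smooth_at (\<lambda>q. b q (M q) (X q) - b q (M q) (M q) * g q (k q) (X q) / 2) p"
        by (intro smooth_at_diff smooth_at_divide smooth_at_mult smooth_at_const bs gs M X kK p) simp
      moreover have "\<forall>\<^sub>F q in nhds p. b q (M q) (X q) - b q (M q) (M q) * g q (k q) (X q) / 2 = \<alpha> q (X q)"
        using smooth_at_nonzero[OF s1 n1] eventually_nhds_in_open[OF U p]
      proof eventually_elim
        case (elim q)
        have Mq: "g q (k q) (M q) = 1" using elim by (simp add: M_def linear_cmul[OF linear_right[OF g]])
        show ?case
          unfolding \<alpha>_def
          by (rule sym_prod_cancel[where \<kappa> = "g q (k q)" and l = "M q", OF Mq])
            (use dual[OF elim(2) Mq] dual[OF elim(2) l[OF elim(2)]] in metis)
      qed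
      ultimately show "smooth_at (\<lambda>q. \<alpha> q (X q)) p" by (rule smooth_at_cong[rotated])
    qed
    then have "smooth_one_form A U \<alpha>" using lin smooth_one_form_iff[OF U] by blast
    moreover have "g' p v w = exp (2 * \<phi> p) * (g p v w + 2 * sym_prod (g p (k p)) (\<alpha> p) v w)"
      if "p \<in> U" for p v w
      using dual[OF that l[OF that], of v w] unfolding bg sym_prod_def \<alpha>_def by simp
    ultimately show ?thesis by blast
  qed
  have "smooth_fun A UNIV \<phi>" using \<phi> smooth_fun_iff[OF open_UNIV] by blast
  then show ?thesis
    unfolding optical_rel_def mem_Collect_eq case_prod_conv
    by (intro conjI g g' exI[of _ \<phi>] allI impI) (auto intro: ex)
qed

text \<open>On the kernel of \<kappa> both terms of 2\<kappa>\<alpha> vanish, so only the scaling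
  survives there. That the two metrics have the same orthogonal complement of K uses the
  nondegeneracy of the second one.\<close>

lemma optical_relD:
  assumes "(g, g') \<in> optical_rel A K"
  obtains \<phi> where "\<And>p. smooth_at \<phi> p" "\<And>p. orth K g' p = orth K g p"
    "\<And>p v w. v \<in> orth K g p \<Longrightarrow> w \<in> orth K g p \<Longrightarrow> g' p v w = exp (2 * \<phi> p) * g p v w"
proof -
  have g: "g \<in> null_metrics A K" and g': "g' \<in> null_metrics A K"
    using assms unfolding optical_rel_def by auto
  obtain \<phi> where \<phi>: "smooth_fun A UNIV \<phi>"
    and \<alpha>: "\<And>U k. open U \<Longrightarrow> smooth_section A K U k \<Longrightarrow> (\<forall>p\<in>U. k p \<noteq> 0) \<Longrightarrow>
         (\<exists>\<alpha>. smooth_one_form A U \<alpha> \<and> (\<forall>p\<in>U. \<forall>v w. g' p v w =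
              exp (2 * \<phi> p) * (g p v w + 2 * sym_prod (g p (k p)) (\<alpha> p) v w)))"
    using assms unfolding optical_rel_def mem_Collect_eq case_prod_conv by (elim conjE exE) simp
  have *: "orth K g' p = orth K g p \<and> (\<forall>v\<in>orth K g p. \<forall>w\<in>orth K g p. g' p v w = exp (2 * \<phi> p) * g p v w)" for p
  proof -
    obtain U k where U: "open U" "p \<in> U" and k: "\<And>q. q \<in> U \<Longrightarrow> smooth_vec_at k q" "\<And>q. q \<in> U \<Longrightarrow> k q \<in> K q"
      "\<And>q. q \<in> U \<Longrightarrow> k q \<noteq> 0" by (metis local_generator[of p])
    have "smooth_section A K U k"
      unfolding smooth_section_def using smooth_vector_field_iff[OF U(1)] k by blast
    then obtain \<beta> where \<beta>: "\<And>v w. g' p v w = exp (2 * \<phi> p) * (g p v w + 2 * sym_prod (g p (k p)) (\<beta> p) v w)"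
      using \<alpha>[OF U(1)] k(3) U(2) by metis
    have o: "optical_form (g p) (k p)" "optical_form (g' p) (k p)"
      using null_metricsD(5) g g' k U by auto
    then have kk: "g p (k p) (k p) = 0" unfolding optical_form_def by blast
    \<comment> \<open>As k is null, inserting it leaves only the factor 1 + \<beta>(k). It is
      nonzero because g' pairs k nontrivially, but it may be negative.\<close>
    have scale: "g' p (k p) w = exp (2 * \<phi> p) * (1 + \<beta> p (k p)) * g p (k p) w" for w
      unfolding \<beta> sym_prod_def using kk by (simp add: algebra_simps)
    obtain w where "g' p (k p) w \<noteq> 0" using o(2) unfolding optical_form_def by blast
    then have "exp (2 * \<phi> p) * (1 + \<beta> p (k p)) \<noteq> 0" unfolding scale by auto
    then have "g' p (k p) w = 0 \<longleftrightarrow> g p (k p) w = 0" for w unfolding scale by simp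
    moreover have og: "orth K g p = {w. g p (k p) w = 0}" "orth K g' p = {w. g' p (k p) w = 0}"
      using orth_null g g' k U by auto
    ultimately show ?thesis by (simp add: \<beta> sym_prod_def)
  qed
  show thesis
    by (rule that[of \<phi>]) (use \<phi> * smooth_fun_iff[OF open_UNIV] in auto)
qed

text \<open>Symmetry and transitivity are not visible in the definition, where \<kappa> is formed
  with the first metric. In terms of the restrictions to the common complement they amount to
  negating and adding the exponents.\<close>

lemma equiv_optical_rel: "equiv (null_metrics A K) (optical_rel A K)"
proof (rule equivI)
  show "optical_rel A K \<subseteq> null_metrics A K \<times> null_metrics A K"
    unfolding optical_rel_def by auto
  show "refl_on (null_metrics A K) (optical_rel A K)"
    by (rule refl_onI) (auto intro: optical_relI[where \<phi> = "\<lambda>p. 0"] smooth_at_const)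
  show "sym (optical_rel A K)"
  proof (rule symI)
    fix g g' assume r: "(g, g') \<in> optical_rel A K"
    obtain \<phi> where \<phi>: "\<And>p. smooth_at \<phi> p" "\<And>p. orth K g' p = orth K g p"
      "\<And>p v w. v \<in> orth K g p \<Longrightarrow> w \<in> orth K g p \<Longrightarrow> g' p v w = exp (2 * \<phi> p) * g p v w"
      using optical_relD[OF r] by metis
    show "(g', g) \<in> optical_rel A K"
      by (rule optical_relI[where \<phi> = "\<lambda>p. - \<phi> p"])
        (use r \<phi> smooth_at_minus[OF \<phi>(1)] in \<open>auto simp: optical_rel_def exp_minus\<close>)
  qed
  show "trans (optical_rel A K)"
  proof (rule transI)
    fix g g' g'' assume r: "(g, g') \<in> optical_rel A K" "(g', g'') \<in> optical_rel A K"
    obtain \<phi> where \<phi>: "\<And>p. smooth_at \<phi> p" "\<And>p. orth K g' p = orth K g p"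
      "\<And>p v w. v \<in> orth K g p \<Longrightarrow> w \<in> orth K g p \<Longrightarrow> g' p v w = exp (2 * \<phi> p) * g p v w"
      using optical_relD[OF r(1)] by metis
    obtain \<psi> where \<psi>: "\<And>p. smooth_at \<psi> p"
      "\<And>p v w. v \<in> orth K g' p \<Longrightarrow> w \<in> orth K g' p \<Longrightarrow> g'' p v w = exp (2 * \<psi> p) * g' p v w"
      using optical_relD[OF r(2)] by metis
    show "(g, g'') \<in> optical_rel A K"
      by (rule optical_relI[where \<phi> = "\<lambda>p. \<phi> p + \<psi> p"])
        (use r \<phi> \<psi> smooth_at_add[OF \<phi>(1) \<psi>(1)] in \<open>auto simp: optical_rel_def distrib_left exp_add\<close>)
  qed
qed

end

lemma span_extend_vector:
  fixes V :: "(real^'d::finite) set"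
  assumes "subspace V" "dim V = n + 1" "k \<in> V" "k \<noteq> 0"
  obtains x :: "nat \<Rightarrow> real^'d" where "span (insert k (x ` {..<n})) = V"
proof -
  have "independent {k}" using assms(4) by simp
  then obtain B where B: "{k} \<subseteq> B" "B \<subseteq> V" "independent B" "V \<subseteq> span B"
    using maximal_independent_subset_extend[of "{k}" V] assms(3) by blast
  have fin: "finite B" using B(3) by (rule independent_imp_finite)
  have "card B = n + 1" using basis_card_eq_dim[OF B(2,4,3)] assms(2) by simp
  then have "card (B - {k}) = n" using B(1) fin by simp
  then obtain x :: "nat \<Rightarrow> real^'d" where x: "bij_betw x {0..<n} (B - {k})"
    using ex_bij_betw_nat_finite[of "B - {k}"] fin by auto
  have "insert k (x ` {..<n}) = B"
    using bij_betw_imp_surj_on[OF x] B(1) by (auto simp: atLeast0LessThan)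
  moreover have "span B = V" using B(2,4) assms(1) by (rule span_subspace)
  ultimately have "span (insert k (x ` {..<n})) = V" by simp
  then show ?thesis by (rule that)
qed

context line_distribution
begin

section \<open>From a metric to its screen metric\<close>

lemma coset_eq_iff: "coset K p u = coset K p v \<longleftrightarrow> u - v \<in> K p"
proof
  assume "coset K p u = coset K p v"
  moreover have "u \<in> coset K p u" unfolding coset_def using subspace_0[OF subspace_K] by force
  ultimately show "u - v \<in> K p" unfolding coset_def by auto
next
  assume uv: "u - v \<in> K p"
  have "x \<in> coset K p v" if "x \<in> coset K p u" for x
  proof -
    obtain y where "x = u + y" "y \<in> K p" using \<open>x \<in> coset K p u\<close> unfolding coset_def by auto
    then have "x = v + ((u - v) + y)" "(u - v) + y \<in> K p" using uv subspace_add[OF subspace_K] by auto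
    then show ?thesis unfolding coset_def by blast
  qed
  moreover have "x \<in> coset K p u" if "x \<in> coset K p v" for x
  proof -
    obtain y where "x = v + y" "y \<in> K p" using \<open>x \<in> coset K p v\<close> unfolding coset_def by auto
    then have "x = u + (y - (u - v))" "y - (u - v) \<in> K p" using uv subspace_diff[OF subspace_K] by auto
    then show ?thesis unfolding coset_def by blast
  qed
  ultimately show "coset K p u = coset K p v" by blast
qed

lemma subspace_orth: "g \<in> null_metrics A K \<Longrightarrow> subspace (orth K g p)"
  unfolding orth_def by (rule subspaceI)
    (simp_all add: linear_0[OF linear_right] linear_add[OF linear_right] linear_cmul[OF linear_right])

lemma K_subset_orth: "g \<in> null_metrics A K \<Longrightarrow> K p \<subseteq> orth K g p"
proof
  fix k assume g: "g \<in> null_metrics A K" and k: "k \<in> K p"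
  show "k \<in> orth K g p"
  proof (cases "k = 0")
    case True
    then show ?thesis using subspace_0[OF subspace_orth[OF g]] by simp
  next
    case False
    then show ?thesis
      using orth_null[OF g k False] null_metricsD(5)[OF g k False] unfolding optical_form_def by simp
  qed
qed

lemma orth_kills_K:
  assumes "g \<in> null_metrics A K" "v \<in> K p" "w \<in> orth K g p"
  shows "g p v w = 0" "g p w v = 0"
proof -
  show "g p v w = 0" using assms(2,3) unfolding orth_def by blast
  then show "g p w v = 0" using null_metricsD(4)[OF assms(1), of p w v] by simp
qed

lemma orth_positive:
  assumes "g \<in> null_metrics A K" "v \<in> orth K g p" "v \<notin> K p"
  shows "g p v v > 0"
proof -
  obtain k where k: "k \<in> K p" "k \<noteq> 0" using generator_exists by blast
  then show ?thesis
    using null_metricsD(5)[OF assms(1) k] orth_kills_K(1)[OF assms(1) k(1) assms(2)] assms(3) K_eq_span[OF k]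
    unfolding optical_form_def by blast
qed

text \<open>K is orthogonal to all of N, so the value does not change with the representatives, and
  the definite description in \<open>screen_metric_of\<close> is well defined.\<close>

lemma screen_metric_of_coset:
  assumes g: "g \<in> null_metrics A K" and v: "v \<in> orth K g p" and w: "w \<in> orth K g p"
  shows "screen_metric_of K (orth K g) g p (coset K p v) (coset K p w) = g p v w"
proof -
  have eq: "g p (v + a) (w + b) = g p v w" if "a \<in> K p" "b \<in> K p" for a b
    using orth_kills_K[OF g that(1) w] orth_kills_K[OF g that(2) v] orth_kills_K(1)[OF g that(1)]
      K_subset_orth[OF g] that(2)
    by (simp add: linear_add[OF linear_left[OF g]] linear_add[OF linear_right[OF g]] subset_iff)
  have "(THE r. \<forall>x\<in>coset K p v. \<forall>y\<in>coset K p w. g p x y = r) = g p v w"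
  proof (rule the_equality)
    show "\<forall>x\<in>coset K p v. \<forall>y\<in>coset K p w. g p x y = g p v w"
      unfolding coset_def using eq by auto
    fix r assume r: "\<forall>x\<in>coset K p v. \<forall>y\<in>coset K p w. g p x y = r"
    have "v \<in> coset K p v" "w \<in> coset K p w"
      unfolding coset_def using subspace_0[OF subspace_K] by force+
    then have "g p v w = r" using r by simp
    then show "r = g p v w" ..
  qed
  then show ?thesis unfolding screen_metric_of_def screen_def using v w by simp
qed

lemma screen_metric_of_eqI:
  assumes g: "g \<in> null_metrics A K"
    and h0: "\<And>p a b. a \<notin> screen K (orth K g) p \<or> b \<notin> screen K (orth K g) p \<Longrightarrow> h p a b = 0"
    and h: "\<And>p v w. v \<in> orth K g p \<Longrightarrow> w \<in> orth K g p \<Longrightarrow> h p (coset K p v) (coset K p w) = g p v w"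
  shows "screen_metric_of K (orth K g) g = h"
proof (intro ext)
  fix p a b
  show "screen_metric_of K (orth K g) g p a b = h p a b"
  proof (cases "a \<in> screen K (orth K g) p \<and> b \<in> screen K (orth K g) p")
    case True
    then obtain v w where "v \<in> orth K g p" "w \<in> orth K g p" "a = coset K p v" "b = coset K p w"
      unfolding screen_def by blast
    then show ?thesis using h screen_metric_of_coset[OF g] by simp
  next
    case False
    then show ?thesis using h0 unfolding screen_metric_of_def by auto
  qed
qed

lemma screen_metric_of_in:
  assumes g: "g \<in> null_metrics A K"
  shows "screen_metric_of K (orth K g) g \<in> screen_metrics A K (orth K g)"
proof -
  let ?N = "orth K g" and ?h = "screen_metric_of K (orth K g) g"
  have 1: "?h p a b = 0" if "a \<notin> screen K ?N p \<or> b \<notin> screen K ?N p" for p a b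
    using that by (auto simp: screen_metric_of_def)
  have 2: "?h p a b = ?h p b a" if ab: "a \<in> screen K ?N p" "b \<in> screen K ?N p" for p a b
  proof -
    obtain v w where vw: "v \<in> ?N p" "w \<in> ?N p" "a = coset K p v" "b = coset K p w"
      using ab unfolding screen_def by blast
    then show ?thesis using screen_metric_of_coset[OF g] null_metricsD(4)[OF g, of p v w] by simp
  qed
  have 3: "?h p (coset K p (r *\<^sub>R u + s *\<^sub>R v)) b = r * ?h p (coset K p u) b + s * ?h p (coset K p v) b"
    if uv: "u \<in> ?N p" "v \<in> ?N p" "b \<in> screen K ?N p" for p u v b r s
  proof -
    obtain w where w: "w \<in> ?N p" "b = coset K p w" using uv(3) unfolding screen_def by blast
    have "r *\<^sub>R u + s *\<^sub>R v \<in> ?N p"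
      using uv subspace_orth[OF g] by (simp add: subspace_add subspace_scale)
    then show ?thesis
      using uv w screen_metric_of_coset[OF g]
      by (simp add: linear_add[OF linear_left[OF g]] linear_cmul[OF linear_left[OF g]])
  qed
  have 4: "?h p a a > 0" if a: "a \<in> screen K ?N p" "a \<noteq> coset K p 0" for p a
  proof -
    obtain v where v: "v \<in> ?N p" "a = coset K p v" using a(1) unfolding screen_def by blast
    then have "v \<notin> K p" using a(2) coset_eq_iff[of p v 0] by simp
    then show ?thesis using orth_positive[OF g v(1)] screen_metric_of_coset[OF g v(1) v(1)] v by simp
  qed
  have 5: "smooth_fun A U (\<lambda>p. ?h p (coset K p (X p)) (coset K p (Y p)))"
    if U: "open U" and XY: "smooth_section A ?N U X" "smooth_section A ?N U Y" for U X Y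
    unfolding smooth_fun_iff[OF U]
  proof
    fix p assume p: "p \<in> U"
    have v: "smooth_vec_at X p" "smooth_vec_at Y p" and m: "\<And>q. q \<in> U \<Longrightarrow> X q \<in> ?N q" "\<And>q. q \<in> U \<Longrightarrow> Y q \<in> ?N q"
      using XY p smooth_vector_field_iff[OF U] unfolding smooth_section_def by auto
    have "smooth_at (\<lambda>q. g q (X q) (Y q)) p"
      using smooth_bilin_atD[OF null_metricsD(2)[OF g]] v by blast
    then show "smooth_at (\<lambda>q. ?h q (coset K q (X q)) (coset K q (Y q))) p"
      by (rule smooth_at_cong[rotated])
        (use eventually_nhds_in_open[OF U p] in \<open>eventually_elim, use screen_metric_of_coset[OF g] m in simp\<close>)
  qed
  show ?thesis
    unfolding screen_metrics_def using 1 2 3 4 5 by blast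
qed

lemma scaled_null_metric:
  assumes g: "g \<in> null_metrics A K" and f: "\<And>p. smooth_at f p" "\<And>p. f p > (0::real)"
  shows "(\<lambda>p v w. f p * g p v w) \<in> null_metrics A K"
proof -
  have "lorentzian_form (\<lambda>v w. f p * g p v w)" for p
  proof -
    obtain k where k: "k \<in> K p" "k \<noteq> 0" using generator_exists by blast
    have "optical_form (g p) k" by (rule null_metricsD(5)[OF g k])
    then have "optical_form (\<lambda>v w. f p * g p v w) k"
      using f(2)[of p] unfolding optical_form_def bilinear_def
      by (auto intro!: linearI simp: linear_add[OF linear_right[OF g]] linear_cmul[OF linear_right[OF g]]
        linear_add[OF linear_left[OF g]] linear_cmul[OF linear_left[OF g]] algebra_simps)
    then show ?thesis by (rule optical_form_imp_lorentzian)
  qed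
  moreover have "smooth_bilin_at (\<lambda>p v w. f p * g p v w) p" for p
    unfolding smooth_bilin_at_def
    using smooth_at_mult[OF f(1)] smooth_bilin_atD[OF null_metricsD(2)[OF g]] by blast
  ultimately have "lorentzian_metric A (\<lambda>p v w. f p * g p v w)"
    unfolding lorentzian_metric_iff by blast
  moreover have "g p v v = 0" if "v \<in> K p" for p v
    using g that unfolding null_metrics_def by blast
  ultimately show ?thesis unfolding null_metrics_def by simp
qed

text \<open>The whole induced structure can be computed from one representative: all members of the
  optical class share N, and their screen metrics fill out exactly one conformal class. Injectivity
  and surjectivity are both reduced to this.\<close>

lemma induced_class:
  assumes g: "g \<in> null_metrics A K"
  shows "induced_screen_structure (K, optical_rel A K `` {g}) =
    (K, orth K g, conformal_rel A K (orth K g) `` {screen_metric_of K (orth K g) g})"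
proof -
  let ?O = "optical_rel A K `` {g}" and ?N = "orth K g"
  have gO: "g \<in> ?O" using equiv_class_self[OF equiv_optical_rel g] .
  have orth_O: "orth K g' p = ?N p" if "g' \<in> ?O" for g' p
    using that optical_relD[of g g'] by (metis Image_singleton_iff)
  have "orth_distribution K ?O = ?N"
  proof
    fix p
    have "orth_distribution K ?O p = (\<Inter>g'\<in>?O. orth K g' p)"
      unfolding orth_distribution_def orth_def by blast
    also have "\<dots> = ?N p" using orth_O gO by blast
    finally show "orth_distribution K ?O p = ?N p" .
  qed
  moreover have "screen_metric_of K ?N ` ?O = conformal_rel A K ?N `` {screen_metric_of K ?N g}"
  proof (intro equalityI subsetI)
    fix h assume "h \<in> screen_metric_of K ?N ` ?O"
    then obtain g' where g': "(g, g') \<in> optical_rel A K" and h: "h = screen_metric_of K ?N g'" by blast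
    obtain \<phi> where \<phi>: "\<And>p. smooth_at \<phi> p" "\<And>p. orth K g' p = orth K g p"
      "\<And>p v w. v \<in> orth K g p \<Longrightarrow> w \<in> orth K g p \<Longrightarrow> g' p v w = exp (2 * \<phi> p) * g p v w"
      using optical_relD[OF g'] by metis
    have N': "orth K g' = ?N" using \<phi>(2) by (rule ext)
    have g'n: "g' \<in> null_metrics A K" using g' unfolding optical_rel_def by blast
    have "h = (\<lambda>p a b. exp (2 * \<phi> p) * screen_metric_of K ?N g p a b)"
      unfolding h N'[symmetric]
      by (rule screen_metric_of_eqI[OF g'n])
        (use screen_metric_of_coset[OF g] \<phi>(3) in \<open>auto simp: N' screen_metric_of_def\<close>)
    moreover have "smooth_fun A UNIV (\<lambda>p. exp (2 * \<phi> p))"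
      unfolding smooth_fun_iff[OF open_UNIV]
      using smooth_at_exp[OF smooth_at_mult[OF smooth_at_const \<phi>(1)]] by blast
    moreover have "h \<in> screen_metrics A K ?N"
      using screen_metric_of_in[OF g'n] by (simp add: N' h)
    ultimately have "(screen_metric_of K ?N g, h) \<in> conformal_rel A K ?N"
      unfolding conformal_rel_def using screen_metric_of_in[OF g]
      by (auto intro!: exI[of _ "\<lambda>p. exp (2 * \<phi> p)"])
    then show "h \<in> conformal_rel A K ?N `` {screen_metric_of K ?N g}" by blast
  next
    fix h assume "h \<in> conformal_rel A K ?N `` {screen_metric_of K ?N g}"
    then obtain f where f: "smooth_fun A UNIV f" "\<And>p. f p > 0"
      and h: "\<And>p a b. h p a b = f p * screen_metric_of K ?N g p a b"
      unfolding conformal_rel_def by blast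
    have sf: "smooth_at f p" for p using f(1) smooth_fun_iff[OF open_UNIV] by blast
    \<comment> \<open>A conformal factor on the screen is realised by scaling the whole metric; the
      exponent required by \<open>optical_rel\<close> is then half of its logarithm.\<close>
    let ?g' = "\<lambda>p v w. f p * g p v w"
    have g'n: "?g' \<in> null_metrics A K" by (rule scaled_null_metric[OF g sf f(2)])
    have N': "orth K ?g' = ?N"
      using f(2) by (intro ext) (auto simp: orth_def less_imp_neq[THEN not_sym])
    have "(g, ?g') \<in> optical_rel A K"
    proof (rule optical_relI[OF g g'n])
      show "smooth_at (\<lambda>p. ln (f p) / 2) p" for p
        by (intro smooth_at_divide smooth_at_ln smooth_at_const sf f) simp
    qed (use f(2) in \<open>simp add: exp_ln\<close>)
    moreover have "screen_metric_of K (orth K ?g') ?g' = h"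
      by (rule screen_metric_of_eqI[OF g'n])
        (use screen_metric_of_coset[OF g] in \<open>auto simp: N' h screen_metric_of_def\<close>)
    ultimately show "h \<in> screen_metric_of K ?N ` ?O" unfolding N' by blast
  qed
  ultimately show ?thesis unfolding induced_screen_structure_def by simp
qed

end

context split_index
begin

text \<open>Two linear functionals vanishing on the hyperplane spanned by \<open>k\<close> and
  \<open>X\<close> are proportional, and \<open>l\<close> fixes the ratio. With \<kappa> = g(k,.)
  this compares the sign given by the metric with that given by the orientation.\<close>

lemma frame_det_proportional:
  assumes D: "frame_det k X l \<noteq> 0" and \<kappa>: "linear \<kappa>" "\<And>v. v \<in> span (insert k (X ` {..<n})) \<Longrightarrow> \<kappa> v = (0::real)"
  shows "\<kappa> l * frame_det k X v = \<kappa> v * frame_det k X l"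
proof -
  define c where "c = frame_det k X v / frame_det k X l"
  have "frame_det k X (v - c *\<^sub>R l) = 0"
    using D by (simp add: linear_diff[OF linear_frame_det_last] linear_cmul[OF linear_frame_det_last] c_def)
  then have "\<kappa> (v - c *\<^sub>R l) = 0" using \<kappa>(2) kernel_frame_det[OF D] by blast
  then have "\<kappa> v = c * \<kappa> l" by (simp add: linear_diff[OF \<kappa>(1)] linear_cmul[OF \<kappa>(1)])
  then show ?thesis using D by (simp add: c_def)
qed

lemma dim_span_frame:
  assumes "frame_det k X l \<noteq> 0"
  shows "dim (span (insert k (X ` {..<n}))) = n + 1"
proof -
  have "{v. frame_det k X v = 0} = span (insert k (X ` {..<n}))" using kernel_frame_det[OF assms] by blast
  then show ?thesis using dim_kernel[OF linear_frame_det_last assms] card_index by simp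
qed

text \<open>Allows the orientation of a screen frame to be corrected by scaling its first vector,
  which exists only if \<open>n > 0\<close>.\<close>

lemma frame_det_flip:
  assumes "n > 0"
  shows "frame_det k (\<lambda>i. if i = 0 then s *\<^sub>R X i else X i) l = s * frame_det k X l"
proof -
  have "0 \<in> e ` (UNIV - {ik, il})" using e assms by (simp add: bij_betw_def)
  then obtain r where "e r = 0" "r \<in> UNIV - {ik, il}" by (metis imageE)
  then have r: "r \<noteq> ik" "r \<noteq> il" "e r = 0" by auto
  have Xr: "X (e r) = X 0" using r(3) by simp
  have eiff: "e i = 0 \<longleftrightarrow> i = r" if "i \<noteq> ik" "i \<noteq> il" for i
    using bij_betw_imp_inj_on[OF e] r that by (metis Diff_iff UNIV_I empty_iff inj_on_eq_iff insert_iff)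
  have "(\<chi> i. frame k (\<lambda>i. if i = 0 then s *\<^sub>R X i else X i) l i) =
      (\<chi> i. if i = r then s *\<^sub>R X 0 else frame k X l i)"
    using r(1,2) Xr eiff by (auto simp: vec_eq_iff frame_def)
  moreover have "(\<chi> i. frame k X l i) = (\<chi> i. if i = r then X 0 else frame k X l i)"
    using r(1,2) Xr by (auto simp: vec_eq_iff frame_def)
  ultimately show ?thesis
    unfolding frame_det_def
    using det_row_mul[of r s "\<lambda>_. X 0" "frame k X l", unfolded scalar_mult_eq_scaleR] by simp
qed

end

locale oriented_line = line_distribution A K + oriented_smooth_manifold A + split_index ik il e n
  for A :: "('m::{t2_space, second_countable_topology}, 'd::finite) chart set" and K
    and ik il :: 'd and e n
begin

section \<open>The orthogonal distribution and the orientation of the screen\<close>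

lemma dim_orth:
  assumes g: "g \<in> null_metrics A K"
  shows "dim (orth K g p) = n + 1"
proof -
  obtain k where k: "k \<in> K p" "k \<noteq> 0" using generator_exists by blast
  obtain l where l: "g p k l \<noteq> 0" using null_metricsD(5)[OF g k] unfolding optical_form_def by blast
  show ?thesis using dim_kernel[OF linear_right[OF g] l] card_index orth_null[OF g k] by simp
qed

lemma frame_spans_orth:
  assumes g: "g \<in> null_metrics A K" and k: "k \<in> K p"
    and X: "\<And>i. i < n \<Longrightarrow> X i \<in> orth K g p" and D: "frame_det k X l \<noteq> 0"
  shows "span (insert k (X ` {..<n})) = orth K g p"
proof (rule subspace_dim_equal)
  show "span (insert k (X ` {..<n})) \<subseteq> orth K g p"
    by (rule span_minimal[OF _ subspace_orth[OF g]]) (use X k K_subset_orth[OF g] in auto)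
  show "dim (orth K g p) \<le> dim (span (insert k (X ` {..<n})))"
    using dim_span_frame[OF D] dim_orth[OF g] by simp
qed (simp_all add: subspace_orth[OF g])

lemma span_K_Un:
  assumes "k \<in> K p" "k \<noteq> 0"
  shows "span (K p \<union> S) = span (insert k S)"
proof -
  have "K p \<subseteq> span (insert k S)"
    using K_eq_span[OF assms] span_mono[of "{k}" "insert k S"] by simp
  then have "K p \<union> S \<subseteq> span (insert k S)" using span_superset[of "insert k S"] by auto
  moreover have "insert k S \<subseteq> span (K p \<union> S)" using span_superset[of "K p \<union> S"] assms(1) by auto
  ultimately show ?thesis unfolding span_eq by blast
qed

lemma smooth_frame:
  assumes "smooth_vec_at k p" "\<And>i. i < n \<Longrightarrow> smooth_vec_at (X i) p" "smooth_vec_at l p"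
  shows "smooth_vec_at (\<lambda>q. frame (k q) (\<lambda>i. X i q) (l q) i) p"
  using assms e_less[of i] unfolding frame_def by (cases "i = ik"; cases "i = il") simp_all

lemma local_screen_frame:
  assumes g: "g \<in> null_metrics A K"
  obtains k X l where "frame_det (k p) (\<lambda>i. X i p) (l p) \<noteq> 0"
    "\<forall>\<^sub>F q in nhds p. smooth_vec_at k q \<and> k q \<in> K q \<and> k q \<noteq> 0 \<and> smooth_vec_at l q \<and> g q (k q) (l q) > 0 \<and>
       (\<forall>i<n. smooth_vec_at (X i) q \<and> X i q \<in> orth K g q)"
proof -
  obtain U k where U: "open U" "p \<in> U" and k: "\<And>q. q \<in> U \<Longrightarrow> smooth_vec_at k q" "\<And>q. q \<in> U \<Longrightarrow> k q \<in> K q"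
    "\<And>q. q \<in> U \<Longrightarrow> k q \<noteq> 0" by (metis local_generator[of p])
  have kp: "k p \<in> K p" "k p \<noteq> 0" "smooth_vec_at k p" using k U(2) by auto
  obtain l1 where l1: "g p (k p) l1 \<noteq> 0" using null_metricsD(5)[OF g kp(1,2)] unfolding optical_form_def by blast
  \<comment> \<open>Scaling by its own pairing with k turns the pairing into a square, hence
    positive.\<close>
  define l0 where "l0 = (g p (k p) l1) *\<^sub>R l1"
  have l0: "g p (k p) l0 > 0" 
  proof -
    have "g p (k p) l1 * g p (k p) l1 > 0" using l1 not_real_square_gt_zero by blast
    then show ?thesis by (simp add: l0_def linear_cmul[OF linear_right[OF g]])
  qed
  obtain l where l: "l p = l0" "smooth_vec_at l p" by (rule smooth_vec_extension)
  have "k p \<in> orth K g p" using K_subset_orth[OF g] kp by blast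
  then obtain x :: "nat \<Rightarrow> real^'d" where x: "span (insert (k p) (x ` {..<n})) = orth K g p"
    using span_extend_vector[OF subspace_orth[OF g] dim_orth[OF g] _ kp(2)] by metis
  have "\<exists>X. X p = x i \<and> smooth_vec_at X p" for i by (metis smooth_vec_extension)
  then obtain Y where Y: "\<And>i. Y i p = x i" "\<And>i. smooth_vec_at (Y i) p" by metis
  \<comment> \<open>Projection of arbitrary smooth extensions along \<open>l\<close> onto the kernel
    of g(k,.). At \<open>p\<close> it changes nothing, since the \<open>x i\<close> already lie
    there, so the frame stays independent.\<close>
  define X where "X i q = Y i q - (g q (k q) (Y i q) / g q (k q) (l q)) *\<^sub>R l q" for i q
  note gs = smooth_bilin_atD[OF null_metricsD(2)[OF g]]
  have gl: "g p (k p) (l p) > 0" using l l0 by simp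
  have Xs: "smooth_vec_at (X i) p" for i
    unfolding X_def
    by (intro smooth_vec_at_diff smooth_vec_at_scaleR smooth_at_divide gs kp Y l) (use gl in simp)
  have "x i \<in> orth K g p" if "i < n" for i
    using that x span_superset[of "insert (k p) (x ` {..<n})"] by auto
  then have Xp: "X i p = x i" if "i < n" for i
    using that Y(1) orth_null[OF g kp(1,2)] by (simp add: X_def)
  have "frame_det (k p) x (l p) \<noteq> 0"
  proof -
    let ?S = "insert (k p) (x ` {..<n})"
    have "l p \<notin> span ?S" unfolding x orth_null[OF g kp(1,2)] using gl by simp
    moreover have "dim ?S = n + 1" using dim_orth[OF g, of p] x dim_span[of ?S] by simp
    ultimately have "dim (insert (l p) ?S) = CARD('d)" by (simp add: dim_insert card_index)
    then have "span (insert (l p) ?S) = UNIV"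
      using subspace_dim_equal[of "span (insert (l p) ?S)" UNIV] dim_span[of "insert (l p) ?S"] by simp
    then show ?thesis unfolding frame_det_nonzero_iff by (simp add: insert_commute)
  qed
  moreover have "frame_det (k p) (\<lambda>i. X i p) (l p) = frame_det (k p) x (l p)"
    unfolding frame_det_def frame_def using Xp e_less by (intro arg_cong[where f = det]) (auto simp: vec_eq_iff)
  ultimately have D: "frame_det (k p) (\<lambda>i. X i p) (l p) \<noteq> 0" by simp
  have "\<forall>\<^sub>F q in nhds p. g q (k q) (l q) > 0" 
    by (rule smooth_at_pos[OF smooth_bilin_atD[OF null_metricsD(2)[OF g] kp(3) l(2)] gl])
  moreover have "\<forall>\<^sub>F q in nhds p. \<forall>i\<in>{..<n}. smooth_vec_at (X i) q"
    using smooth_vec_at_eventually[OF Xs] by (intro eventually_ball_finite) auto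
  ultimately have "\<forall>\<^sub>F q in nhds p. smooth_vec_at k q \<and> k q \<in> K q \<and> k q \<noteq> 0 \<and> smooth_vec_at l q \<and> g q (k q) (l q) > 0 \<and>
       (\<forall>i<n. smooth_vec_at (X i) q \<and> X i q \<in> orth K g q)"
    using smooth_vec_at_eventually[OF l(2)] eventually_nhds_in_open[OF U]
  proof eventually_elim
    case (elim q)
    have "X i q \<in> orth K g q" for i
      using elim orth_null[OF g k(2,3), of q]
      by (simp add: X_def linear_diff[OF linear_right[OF g]] linear_cmul[OF linear_right[OF g]])
    then show ?case using elim k by auto
  qed
  with D show ?thesis by (rule that)
qed

lemma distribution_orth:
  assumes g: "g \<in> null_metrics A K"
  shows "distribution A (n + 1) (orth K g)"
  unfolding distribution_def
proof (intro conjI allI)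
  fix p
  show "subspace (orth K g p)" "dim (orth K g p) = n + 1" using subspace_orth dim_orth g by auto
  obtain k X l where D: "frame_det (k p) (\<lambda>i. X i p) (l p) \<noteq> 0"
    and ev: "\<forall>\<^sub>F q in nhds p. smooth_vec_at k q \<and> k q \<in> K q \<and> k q \<noteq> 0 \<and> smooth_vec_at l q \<and> g q (k q) (l q) > 0 \<and>
       (\<forall>i<n. smooth_vec_at (X i) q \<and> X i q \<in> orth K g q)"
    by (rule local_screen_frame[OF g])
  have evp: "smooth_vec_at k p" "smooth_vec_at l p" "\<And>i. i < n \<Longrightarrow> smooth_vec_at (X i) p"
    using eventually_nhds_x_imp_x[OF ev] by auto
  have "\<forall>\<^sub>F q in nhds p. frame_det (k q) (\<lambda>i. X i q) (l q) \<noteq> 0"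
    unfolding frame_det_def
    by (rule eventually_det_nonzero) (use smooth_frame evp D in \<open>auto simp: frame_det_def\<close>)
  with ev have "\<forall>\<^sub>F q in nhds p. frame_det (k q) (\<lambda>i. X i q) (l q) \<noteq> 0 \<and> smooth_vec_at k q \<and> k q \<in> K q \<and>
      (\<forall>i<n. smooth_vec_at (X i) q \<and> X i q \<in> orth K g q)"
    by eventually_elim blast
  then obtain U where U: "open U" "p \<in> U" and P: "\<And>q. q \<in> U \<Longrightarrow> frame_det (k q) (\<lambda>i. X i q) (l q) \<noteq> 0 \<and>
      smooth_vec_at k q \<and> k q \<in> K q \<and> (\<forall>i<n. smooth_vec_at (X i) q \<and> X i q \<in> orth K g q)"
    unfolding eventually_nhds by blast
  \<comment> \<open>Index 0 holds the generator of K; the screen vectors are shifted by one.\<close>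
  define Z where "Z i q = (if i = 0 then k q else X (i - 1) q)" for i :: nat and q
  have "(\<lambda>i. Z i q) ` {..<n + 1} = insert (k q) ((\<lambda>i. X i q) ` {..<n})" for q
    by (simp only: Suc_eq_plus1[symmetric] lessThan_Suc_eq_insert_0 image_insert image_image) (simp add: Z_def)
  then have "orth K g q = span ((\<lambda>i. Z i q) ` {..<n + 1})" if "q \<in> U" for q
    using frame_spans_orth[OF g, of "k q" q "\<lambda>i. X i q" "l q"] P[OF that] by simp
  moreover have "smooth_vector_field A U (Z i)" if "i < n + 1" for i
    unfolding smooth_vector_field_iff[OF U(1)] Z_def using P that by (cases i) auto
  ultimately show "\<exists>U X. open U \<and> p \<in> U \<and> (\<forall>i<n + 1. smooth_vector_field A U (X i)) \<and>
        (\<forall>q\<in>U. orth K g q = span ((\<lambda>i. X i q) ` {..<n + 1}))"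
    using U by blast
qed

text \<open>The orienting frames are those which, completed by k in K and l with g(k,l) > 0, are
  positive in TM. The condition is unchanged if k and l are both reversed, so no orientation of K is
  needed.\<close>

lemma screen_orientable_orth:
  assumes g: "g \<in> null_metrics A K"
  shows "screen_orientable A n K (orth K g)"
proof (cases "n = 0")
  \<comment> \<open>There is no screen vector whose sign could be corrected, but the empty frame
    works: the Leibniz sum over the only permutation is 1.\<close>
  case True
  have "orth K g p = span (K p)" for p
  proof -
    have "K p = orth K g p"
      using subspace_dim_equal[OF subspace_K subspace_orth[OF g] K_subset_orth[OF g]] dim_orth[OF g] dim_K True by simp
    then show ?thesis using span_eq_iff subspace_K by metis
  qed
  then show ?thesis
    unfolding screen_orientable_def True by (intro exI[of _ "{(UNIV, \<lambda>_ _. 0)}"]) simp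
next
  case False
  let ?N = "orth K g"
  define F where "F = {(U, X). open U \<and> (\<forall>i<n. smooth_section A ?N U (X i)) \<and>
      (\<forall>p\<in>U. ?N p = span (K p \<union> (\<lambda>i. X i p) ` {..<n})) \<and>
      (\<forall>p\<in>U. \<forall>k\<in>K p. \<forall>l. g p k l > 0 \<longrightarrow> frame_det k (\<lambda>i. X i p) l > 0)}"
  have "\<exists>U X. (U, X) \<in> F \<and> p \<in> U" for p
  proof -
    obtain k X l where D: "frame_det (k p) (\<lambda>i. X i p) (l p) \<noteq> 0"
      and ev: "\<forall>\<^sub>F q in nhds p. smooth_vec_at k q \<and> k q \<in> K q \<and> k q \<noteq> 0 \<and> smooth_vec_at l q \<and> g q (k q) (l q) > 0 \<and>
         (\<forall>i<n. smooth_vec_at (X i) q \<and> X i q \<in> orth K g q)"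
      by (rule local_screen_frame[OF g])
    \<comment> \<open>The sign of the determinant at \<open>p\<close>; scaling the first vector by
      it makes the frame positive at \<open>p\<close>, hence nearby.\<close>
    define s where "s = sgn (frame_det (k p) (\<lambda>i. X i p) (l p))"
    define Y where "Y i q = (if i = 0 then s *\<^sub>R X i q else X i q)" for i :: nat and q
    have "frame_det (k p) (\<lambda>i. Y i p) (l p) > 0"
      unfolding Y_def frame_det_flip[OF False[unfolded neq0_conv]]
      using D by (simp add: s_def sgn_if)
    have Ysm: "smooth_vec_at (Y i) q" if "smooth_vec_at (X i) q" for i q
      unfolding Y_def using smooth_vec_at_scaleR[OF smooth_at_const that] that by (cases "i = 0") auto
    have Yin: "Y i q \<in> ?N q" if "X i q \<in> ?N q" for i q
      unfolding Y_def using subspace_scale[OF subspace_orth[OF g] that] that by (cases "i = 0") auto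
    have evp: "smooth_vec_at k p" "smooth_vec_at l p" "\<And>i. i < n \<Longrightarrow> smooth_vec_at (Y i) p"
      using eventually_nhds_x_imp_x[OF ev] Ysm by auto
    have "\<forall>\<^sub>F q in nhds p. frame_det (k q) (\<lambda>i. Y i q) (l q) > 0"
      unfolding frame_det_def
      by (rule eventually_det_pos) (use smooth_frame evp \<open>frame_det (k p) (\<lambda>i. Y i p) (l p) > 0\<close> in \<open>auto simp: frame_det_def\<close>)
    then have "\<forall>\<^sub>F q in nhds p. frame_det (k q) (\<lambda>i. Y i q) (l q) > 0 \<and> k q \<in> K q \<and> k q \<noteq> 0 \<and> g q (k q) (l q) > 0 \<and>
         (\<forall>i<n. smooth_vec_at (Y i) q \<and> Y i q \<in> ?N q)"
      using ev by eventually_elim (use Ysm Yin in blast)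
    then obtain U where U: "open U" "p \<in> U" and P: "\<And>q. q \<in> U \<Longrightarrow> frame_det (k q) (\<lambda>i. Y i q) (l q) > 0 \<and>
         k q \<in> K q \<and> k q \<noteq> 0 \<and> g q (k q) (l q) > 0 \<and> (\<forall>i<n. smooth_vec_at (Y i) q \<and> Y i q \<in> ?N q)"
      unfolding eventually_nhds by blast
    have sp: "span (insert (k q) ((\<lambda>i. Y i q) ` {..<n})) = ?N q" if "q \<in> U" for q
      using frame_spans_orth[OF g, of "k q" q "\<lambda>i. Y i q" "l q"] P[OF that] by auto
    have "frame_det k' (\<lambda>i. Y i q) l' > 0" if q: "q \<in> U" and k': "k' \<in> K q" and pos: "g q k' l' > 0" for q k' l'
    proof -
      have Pq: "frame_det (k q) (\<lambda>i. Y i q) (l q) > 0" "k q \<in> K q" "k q \<noteq> 0" "g q (k q) (l q) > 0" using P[OF q] by auto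
      obtain a where a: "k' = a *\<^sub>R k q" using k' K_eq_span[OF Pq(2,3)] unfolding span_singleton by auto
      have "g q (k q) (l q) * frame_det (k q) (\<lambda>i. Y i q) l' = g q (k q) l' * frame_det (k q) (\<lambda>i. Y i q) (l q)"
        by (rule frame_det_proportional[OF _ linear_right[OF g]])
          (use Pq sp[OF q] orth_null[OF g Pq(2,3)] in auto)
      then have "g q (k q) (l q) * frame_det k' (\<lambda>i. Y i q) l' = g q k' l' * frame_det (k q) (\<lambda>i. Y i q) (l q)"
        unfolding a by (simp add: linear_cmul[OF linear_left[OF g]] linear_cmul[OF linear_frame_det_first] mult.left_commute)
      then show ?thesis using Pq(1,4) pos by (metis mult_pos_pos zero_less_mult_pos)
    qed
    moreover have "?N q = span (K q \<union> (\<lambda>i. Y i q) ` {..<n})" if "q \<in> U" for q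
      using sp[OF that] span_K_Un[of "k q" q] P[OF that] by simp
    moreover have "smooth_section A ?N U (Y i)" if "i < n" for i
      unfolding smooth_section_def smooth_vector_field_iff[OF U(1)] using P that by blast
    ultimately have "(U, Y) \<in> F"
      unfolding F_def mem_Collect_eq case_prod_conv by (intro conjI U(1) ballI allI impI)
    then show ?thesis using U(2) by blast
  qed
  then have cover: "(\<Union>(U, X)\<in>F. U) = UNIV" by auto
  have frames: "\<forall>(U, X)\<in>F. open U \<and> (\<forall>i<n. smooth_section A ?N U (X i)) \<and>
           (\<forall>p\<in>U. ?N p = span (K p \<union> (\<lambda>i. X i p) ` {..<n}))"
    unfolding F_def by auto
  have det: "(\<Sum>\<pi> | \<pi> permutes {..<n}. of_int (sign \<pi>) * (\<Prod>i<n. a i (\<pi> i))) > (0::real)"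
    if F: "(U, X) \<in> F" "(V, Y) \<in> F" and p: "p \<in> U" "p \<in> V"
      and a: "\<And>j. j < n \<Longrightarrow> Y j p - (\<Sum>i<n. a i j *\<^sub>R X i p) \<in> K p" for U X V Y p a
  proof -
    obtain k where k: "k \<in> K p" "k \<noteq> 0" using generator_exists by blast
    obtain l where l: "g p k l \<noteq> 0" using null_metricsD(5)[OF g k] unfolding optical_form_def by blast
    have pos: "g p k (g p k l *\<^sub>R l) > 0"
    proof -
      have "g p k l * g p k l > 0" using l not_real_square_gt_zero by blast
      then show ?thesis by (simp add: linear_cmul[OF linear_right[OF g]])
    qed
    \<comment> \<open>Both frames are positive when completed by the same k and l, so the factor
      between the two determinants is positive.\<close>
    have d: "frame_det k (\<lambda>i. X i p) (g p k l *\<^sub>R l) > 0" "frame_det k (\<lambda>i. Y i p) (g p k l *\<^sub>R l) > 0"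
      using F p k(1) pos unfolding F_def by auto
    have "frame_det k (\<lambda>i. Y i p) (g p k l *\<^sub>R l) =
       (\<Sum>\<pi> | \<pi> permutes {..<n}. of_int (sign \<pi>) * (\<Prod>i<n. a i (\<pi> i))) * frame_det k (\<lambda>i. X i p) (g p k l *\<^sub>R l)"
      by (rule frame_det_change) (use a K_eq_span[OF k] in auto)
    from zero_less_mult_pos2[OF d(2)[unfolded this] d(1)] show ?thesis .
  qed
  show ?thesis
    unfolding screen_orientable_def
  proof (intro exI[of _ F] conjI cover frames)
    show "\<forall>(U, X)\<in>F. \<forall>(V, Y)\<in>F. \<forall>p\<in>U \<inter> V. \<forall>a :: nat \<Rightarrow> nat \<Rightarrow> real.
           (\<forall>j<n. Y j p - (\<Sum>i<n. a i j *\<^sub>R X i p) \<in> K p) \<longrightarrow>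
           (\<Sum>\<pi> | \<pi> permutes {..<n}. of_int (sign \<pi>) * (\<Prod>i<n. a i (\<pi> i))) > 0"
    proof (intro ballI case_prodI2 allI impI)
      fix P Q U X V Y p and a :: "nat \<Rightarrow> nat \<Rightarrow> real"
      assume "P \<in> F" "P = (U, X)" "Q \<in> F" "Q = (V, Y)" "p \<in> U \<inter> V"
        and "\<forall>j<n. Y j p - (\<Sum>i<n. a i j *\<^sub>R X i p) \<in> K p"
      then show "(\<Sum>\<pi> | \<pi> permutes {..<n}. of_int (sign \<pi>) * (\<Prod>i<n. a i (\<pi> i))) > (0::real)"
        using det[of U X V Y p a] by simp
    qed
  qed
qed

end

section \<open>Metrics inducing a given screen structure\<close>

lemma span_image_coefficients:
  fixes X :: "nat \<Rightarrow> 'v::real_vector"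
  assumes "v \<in> span (X ` {..<n})"
  shows "\<exists>a. v = (\<Sum>i<n. a i *\<^sub>R X i)"
proof -
  let ?S = "range (\<lambda>a :: nat \<Rightarrow> real. \<Sum>i<n. a i *\<^sub>R X i)"
  have "subspace ?S"
  proof (rule subspaceI)
    show "0 \<in> ?S" by (rule image_eqI[of _ _ "\<lambda>_. 0"]) auto
    fix u v c assume "u \<in> ?S"
    then obtain a where a: "u = (\<Sum>i<n. a i *\<^sub>R X i)" by blast
    show "c *\<^sub>R u \<in> ?S" by (rule image_eqI[of _ _ "\<lambda>i. c * a i"]) (auto simp: a scaleR_sum_right)
    assume "v \<in> ?S"
    then obtain b where b: "v = (\<Sum>i<n. b i *\<^sub>R X i)" by blast
    show "u + v \<in> ?S" by (rule image_eqI[of _ _ "\<lambda>i. a i + b i"]) (auto simp: a b scaleR_add_left sum.distrib)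
  qed
  moreover have "X j \<in> ?S" if "j < n" for j
  proof (rule image_eqI[of _ _ "\<lambda>i. if i = j then 1 else 0"])
    have "(\<Sum>i<n. (if i = j then 1 else 0) *\<^sub>R X i) = (\<Sum>i<n. if i = j then X i else 0)"
      by (rule sum.cong) auto
    then show "X j = (\<Sum>i<n. (if i = j then 1 else 0) *\<^sub>R X i)" using that by simp
  qed simp
  ultimately have "span (X ` {..<n}) \<subseteq> ?S" by (intro span_minimal) auto
  then show ?thesis using assms by blast
qed

lemma screen_metricsD:
  assumes "h \<in> screen_metrics A K N"
  shows "a \<notin> screen K N p \<or> b \<notin> screen K N p \<Longrightarrow> h p a b = 0"
    and "a \<in> screen K N p \<Longrightarrow> b \<in> screen K N p \<Longrightarrow> h p a b = h p b a"
    and "u \<in> N p \<Longrightarrow> v \<in> N p \<Longrightarrow> b \<in> screen K N p \<Longrightarrow>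
        h p (coset K p (r *\<^sub>R u + s *\<^sub>R v)) b = r * h p (coset K p u) b + s * h p (coset K p v) b"
    and "a \<in> screen K N p \<Longrightarrow> a \<noteq> coset K p 0 \<Longrightarrow> h p a a > 0"
    and "open U \<Longrightarrow> smooth_section A N U X \<Longrightarrow> smooth_section A N U Y \<Longrightarrow>
        smooth_fun A U (\<lambda>p. h p (coset K p (X p)) (coset K p (Y p)))"
proof -
  note * = assms[unfolded screen_metrics_def mem_Collect_eq]
  show "a \<notin> screen K N p \<or> b \<notin> screen K N p \<Longrightarrow> h p a b = 0" using *[THEN conjunct1] by blast
  show "a \<in> screen K N p \<Longrightarrow> b \<in> screen K N p \<Longrightarrow> h p a b = h p b a"
    using *[THEN conjunct2, THEN conjunct1] by blast
  show "u \<in> N p \<Longrightarrow> v \<in> N p \<Longrightarrow> b \<in> screen K N p \<Longrightarrow>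
        h p (coset K p (r *\<^sub>R u + s *\<^sub>R v)) b = r * h p (coset K p u) b + s * h p (coset K p v) b"
    using *[THEN conjunct2, THEN conjunct2, THEN conjunct1] by blast
  show "a \<in> screen K N p \<Longrightarrow> a \<noteq> coset K p 0 \<Longrightarrow> h p a a > 0"
    using *[THEN conjunct2, THEN conjunct2, THEN conjunct2, THEN conjunct1] by blast
  show "open U \<Longrightarrow> smooth_section A N U X \<Longrightarrow> smooth_section A N U Y \<Longrightarrow>
        smooth_fun A U (\<lambda>p. h p (coset K p (X p)) (coset K p (Y p)))"
    using *[THEN conjunct2, THEN conjunct2, THEN conjunct2, THEN conjunct2] by blast
qed

locale screen_structure = oriented_line A K ik il e n
  for A :: "('m::{t2_space, second_countable_topology}, 'd::finite) chart set" and K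
    and ik il :: 'd and e n +
  fixes N :: "'m \<Rightarrow> (real^'d) set" and h :: "'m \<Rightarrow> (real^'d) set \<Rightarrow> (real^'d) set \<Rightarrow> real"
    and F :: "('m set \<times> (nat \<Rightarrow> 'm \<Rightarrow> real^'d)) set"
  assumes N: "distribution A (n + 1) N" and KN: "K p \<subseteq> N p" and h: "h \<in> screen_metrics A K N"
    and F_cover: "\<exists>U X. (U, X) \<in> F \<and> p \<in> U"
    and F_frame: "(U, X) \<in> F \<Longrightarrow> open U \<and> (\<forall>i<n. smooth_section A N U (X i)) \<and>
           (\<forall>p\<in>U. N p = span (K p \<union> (\<lambda>i. X i p) ` {..<n}))"
    and F_det: "(U, X) \<in> F \<Longrightarrow> (V, Y) \<in> F \<Longrightarrow> p \<in> U \<Longrightarrow> p \<in> V \<Longrightarrow>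
        (\<And>j. j < n \<Longrightarrow> Y j p - (\<Sum>i<n. a i j *\<^sub>R X i p) \<in> K p) \<Longrightarrow>
           (\<Sum>\<pi> | \<pi> permutes {..<n}. of_int (sign \<pi>) * (\<Prod>i<n. a i (\<pi> i :: nat))) > (0::real)"
begin

lemma subspace_N: "subspace (N p)" and dim_N: "dim (N p) = n + 1"
  using N unfolding distribution_def by auto

text \<open>The screen metric pulled back to tangent vectors. It is bilinear only on N, because
  \<open>h\<close> is set to zero off the fibres; a projection onto N has to precede it in a form on
  the whole tangent space.\<close>

definition H :: "'m \<Rightarrow> real^'d \<Rightarrow> real^'d \<Rightarrow> real" where
  "H p v w = h p (coset K p v) (coset K p w)"

lemma coset_in_screen: "v \<in> N p \<Longrightarrow> coset K p v \<in> screen K N p"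
  unfolding screen_def by blast

lemma H_sym: "v \<in> N p \<Longrightarrow> w \<in> N p \<Longrightarrow> H p v w = H p w v"
  unfolding H_def by (intro screen_metricsD(2)[OF h] coset_in_screen)

lemma H_lin: "u \<in> N p \<Longrightarrow> v \<in> N p \<Longrightarrow> w \<in> N p \<Longrightarrow> H p (r *\<^sub>R u + s *\<^sub>R v) w = r * H p u w + s * H p v w"
  unfolding H_def by (intro screen_metricsD(3)[OF h] coset_in_screen)

lemma H_pos: "v \<in> N p \<Longrightarrow> v \<notin> K p \<Longrightarrow> H p v v > 0"
  unfolding H_def using screen_metricsD(4)[OF h coset_in_screen] coset_eq_iff[of p v 0] by simp

lemma H_zero:
  assumes "v \<in> K p" "w \<in> N p"
  shows "H p v w = 0" "H p w v = 0"
proof -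
  have "coset K p v = coset K p 0" using coset_eq_iff[of p v 0] assms(1) by simp
  then have "H p v w = H p 0 w" by (simp add: H_def)
  also have "\<dots> = 0"
    using H_lin[of 0 p 0 w 0 0] subspace_0[OF subspace_N] assms(2) by simp
  finally show "H p v w = 0" .
  then show "H p w v = 0" using H_sym assms KN by (metis subsetD)
qed

lemma smooth_H:
  assumes X: "smooth_vec_at X p" "\<forall>\<^sub>F q in nhds p. X q \<in> N q"
    and Y: "smooth_vec_at Y p" "\<forall>\<^sub>F q in nhds p. Y q \<in> N q"
  shows "smooth_at (\<lambda>q. H q (X q) (Y q)) p"
proof -
  have "\<forall>\<^sub>F q in nhds p. smooth_vec_at X q \<and> X q \<in> N q \<and> smooth_vec_at Y q \<and> Y q \<in> N q"
    using smooth_vec_at_eventually[OF X(1)] X(2) smooth_vec_at_eventually[OF Y(1)] Y(2)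
    by eventually_elim blast
  then obtain U where U: "open U" "p \<in> U" "\<forall>q\<in>U. smooth_vec_at X q \<and> X q \<in> N q \<and> smooth_vec_at Y q \<and> Y q \<in> N q"
    unfolding eventually_nhds by blast
  have "smooth_section A N U X" "smooth_section A N U Y"
    unfolding smooth_section_def smooth_vector_field_iff[OF U(1)] using U(3) by blast+
  then have "smooth_fun A U (\<lambda>p. h p (coset K p (X p)) (coset K p (Y p)))"
    by (rule screen_metricsD(5)[OF h U(1)])
  then show ?thesis using smooth_fun_iff[OF U(1)] U(2) unfolding H_def by blast
qed

text \<open>An orientation of K \<otimes> TM/N given by those of TM and N/K. One frame of
  \<open>F\<close> is asked for; \<open>positive_pairD\<close> shows that all frames of
  \<open>F\<close> at the point agree. A zero \<open>k\<close> is excluded by the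
  determinant.\<close>

definition positive_pair :: "'m \<Rightarrow> real^'d \<Rightarrow> real^'d \<Rightarrow> bool" where
  "positive_pair p k l \<longleftrightarrow> (\<exists>U X. (U, X) \<in> F \<and> p \<in> U \<and> frame_det k (\<lambda>i. X i p) l > 0)"

text \<open>The forms admissible at a point are a convex set, because of the sign condition on
  positive pairs; this is what makes gluing by partition functions possible.\<close>
definition admissible :: "'m \<Rightarrow> (real^'d \<Rightarrow> real^'d \<Rightarrow> real) \<Rightarrow> bool" where
  "admissible p B \<longleftrightarrow> bilinear B \<and> (\<forall>v w. B v w = B w v) \<and> (\<forall>k\<in>K p. \<forall>w\<in>N p. B k w = 0) \<and>
     (\<forall>v\<in>N p. \<forall>w\<in>N p. B v w = H p v w) \<and> (\<forall>k\<in>K p. \<forall>l. positive_pair p k l \<longrightarrow> B k l > 0)"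

lemma frame_in_N:
  assumes "(U, X) \<in> F" "p \<in> U" "k \<in> K p" "k \<noteq> 0"
  shows "span (insert k ((\<lambda>i. X i p) ` {..<n})) = N p"
  using F_frame[OF assms(1)] assms span_K_Un by metis

lemma frame_det_nonzero:
  assumes "(U, X) \<in> F" "p \<in> U" "k \<in> K p" "k \<noteq> 0" "l \<notin> N p"
  shows "frame_det k (\<lambda>i. X i p) l \<noteq> 0"
proof -
  let ?S = "insert k ((\<lambda>i. X i p) ` {..<n})"
  have S: "span ?S = N p" by (rule frame_in_N[OF assms(1-4)])
  then have "dim ?S = n + 1" using dim_N[of p] dim_span[of ?S] by simp
  then have "dim (insert l ?S) = CARD('d)" using S assms(5) by (simp add: dim_insert card_index)
  then have "span (insert l ?S) = UNIV"
    using subspace_dim_equal[of "span (insert l ?S)" UNIV] dim_span[of "insert l ?S"] by simp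
  then show ?thesis unfolding frame_det_nonzero_iff by (simp add: insert_commute)
qed

lemma complement_exists: "\<exists>l. l \<notin> N p"
proof (rule ccontr)
  assume "\<not> ?thesis"
  then have "N p = UNIV" by blast
  then show False using dim_N[of p] card_index by simp
qed

lemma frame_det_pos_exists:
  assumes "(U, X) \<in> F" "p \<in> U" "k \<in> K p" "k \<noteq> 0"
  shows "\<exists>l. frame_det k (\<lambda>i. X i p) l > 0"
proof -
  obtain l where "l \<notin> N p" using complement_exists by blast
  then have D: "frame_det k (\<lambda>i. X i p) l \<noteq> 0" by (rule frame_det_nonzero[OF assms])
  have "frame_det k (\<lambda>i. X i p) l * frame_det k (\<lambda>i. X i p) l > 0"
    using D not_real_square_gt_zero by blast
  then have "frame_det k (\<lambda>i. X i p) (frame_det k (\<lambda>i. X i p) l *\<^sub>R l) > 0"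
    by (simp add: linear_cmul[OF linear_frame_det_last])
  then show ?thesis by blast
qed

text \<open>Any two frames of \<open>F\<close> differ modulo K by a matrix of positive determinant,
  so the frame determinants with the same k and l have the same sign.\<close>

lemma positive_pairD:
  assumes U: "(U, X) \<in> F" "p \<in> U" and k: "k \<in> K p" and pos: "positive_pair p k l"
  shows "frame_det k (\<lambda>i. X i p) l > 0"
proof -
  obtain V Y where V: "(V, Y) \<in> F" "p \<in> V" and Y: "frame_det k (\<lambda>i. Y i p) l > 0"
    using pos unfolding positive_pair_def by blast
  have "k \<noteq> 0"
  proof
    assume "k = 0"
    then show False using Y linear_0[OF linear_frame_det_first] by simp
  qed
  have "\<exists>b. j < n \<longrightarrow> Y j p - (\<Sum>i<n. b i *\<^sub>R X i p) \<in> K p" for j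
  proof (cases "j < n")
    case True
    then have "Y j p \<in> N p" using F_frame[OF V(1)] V(2) unfolding smooth_section_def by blast
    then have "Y j p \<in> span (insert k ((\<lambda>i. X i p) ` {..<n}))" using frame_in_N[OF U k \<open>k \<noteq> 0\<close>] by simp
    then obtain t where "Y j p - t *\<^sub>R k \<in> span ((\<lambda>i. X i p) ` {..<n})" unfolding span_breakdown_eq by blast
    then obtain b where "Y j p - t *\<^sub>R k = (\<Sum>i<n. b i *\<^sub>R X i p)" using span_image_coefficients by blast
    then have "Y j p - (\<Sum>i<n. b i *\<^sub>R X i p) = t *\<^sub>R k" by (simp add: algebra_simps)
    then show ?thesis using subspace_scale[OF subspace_K k] by (intro exI[of _ b]) simp
  qed simp
  then obtain b where "\<And>j. j < n \<Longrightarrow> Y j p - (\<Sum>i<n. b j i *\<^sub>R X i p) \<in> K p" by metis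
  then obtain a where a: "\<And>j. j < n \<Longrightarrow> Y j p - (\<Sum>i<n. a i j *\<^sub>R X i p) \<in> K p"
    by (rule that[of "\<lambda>i j. b j i"])
  have eq: "frame_det k (\<lambda>i. Y i p) l = (\<Sum>\<pi> | \<pi> permutes {..<n}. of_int (sign \<pi>) * (\<Prod>i<n. a i (\<pi> i)))
      * frame_det k (\<lambda>i. X i p) l"
    by (rule frame_det_change) (use a K_eq_span[OF k \<open>k \<noteq> 0\<close>] in simp)
  from zero_less_mult_pos[OF Y[unfolded eq] F_det[OF U(1) V(1) U(2) V(2) a]] show ?thesis .
qed

text \<open>In a local frame (k, X, l) the form is a hyperbolic pair k, l with g(k,l) = 1,
  orthogonal to the X, plus the screen metric on X. Choosing l with positive determinant yields the
  sign condition.\<close>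

lemma local_admissible:
  "\<exists>g. \<forall>\<^sub>F q in nhds p. admissible q (g q) \<and> smooth_bilin_at g q"
proof -
  obtain U X where UF: "(U, X) \<in> F" "p \<in> U" using F_cover by blast
  have oU: "open U" and XN: "\<And>i q. i < n \<Longrightarrow> q \<in> U \<Longrightarrow> X i q \<in> N q"
    and Xs: "\<And>i q. i < n \<Longrightarrow> q \<in> U \<Longrightarrow> smooth_vec_at (X i) q"
    using F_frame[OF UF(1)] smooth_vector_field_iff[of U] unfolding smooth_section_def by auto
  obtain V k where V: "open V" "p \<in> V" and k: "\<And>q. q \<in> V \<Longrightarrow> smooth_vec_at k q" "\<And>q. q \<in> V \<Longrightarrow> k q \<in> K q"
    "\<And>q. q \<in> V \<Longrightarrow> k q \<noteq> 0" by (metis local_generator[of p])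
  obtain l0 where l0: "frame_det (k p) (\<lambda>i. X i p) l0 > 0"
    using frame_det_pos_exists[OF UF k(2,3)[OF V(2)]] by blast
  obtain l where l: "l p = l0" "smooth_vec_at l p" by (rule smooth_vec_extension)
  define D where "D q = frame_det (k q) (\<lambda>i. X i q) (l q)" for q
  have "\<forall>\<^sub>F q in nhds p. frame_det (k q) (\<lambda>i. X i q) (l q) > 0"
    unfolding frame_det_def
    by (rule eventually_det_pos) (use smooth_frame k(1) V(2) Xs UF(2) l l0 in \<open>auto simp: frame_det_def\<close>)
  then have "\<forall>\<^sub>F q in nhds p. D q > 0 \<and> smooth_vec_at l q \<and> q \<in> U \<and> q \<in> V"
    using smooth_vec_at_eventually[OF l(2)] eventually_nhds_in_open[OF oU UF(2)] eventually_nhds_in_open[OF V]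
    unfolding D_def by eventually_elim blast
  then obtain W where W: "open W" "p \<in> W" and P: "\<And>q. q \<in> W \<Longrightarrow> D q > 0 \<and> smooth_vec_at l q \<and> q \<in> U \<and> q \<in> V"
    unfolding eventually_nhds by blast
  \<comment> \<open>By Cramer's rule \<open>lam\<close> and \<open>mu\<close> are the members of the dual frame belonging to \<open>l\<close> and \<open>k\<close>;
    the kernel of \<open>lam\<close> is \<open>N\<close>, and \<open>\<pi>\<close> is the projection onto \<open>N\<close> along \<open>l\<close>.\<close>
  define lam where "lam q v = frame_det (k q) (\<lambda>i. X i q) v / D q" for q v
  define mu where "mu q v = frame_det v (\<lambda>i. X i q) (l q) / D q" for q v
  define \<pi> where "\<pi> q v = v - lam q v *\<^sub>R l q" for q v
  define g where "g q v w = mu q v * lam q w + lam q v * mu q w + H q (\<pi> q v) (\<pi> q w)" for q v w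
  have lam_lin: "linear (lam q)" for q
    unfolding lam_def by (rule linearI)
      (simp_all add: linear_add[OF linear_frame_det_last] linear_cmul[OF linear_frame_det_last] add_divide_distrib)
  have mu_lin: "linear (mu q)" for q
    unfolding mu_def by (rule linearI)
      (simp_all add: linear_add[OF linear_frame_det_first] linear_cmul[OF linear_frame_det_first] add_divide_distrib)
  have kN: "lam q v = 0 \<longleftrightarrow> v \<in> N q" if "q \<in> W" for q v
    using kernel_frame_det[of "k q" "\<lambda>i. X i q" "l q" v] P[OF that] frame_in_N[OF UF(1), of q "k q"] k(2,3)[of q]
    unfolding lam_def D_def by simp
  have lam_0: "lam q v = 0" if "q \<in> W" "v \<in> N q" for q v using kN that by blast
  have lam_l: "lam q (l q) = 1" and mu_k: "mu q (k q) = 1" if "q \<in> W" for q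
    using P[OF that] unfolding lam_def mu_def D_def by auto
  have \<pi>N: "\<pi> q v \<in> N q" if "q \<in> W" for q v
    unfolding kN[OF that, symmetric] \<pi>_def
    by (simp add: linear_diff[OF lam_lin] linear_cmul[OF lam_lin] lam_l[OF that])
  have \<pi>_id: "\<pi> q v = v" if "q \<in> W" "v \<in> N q" for q v
    using lam_0[OF that] by (simp add: \<pi>_def)
  have \<pi>_lin: "linear (\<pi> q)" for q
    unfolding \<pi>_def by (rule linearI)
      (simp_all add: linear_add[OF lam_lin] linear_cmul[OF lam_lin] algebra_simps)
  have adm: "admissible q (g q)" if q: "q \<in> W" for q
    unfolding admissible_def
  proof (intro conjI allI ballI impI)
    have sym: "g q v w = g q w v" for v w
      unfolding g_def using H_sym[OF \<pi>N[OF q] \<pi>N[OF q]] by simp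
    then show "g q v w = g q w v" for v w .
    have Hadd: "H q (a + b) c = H q a c + H q b c" and Hscale: "H q (r *\<^sub>R a) c = r * H q a c"
      if "a \<in> N q" "b \<in> N q" "c \<in> N q" for a b c r
      using H_lin[OF that, of 1 1] H_lin[OF that, of r 0] by auto
    have lin: "linear (\<lambda>v. g q v w)" for w
      unfolding g_def by (rule linearI)
        (simp_all add: linear_add[OF lam_lin] linear_cmul[OF lam_lin] linear_add[OF mu_lin] linear_cmul[OF mu_lin]
          linear_add[OF \<pi>_lin] linear_cmul[OF \<pi>_lin] Hadd Hscale[OF \<pi>N[OF q] \<pi>N[OF q] \<pi>N[OF q]] \<pi>N[OF q] algebra_simps)
    have "g q v = (\<lambda>w. g q w v)" for v using sym by (rule ext)
    then show "bilinear (g q)" unfolding bilinear_def using lin by metis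
    show "g q v w = H q v w" if "v \<in> N q" "w \<in> N q" for v w
      unfolding g_def using that lam_0[OF q] \<pi>_id[OF q] by simp
    \<comment> \<open>On K the covector \<open>lam\<close> vanishes and so does the term with
      \<open>H\<close>, K being its radical; a single product remains.\<close>
    have gk: "g q k' w = (mu q k') * lam q w" if "k' \<in> K q" for k' w
    proof -
      have "k' \<in> N q" using that KN by blast
      then show ?thesis
        unfolding g_def using lam_0[OF q] \<pi>_id[OF q] H_zero(1)[OF that \<pi>N[OF q]] by simp
    qed
    show "g q k' w = 0" if "k' \<in> K q" "w \<in> N q" for k' w
      using gk[OF that(1)] lam_0[OF q] that(2) by simp
    show "g q k' l' > 0" if k': "k' \<in> K q" and pos: "positive_pair q k' l'" for k' l'
    proof -
      have kq: "k q \<in> K q" "k q \<noteq> 0" using P[OF q] k by auto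
      obtain a where a: "k' = a *\<^sub>R k q" using k' K_eq_span[OF kq] unfolding span_singleton by auto
      have "frame_det k' (\<lambda>i. X i q) l' > 0" using positive_pairD[OF UF(1) _ k' pos] P[OF q] by blast
      \<comment> \<open>Passing from \<open>k q\<close> to its multiple \<open>k'\<close> scales the
        determinant and \<open>mu\<close> by the same \<open>a\<close>, so negative multiples also
        satisfy the sign condition.\<close>
      then have "a * frame_det (k q) (\<lambda>i. X i q) l' > 0" unfolding a by (simp add: linear_cmul[OF linear_frame_det_first])
      then have "a * lam q l' > 0" unfolding lam_def using P[OF q] by (simp add: zero_less_divide_iff)
      moreover have "mu q k' = a" unfolding a by (simp add: linear_cmul[OF mu_lin] mu_k[OF q])
      ultimately show ?thesis using gk[OF k'] by simp
    qed
  qed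
  have sm: "smooth_bilin_at g q" if q: "q \<in> W" for q
  proof -
    have s: "smooth_vec_at k q" "smooth_vec_at l q" "\<And>i. i < n \<Longrightarrow> smooth_vec_at (X i) q"
      and D: "frame_det (k q) (\<lambda>i. X i q) (l q) \<noteq> 0"
      using P[OF q] k Xs unfolding D_def by auto
    have lam_s: "smooth_at (\<lambda>q. lam q (V q)) q" if "smooth_vec_at V q" for V
      unfolding lam_def D_def frame_det_def
      by (rule smooth_at_det_ratio) (use smooth_frame s that D in \<open>auto simp: frame_det_def\<close>)
    have mu_s: "smooth_at (\<lambda>q. mu q (V q)) q" if "smooth_vec_at V q" for V
      unfolding mu_def D_def frame_det_def
      by (rule smooth_at_det_ratio) (use smooth_frame s that D in \<open>auto simp: frame_det_def\<close>)
    have \<pi>_s: "smooth_vec_at (\<lambda>q. \<pi> q (V q)) q" if "smooth_vec_at V q" for V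
      unfolding \<pi>_def by (intro smooth_vec_at_diff smooth_vec_at_scaleR lam_s that s)
    have "\<forall>\<^sub>F q' in nhds q. \<pi> q' (V q') \<in> N q'" for V
      using eventually_nhds_in_open[OF W(1) q] by eventually_elim (rule \<pi>N)
    then have "smooth_at (\<lambda>q. g q (V q) (V' q)) q" if "smooth_vec_at V q" "smooth_vec_at V' q" for V V'
      unfolding g_def by (intro smooth_at_add smooth_at_mult lam_s mu_s smooth_H \<pi>_s that)
    then show ?thesis unfolding smooth_bilin_at_def by blast
  qed
  have "\<forall>\<^sub>F q in nhds p. admissible q (g q) \<and> smooth_bilin_at g q"
    using eventually_nhds_in_open[OF W] by eventually_elim (use adm sm in blast)
  then show ?thesis by blast
qed

text \<open>All conditions at the point are linear equations, prescribed values or strict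
  inequalities. Dividing by the total weight preserves the prescribed values \<open>H\<close>;
  positive weights preserve the inequalities.\<close>

lemma admissible_average:
  fixes w :: "nat \<Rightarrow> real"
  assumes fin: "finite I" and w: "\<And>i. i \<in> I \<Longrightarrow> w i > 0" and ne: "I \<noteq> {}"
    and adm: "\<And>i. i \<in> I \<Longrightarrow> admissible p (B i)"
  shows "admissible p (\<lambda>u v. (\<Sum>i\<in>I. w i * B i u v) / (\<Sum>i\<in>I. w i))"
proof -
  have W: "(\<Sum>i\<in>I. w i) > 0" using fin w ne by (intro sum_pos) auto
  have bil: "\<And>i. i \<in> I \<Longrightarrow> bilinear (B i)" using adm unfolding admissible_def by blast
  have sym: "(\<Sum>i\<in>I. w i * B i u v) = (\<Sum>i\<in>I. w i * B i v u)" for u v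
    by (rule sum.cong) (use adm in \<open>auto simp: admissible_def\<close>)
  have "linear (\<lambda>u. (\<Sum>i\<in>I. w i * B i u v) / (\<Sum>i\<in>I. w i))" for v
    by (rule linearI)
      (simp_all add: bil bilinear_ladd bilinear_lmul distrib_left sum.distrib add_divide_distrib sum_distrib_left mult_ac
        cong: sum.cong)
  then have 1: "bilinear (\<lambda>u v. (\<Sum>i\<in>I. w i * B i u v) / (\<Sum>i\<in>I. w i))"
    unfolding bilinear_def using sym by simp
  have 2: "(\<Sum>i\<in>I. w i * B i k v) / (\<Sum>i\<in>I. w i) = 0" if "k \<in> K p" "v \<in> N p" for k v
  proof -
    have "(\<Sum>i\<in>I. w i * B i k v) = 0"
      by (rule sum.neutral) (use adm that in \<open>auto simp: admissible_def\<close>)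
    then show ?thesis by simp
  qed
  have 3: "(\<Sum>i\<in>I. w i * B i u v) / (\<Sum>i\<in>I. w i) = H p u v" if "u \<in> N p" "v \<in> N p" for u v
  proof -
    have "(\<Sum>i\<in>I. w i * B i u v) = (\<Sum>i\<in>I. w i * H p u v)"
      by (rule sum.cong) (use adm that in \<open>auto simp: admissible_def\<close>)
    then show ?thesis using W by (simp add: sum_distrib_right[symmetric])
  qed
  have 4: "(\<Sum>i\<in>I. w i * B i k l) / (\<Sum>i\<in>I. w i) > 0" if "k \<in> K p" "positive_pair p k l" for k l
  proof -
    have "(\<Sum>i\<in>I. w i * B i k l) > 0"
      using fin ne w adm that by (intro sum_pos mult_pos_pos) (auto simp: admissible_def)
    then show ?thesis using W by simp
  qed
  show ?thesis
    unfolding admissible_def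
    by (intro conjI allI ballI impI 1 2 3 4 arg_cong2[where f = "(/)"] sym refl) assumption+
qed

text \<open>The sign condition makes \<open>B k\<close> nonzero, since positive pairs exist for
  every nonzero k in K. Its kernel contains N and has the same dimension, so it equals N.\<close>

lemma admissible_kernel:
  assumes "admissible p B" "k \<in> K p" "k \<noteq> 0"
  shows "\<exists>l. B k l > 0" "B k w = 0 \<longleftrightarrow> w \<in> N p"
proof -
  obtain U X where U: "(U, X) \<in> F" "p \<in> U" using F_cover by blast
  obtain l where "positive_pair p k l"
    using frame_det_pos_exists[OF U assms(2,3)] U unfolding positive_pair_def by blast
  then have l: "B k l > 0" using assms unfolding admissible_def by blast
  then show "\<exists>l. B k l > 0" by blast
  have lin: "linear (B k)" using assms(1) unfolding admissible_def bilinear_def by blast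
  have "N p \<subseteq> {w. B k w = 0}" using assms unfolding admissible_def by blast
  moreover have "dim {w. B k w = 0} = dim (N p)"
    using dim_kernel[OF lin, of l] l dim_N card_index by simp
  ultimately have "N p = {w. B k w = 0}"
    using subspace_dim_equal[OF subspace_N linear_subspace_kernel[OF lin]] by simp
  then show "B k w = 0 \<longleftrightarrow> w \<in> N p" by blast
qed

lemma admissible_imp_lorentzian:
  assumes "admissible p B"
  shows "lorentzian_form B"
proof -
  obtain k where k: "k \<in> K p" "k \<noteq> 0" using generator_exists by blast
  have "optical_form B k"
    unfolding optical_form_def
  proof (intro conjI allI impI)
    show "\<exists>l. B k l \<noteq> 0" using admissible_kernel(1)[OF assms k] by (metis less_irrefl)
    show "B k k = 0" using admissible_kernel(2)[OF assms k] k(1) KN by blast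
    show "B w w > 0" if "B k w = 0" "w \<notin> span {k}" for w
    proof -
      have w: "w \<in> N p" "w \<notin> K p" using that admissible_kernel(2)[OF assms k] K_eq_span[OF k] by auto
      then have "B w w = H p w w" using assms unfolding admissible_def by blast
      then show ?thesis using H_pos[OF w] by simp
    qed
  qed (use assms k in \<open>auto simp: admissible_def\<close>)
  then show ?thesis by (rule optical_form_imp_lorentzian)
qed

lemma metric_of_admissible:
  assumes "\<And>p. admissible p (g p)" "\<And>p. smooth_bilin_at g p"
  shows "g \<in> null_metrics A K" "orth K g = N" "screen_metric_of K N g = h"
proof -
  have "g p v v = 0" if "v \<in> K p" for p v
    using assms(1)[of p] that KN unfolding admissible_def by blast
  then show g: "g \<in> null_metrics A K"
    unfolding null_metrics_def lorentzian_metric_iff using admissible_imp_lorentzian assms by blast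
  show o: "orth K g = N"
  proof
    fix p
    obtain k where k: "k \<in> K p" "k \<noteq> 0" using generator_exists by blast
    show "orth K g p = N p" using orth_null[OF g k] admissible_kernel(2)[OF assms(1) k] by blast
  qed
  have "screen_metric_of K (orth K g) g = h"
  proof (rule screen_metric_of_eqI[OF g])
    show "h p a b = 0" if "a \<notin> screen K (orth K g) p \<or> b \<notin> screen K (orth K g) p" for p a b
      using screen_metricsD(1)[OF h] that unfolding o by blast
    show "h p (coset K p v) (coset K p w) = g p v w" if "v \<in> orth K g p" "w \<in> orth K g p" for p v w
      using assms(1)[of p] that unfolding o admissible_def H_def by simp
  qed
  then show "screen_metric_of K N g = h" unfolding o .
qed

text \<open>Only admissibility and smoothness are carried through the gluing; the Lorentzian
  signature is recovered pointwise at the end.\<close>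

lemma metric_exists:
  obtains g where "g \<in> null_metrics A K" "orth K g = N" "screen_metric_of K N g = h"
proof -
  obtain g where "\<And>p. \<forall>\<^sub>F q in nhds p. admissible q (g p q) \<and> smooth_bilin_at (g p) q"
    using local_admissible by metis
  then have "\<exists>U. open U \<and> p \<in> U \<and> (\<forall>q\<in>U. admissible q (g p q) \<and> smooth_bilin_at (g p) q)" for p
    unfolding eventually_nhds by blast
  then obtain U where U: "\<And>p. open (U p) \<and> p \<in> U p"
    and g: "\<And>p q. q \<in> U p \<Longrightarrow> admissible q (g p q)" "\<And>p q. q \<in> U p \<Longrightarrow> smooth_bilin_at (g p) q"
    by metis
  obtain x :: "nat \<Rightarrow> 'm" and \<phi> :: "nat \<Rightarrow> 'm \<Rightarrow> real" where \<phi>: "\<And>i q. smooth_at (\<phi> i) q" "\<And>i q. \<phi> i q \<ge> 0" "\<And>q. \<exists>i. \<phi> i q > 0"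
    "\<And>q. \<exists>m. \<forall>\<^sub>F y in nhds q. \<forall>i\<ge>m. \<phi> i y = 0"
    "\<And>i q. q \<notin> U (x i) \<Longrightarrow> \<forall>\<^sub>F y in nhds q. \<phi> i y = 0"
    by (rule partition_functions[OF U], rule that)
  \<comment> \<open>Only indices with nonzero weight enter, since the local form of any other index
    may fail to be admissible at \<open>q\<close>.\<close>
  define I where "I q = {i. \<phi> i q \<noteq> 0}" for q
  define G where "G q u v = (\<Sum>i\<in>I q. \<phi> i q * g (x i) q u v) / (\<Sum>i\<in>I q. \<phi> i q)" for q u v
  have I_subset: "I q \<subseteq> {..<m}" if "\<forall>i\<ge>m. \<phi> i q = 0" for q m
    unfolding I_def using that by (auto simp: not_le[symmetric])
  have adm: "admissible q (G q)" for q
    unfolding G_def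
  proof (rule admissible_average)
    obtain m where "\<forall>\<^sub>F y in nhds q. \<forall>i\<ge>m. \<phi> i y = 0" using \<phi>(4) by blast
    then have "\<forall>i\<ge>m. \<phi> i q = 0" by (rule eventually_nhds_x_imp_x)
    then show "finite (I q)" using finite_subset[OF I_subset] by blast
    show "I q \<noteq> {}" using \<phi>(3)[of q] unfolding I_def by force
    fix i assume i: "i \<in> I q"
    then show "\<phi> i q > 0" using \<phi>(2)[of i q] unfolding I_def by simp
    have "q \<in> U (x i)"
    proof (rule ccontr)
      assume "q \<notin> U (x i)"
      then have "\<phi> i q = 0" by (rule eventually_nhds_x_imp_x[OF \<phi>(5)])
      then show False using i by (simp add: I_def)
    qed
    then show "admissible q (g (x i) q)" by (rule g)
  qed
  have sm: "smooth_bilin_at G p" for p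
    unfolding smooth_bilin_at_def
  proof (intro allI impI)
    fix X Y assume XY: "smooth_vec_at X p" "smooth_vec_at Y p"
    obtain m where m: "\<forall>\<^sub>F y in nhds p. \<forall>i\<ge>m. \<phi> i y = 0" using \<phi>(4) by blast
    \<comment> \<open>The index set varies with the point; by local finiteness it may be replaced
      near \<open>p\<close> by a fixed finite range, the added terms being zero.\<close>
    have sub: "(\<Sum>i\<in>I q. \<phi> i q * f i) = (\<Sum>i<m. \<phi> i q * f i)" if "\<forall>i\<ge>m. \<phi> i q = 0" for q and f :: "nat \<Rightarrow> real"
      by (rule sum.mono_neutral_left) (use I_subset[OF that] in \<open>auto simp: I_def\<close>)
    have mp: "\<forall>i\<ge>m. \<phi> i p = 0" using m by (rule eventually_nhds_x_imp_x)
    have "(\<Sum>i\<in>I p. \<phi> i p) > 0"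
    proof (rule sum_pos)
      show "finite (I p)" using I_subset[OF mp] finite_subset by blast
      show "I p \<noteq> {}" using \<phi>(3)[of p] unfolding I_def by force
      show "\<phi> i p > 0" if "i \<in> I p" for i using \<phi>(2)[of i p] that unfolding I_def by simp
    qed
    then have pos: "(\<Sum>i<m. \<phi> i p) \<noteq> 0" using sub[OF mp, of "\<lambda>_. 1"] by simp
    have "smooth_at (\<lambda>q. \<phi> i q * g (x i) q (X q) (Y q)) p" for i
    proof (cases "p \<in> U (x i)")
      case True
      then show ?thesis by (intro smooth_at_mult \<phi>(1) smooth_bilin_atD[OF g(2)] XY)
    next
      \<comment> \<open>The local form may fail to be smooth here, but its weight vanishes on a
        whole neighbourhood.\<close>
      case False
      have "\<forall>\<^sub>F q in nhds p. 0 = \<phi> i q * g (x i) q (X q) (Y q)"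
        using \<phi>(5)[OF False] by eventually_elim simp
      then show ?thesis by (rule smooth_at_cong) (rule smooth_at_const)
    qed
    then have "smooth_at (\<lambda>q. (\<Sum>i<m. \<phi> i q * g (x i) q (X q) (Y q)) / (\<Sum>i<m. \<phi> i q)) p"
      using pos by (intro smooth_at_divide smooth_at_sum \<phi>(1))
    moreover have "\<forall>\<^sub>F q in nhds p. (\<Sum>i<m. \<phi> i q * g (x i) q (X q) (Y q)) / (\<Sum>i<m. \<phi> i q) = G q (X q) (Y q)"
      using m
    proof eventually_elim
      case (elim q)
      show ?case
        using sub[OF elim, of "\<lambda>i. g (x i) q (X q) (Y q)"] sub[OF elim, of "\<lambda>_. 1"] by (simp add: G_def)
    qed
    ultimately show "smooth_at (\<lambda>q. G q (X q) (Y q)) p" by (rule smooth_at_cong[rotated])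
  qed
  show ?thesis by (rule that[of G]) (use metric_of_admissible[OF adm sm] in auto)
qed

end

section \<open>Assembly of the bijection\<close>

lemma split_index_exists:
  assumes "CARD('d::finite) = n + 2"
  obtains ik il :: "'d::finite" and e where "split_index ik il e n"
proof -
  have "1 < CARD('d)" using assms by simp
  then obtain ik il :: 'd where ne: "ik \<noteq> il"
    by (metis UNIV_I card_le_Suc0_iff_eq finite not_less One_nat_def)
  have "card (UNIV - {ik, il}) = CARD('d) - card {ik, il}" by (rule card_Diff_subset) auto
  then have "card (UNIV - {ik, il}) = card {..<n}" using assms ne by simp
  then obtain e where "bij_betw e (UNIV - {ik, il}) {..<n}"
    using finite_same_card_bij[of "UNIV - {ik, il}" "{..<n}"] by auto
  with ne show ?thesis by (intro that[of ik il e]) (simp add: split_index_def)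
qed

text \<open>The bijection makes the two kinds of data correspond, not merely exist together; the
  equivalence of the existence statements is read off from its two directions.\<close>

theorem proposition7p5:
  fixes A :: "('m::{t2_space, second_countable_topology}, 'd::finite) chart set"
    and n :: nat
  assumes "oriented_smooth_atlas A" and "CARD('d) = n + 2"
  shows "((\<exists>K \<O>. generalised_optical_structure A K \<O>) \<longleftrightarrow>
          (\<exists>K1 N \<C>. conformal_screen_structure A n K1 N \<C> \<and> screen_orientable A n K1 N)) \<and>
         bij_betw induced_screen_structure
           {(K, \<O>). generalised_optical_structure A K \<O>}
           {(K1, N, \<C>). conformal_screen_structure A n K1 N \<C> \<and> screen_orientable A n K1 N}"
proof -
  let ?I = induced_screen_structure
  let ?S = "{(K, \<O>). generalised_optical_structure A K \<O>}"
  let ?T = "{(K, N, \<C>). conformal_screen_structure A n K N \<C> \<and> screen_orientable A n K N}"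
  obtain ik il :: 'd and e where idx: "split_index ik il e n"
    using split_index_exists[OF assms(2)] by blast
  have oriented_line: "oriented_line A K ik il e n" if "distribution A 1 K" for K
  proof -
    have sm: "smooth_manifold A"
      using assms(1) unfolding oriented_smooth_atlas_def by unfold_locales blast
    have "line_distribution A K"
      using sm that by (simp add: line_distribution_def line_distribution_axioms_def)
    moreover have "oriented_smooth_manifold A"
      using sm assms(1) unfolding oriented_smooth_manifold_def oriented_smooth_manifold_axioms_def
        oriented_smooth_atlas_def by blast
    ultimately show ?thesis using idx by (simp add: oriented_line_def)
  qed
  have repr: "\<exists>g \<in> null_metrics A K. \<O> = optical_rel A K `` {g}"
    if "generalised_optical_structure A K \<O>" for K \<O>
    using that unfolding generalised_optical_structure_def quotient_def by blast
  have maps: "?I (K, \<O>) \<in> ?T" if gos: "generalised_optical_structure A K \<O>" for K \<O>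
  proof -
    have "distribution A 1 K" using gos unfolding generalised_optical_structure_def by blast
    then interpret oriented_line A K ik il e n by (rule oriented_line)
    obtain g where g: "g \<in> null_metrics A K" "\<O> = optical_rel A K `` {g}" using repr[OF gos] by blast
    have "conformal_rel A K (orth K g) `` {screen_metric_of K (orth K g) g} \<in>
        screen_metrics A K (orth K g) // conformal_rel A K (orth K g)"
      using screen_metric_of_in[OF g(1)] by (rule quotientI)
    then show ?thesis
      unfolding g(2) induced_class[OF g(1)] conformal_screen_structure_def
      using line distribution_orth[OF g(1)] K_subset_orth[OF g(1)] screen_orientable_orth[OF g(1)] by simp
  qed
  have inj: "inj_on ?I ?S"
  proof (rule inj_onI, clarify)
    fix K \<O> K' \<O>'
    assume gos: "generalised_optical_structure A K \<O>" "generalised_optical_structure A K' \<O>'"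
      and eq: "?I (K, \<O>) = ?I (K', \<O>')"
    then have K': "K' = K" unfolding induced_screen_structure_def by simp
    have "distribution A 1 K" using gos(1) unfolding generalised_optical_structure_def by blast
    then interpret oriented_line A K ik il e n by (rule oriented_line)
    obtain g where g: "g \<in> null_metrics A K" "\<O> = optical_rel A K `` {g}" using repr[OF gos(1)] by blast
    obtain g1 where g1: "g1 \<in> null_metrics A K" "\<O>' = optical_rel A K `` {g1}"
      using repr[OF gos(2)] unfolding K' by blast
    let ?N = "orth K g"
    have N1: "orth K g1 = ?N"
      using eq unfolding g(2) g1(2) K' induced_class[OF g(1)] induced_class[OF g1(1)] by simp
    have image: "screen_metric_of K ?N ` \<O> = screen_metric_of K ?N ` \<O>'"
    proof -
      have "orth_distribution K \<O> = ?N" "orth_distribution K \<O>' = ?N"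
        using induced_class[OF g(1)] induced_class[OF g1(1)] N1
        unfolding g(2) g1(2) induced_screen_structure_def by auto
      then show ?thesis using eq unfolding K' induced_screen_structure_def by simp
    qed
    have "g \<in> \<O>" unfolding g(2) by (rule equiv_class_self[OF equiv_optical_rel g(1)])
    \<comment> \<open>Equal conformal classes provide a member of the second class with literally
      the same screen metric as \<open>g\<close>, so the two metrics agree on N and the exponent can
      be taken to be 0.\<close>
    then obtain g' where g': "g' \<in> \<O>'" "screen_metric_of K ?N g' = screen_metric_of K ?N g"
      using image by (metis imageE imageI)
    have r1: "(g1, g') \<in> optical_rel A K" using g'(1) unfolding g1(2) by blast
    then have g'n: "g' \<in> null_metrics A K" unfolding optical_rel_def by blast
    have N': "orth K g' = ?N"
      using optical_relD[OF r1] N1 by (metis ext)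
    have "(g, g') \<in> optical_rel A K"
    proof (rule optical_relI[OF g(1) g'n smooth_at_const])
      fix p v w assume vw: "v \<in> ?N p" "w \<in> ?N p"
      have "g' p v w = g p v w"
        using screen_metric_of_coset[OF g(1) vw] screen_metric_of_coset[OF g'n, of v p w] vw g'(2)
        unfolding N' by simp
      then show "g' p v w = exp (2 * 0) * g p v w" by simp
    qed
    then have "(g, g1) \<in> optical_rel A K"
      using r1 equiv_optical_rel unfolding equiv_def by (meson symD transD)
    then show "K = K' \<and> \<O> = \<O>'"
      unfolding g(2) g1(2) K' using equiv_class_eq[OF equiv_optical_rel] by simp
  qed
  have surj: "\<exists>\<O>. generalised_optical_structure A K \<O> \<and> ?I (K, \<O>) = (K, N, \<C>)"
    if cs: "conformal_screen_structure A n K N \<C>" and so: "screen_orientable A n K N" for K N \<C>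
  proof -
    have D: "distribution A 1 K" "distribution A (n + 1) N" "\<And>p. K p \<subseteq> N p"
      and C: "\<C> \<in> screen_metrics A K N // conformal_rel A K N"
      using cs unfolding conformal_screen_structure_def by auto
    \<comment> \<open>It suffices to realise one representative \<open>h\<close> by a metric;
      \<open>induced_class\<close> then gives the whole conformal class.\<close>
    obtain h where hC: "h \<in> screen_metrics A K N" "\<C> = conformal_rel A K N `` {h}"
      using C unfolding quotient_def by blast
    interpret oriented_line A K ik il e n by (rule oriented_line[OF D(1)])
    obtain F :: "('m set \<times> (nat \<Rightarrow> 'm \<Rightarrow> real^'d)) set" where F1: "(\<Union>(U, X)\<in>F. U) = UNIV"
      and F2: "\<forall>(U, X)\<in>F. open U \<and> (\<forall>i<n. smooth_section A N U (X i)) \<and>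
           (\<forall>p\<in>U. N p = span (K p \<union> (\<lambda>i. X i p) ` {..<n}))"
      and F3: "\<forall>(U, X)\<in>F. \<forall>(V, Y)\<in>F. \<forall>p\<in>U \<inter> V. \<forall>a :: nat \<Rightarrow> nat \<Rightarrow> real.
           (\<forall>j<n. Y j p - (\<Sum>i<n. a i j *\<^sub>R X i p) \<in> K p) \<longrightarrow>
           (\<Sum>\<pi> | \<pi> permutes {..<n}. of_int (sign \<pi>) * (\<Prod>i<n. a i (\<pi> i))) > 0"
      using so unfolding screen_orientable_def by (elim exE conjE)
    interpret screen_structure A K ik il e n N h F
    proof
      show "distribution A (n + 1) N" "\<And>p. K p \<subseteq> N p" "h \<in> screen_metrics A K N" using D hC by auto
      show "\<exists>U X. (U, X) \<in> F \<and> p \<in> U" for p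
      proof -
        have "p \<in> (\<Union>(U, X)\<in>F. U)" using F1 by simp
        then show ?thesis by auto
      qed
      show "open U \<and> (\<forall>i<n. smooth_section A N U (X i)) \<and>
           (\<forall>p\<in>U. N p = span (K p \<union> (\<lambda>i. X i p) ` {..<n}))" if "(U, X) \<in> F" for U X
        using bspec[OF F2 that] by simp
      show "(\<Sum>\<pi> | \<pi> permutes {..<n}. of_int (sign \<pi>) * (\<Prod>i<n. a i (\<pi> i :: nat))) > (0::real)"
        if "(U, X) \<in> F" "(V, Y) \<in> F" "p \<in> U" "p \<in> V"
          "\<And>j. j < n \<Longrightarrow> Y j p - (\<Sum>i<n. a i j *\<^sub>R X i p) \<in> K p" for U X V Y p a
        using bspec[OF F3 that(1), unfolded case_prod_conv, THEN bspec, OF that(2), unfolded case_prod_conv] that(3-5)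
        by blast
    qed
    obtain g where g: "g \<in> null_metrics A K" "orth K g = N" "screen_metric_of K N g = h"
      by (rule metric_exists)
    have "generalised_optical_structure A K (optical_rel A K `` {g})"
      unfolding generalised_optical_structure_def using line g(1) by (simp add: quotientI)
    moreover have "?I (K, optical_rel A K `` {g}) = (K, N, \<C>)"
      unfolding induced_class[OF g(1)] g(2,3) hC(2) by simp
    ultimately show ?thesis by blast
  qed
  have "?I ` ?S = ?T"
  proof
    show "?I ` ?S \<subseteq> ?T"
    proof (rule image_subsetI)
      fix s assume "s \<in> ?S"
      then obtain K \<O> where "s = (K, \<O>)" "generalised_optical_structure A K \<O>" by blast
      then show "?I s \<in> ?T" using maps[of K \<O>] by simp
    qed
    show "?T \<subseteq> ?I ` ?S"
    proof clarify
      fix K N \<C> assume "conformal_screen_structure A n K N \<C>" "screen_orientable A n K N"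
      then obtain \<O> where "generalised_optical_structure A K \<O>" "?I (K, \<O>) = (K, N, \<C>)"
        using surj by blast
      then show "(K, N, \<C>) \<in> ?I ` ?S" by (intro image_eqI[of _ _ "(K, \<O>)"]) auto
    qed
  qed
  then have bij: "bij_betw ?I ?S ?T" using inj unfolding bij_betw_def by blast
  have "(\<exists>K \<O>. generalised_optical_structure A K \<O>) \<longleftrightarrow>
      (\<exists>K N \<C>. conformal_screen_structure A n K N \<C> \<and> screen_orientable A n K N)"
  proof
    assume "\<exists>K \<O>. generalised_optical_structure A K \<O>"
    then obtain K \<O> where "generalised_optical_structure A K \<O>" by blast
    then have "?I (K, \<O>) \<in> ?T" by (rule maps)
    moreover obtain K1 N \<C> where "?I (K, \<O>) = (K1, N, \<C>)" by (rule prod_cases3)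
    ultimately have "conformal_screen_structure A n K1 N \<C> \<and> screen_orientable A n K1 N" by simp
    then show "\<exists>K N \<C>. conformal_screen_structure A n K N \<C> \<and> screen_orientable A n K N" by blast
  next
    assume "\<exists>K N \<C>. conformal_screen_structure A n K N \<C> \<and> screen_orientable A n K N"
    then show "\<exists>K \<O>. generalised_optical_structure A K \<O>" using surj by blast
  qed
  then show ?thesis using bij by (rule conjI)
qed

end
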